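(* Let $(L/K,v)$ be a simple algebraic extension of valued fields, $L=K(\eta)$, with $e(L/K,v)=[vL:vK]=1$ and $v(\eta)=0$. Let $\mathbf Q=\{Q_i\}_{i\in I}$ be a complete sequence of key polynomials for the induced valuation $\nu$ on $K[x]$, normalized as described in the context, and assume that $\mathbf Q$ is successively strongly monic and that $\tilde{\mathbf Q}$ (together with the fixed full $i$-th expansions of $\tilde Q_\ell$, for neat pairs $(\ell,i)$) is neat. Let $\mathcal O_K$ be the valuation ring of $v|_K$ and let $\mathcal I$ be the kernel of the $\mathcal O_K$-algebra homomorphism $\mathcal O_K[\mathbf X]=\mathcal O_K[X_i\mid i\in I^*]\to L$ given by $X_i\mapsto \tilde Q_i(\eta)$. Let $$\mathcal I_1=\left(b_{\ell i}X_\ell-Q_{\ell i}\ \middle|\ i,\ell\in I^*,\ (\ell,i)\text{ is neat}\right)\mathcal O_K[\mathbf X],$$ $$\mathcal I_2=\left(Q_{i_{\max}i}\ \middle|\ i\in I^*,\ Q_i<_{\rm succ}Q_{i_{\max}}\right)\mathcal O_K[\mathbf X].$$ Then $$\mathcal I=\mathcal I_1+\mathcal I_2.$$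
   Context: **Valuation on $K[x]$.** $\nu(f):=v(f(\eta))$ for $f\in K[x]$ (so $\nu(f)=\infty$ iff the monic minimal polynomial $g$ of $\eta$ over $K$ divides $f$). For a monic nonconstant $q\in K[x]$ and $f=f_0+f_1q+\dots+f_nq^n$ with $\deg f_j<\deg q$ (the $q$-expansion of $f$), the truncation of $\nu$ at $q$ is $\nu_q(f)=\min_j\nu(f_jq^j)$. A set $\mathbf Q\subseteq K[x]\setminus K$ is complete for $\nu$ if for every $f\in K[x]\setminus K$ there is $q\in\mathbf Q$ with $\deg q\le\deg f$ and $\nu_q(f)=\nu(f)$. **Key polynomials.** Fix an extension $\overline\nu$ of $\nu$ to $\overline K[x]$, $\overline K$ an algebraic closure of $K$. For $f\in K[x]\setminus K$ put $\epsilon(f)=\max\{\overline\nu(x-a)\mid a\text{ a root of }f\}$. A monic $Q\in K[x]\setminus K$ is a key polynomial for $\nu$ if $\epsilon(f)<\epsilon(Q)$ for all $f\in K[x]\setminus K$ with $\deg f<\deg Q$. A complete sequence of key polynomials is a family $\mathbf Q=\{Q_i\}_{i\in I}$ of key polynomials, $I$ well ordered, $i\mapsto\epsilon(Q_i)$ strictly increasing, which is a complete set for $\nu$. Then $I$ has a largest element $i_{\max}$ and $Q_{i_{\max}}=g$. Put $I^*=I\setminus\{i_{\max}\}$ and $\nu_i:=\nu_{Q_i}$ for $i\in I^*$. **Normalizations (standing assumptions).** Let $1=n_1<n_2<\dots<n_{w+1}=\deg g$ be the degrees of the elements of $\mathbf Q$ and $I^{(q)}=\{i\in I\mid\deg Q_i=n_q\}$,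 so $I=\coprod_{q=1}^{w+1}I^{(q)}$, $I^{(1)}<\dots<I^{(w)}<I^{(w+1)}=\{i_{\max}\}$. Each $I^{(q)}$ is either a singleton or order-isomorphic to $\mathbb N$. For $n=n_q$ with $q\le w$, put $n_+=n_{q+1}$. Let $\ell_q$ be the smallest element of $I^{(q)}$; for $\ell\in I$, $q_\ell$ is the unique index with $\ell\in I^{(q_\ell)}$; for $i\in I^{(q)}$, $i-\ell_q\in\mathbb N$ is the number of elements of $I^{(q)}$ strictly smaller than $i$; $i+1$ is the immediate successor of $i$ in $I$. For $i\in I^*$ choose $a_i\in K$ with $v(a_i)=\nu(Q_i)$ and put $\tilde Q_i=Q_i/a_i$; put $\tilde Q_{i_{\max}}=g$. One has $\tilde Q_{\ell_1}=x$. $\tilde{\mathbf Q}=\{\tilde Q_i\}_{i\in I}$. For $\lambda:I\to\mathbb N$ with finite support, $\tilde{\mathbf Q}^\lambda=\prod_i\tilde Q_i^{\lambda(i)}$, and, for $\lambda$ supported in $I^*$, $\mathbf X^\lambda=\prod_iX_i^{\lambda(i)}$, where $\mathbf X=\{X_i\}_{i\in I^*}$ are independent variables. **Full $i$-th expansions.** For $i\in I^*$ and $0\ne f\in K[x]$, a full $i$-th expansion of $f$ is an expression $f=\sum_{j=1}^rb_j\tilde{\mathbf Q}^{\lambda_j}$, $b_j\in K$, with $\lambda_j(k)=0$ for $k>i$, such that: (1) $\nu_i(f)=\min_{1\le j\le r}v(b_j)$; (2) if $k<i$ then $\lambda_j(k)<(\deg Q_k)_+/\deg Q_k$ for all $j$;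 (3) for each $q\in\{1,\dots,w\}$ there is at most one $k\in I^{(q)}$ such that $\tilde Q_k$ appears (i.e. $\lambda_j(k)>0$ for some $j$); this $k$ is denoted $j(f,q)$, and $j(f,q)=-\infty$ if there is none. The expansion is neat if there is $s\in\mathbb N$ with $j(f,q)-\ell_q=s$ for all $q\in\{1,\dots,w\}$ such that $\#I^{(q)}=\infty$ and $j(f,q)>-\infty$; it is then neat of level $s$ if the set of such $q$ is non-empty, and neat of level $0$ if that set is empty. **Successors and neat pairs.** For $i<\ell$ in $I$, write $Q_i<_{\rm succ}Q_\ell$ if either $\ell=i+1$, or $\#I^{(q_i)}=\infty$ and $q_\ell=q_i+1$. For such a pair the level is $s(\ell,i)=i-\ell_{q_i}$ if $\ell=i+1$, and $s(\ell,i)=\max\{i-\ell_{q_i},\ell-\ell_{q_\ell}\}$ otherwise. The pair $(\ell,i)$ (with $Q_i<_{\rm succ}Q_\ell$) is neat if the following implication holds: if $q_i\ne q_\ell$ and $\#I^{(q_i)}=\#I^{(q_\ell)}=\infty$, then $i-\ell_{q_i}=\ell-\ell_{q_\ell}$. **Successively strongly monic.** For $Q_i<_{\rm succ}Q_\ell$ with $Q_i$-expansion $Q_\ell=\sum_{j=0}^{r_{\ell i}}q_jQ_i^j$ ($q_{r_{\ell i}}\neq 0$), $Q_\ell$ is strongly $Q_i$-monic if $q_{r_{\ell i}}=1$ and $\nu(Q_i^{r_{\ell i}})=\nu_i(Q_\ell)$. $\mathbf Q$ is successively strongly monic if this holds for all $i,\ell\in I^*$ with $Q_i<_{\rm succ}Q_\ell$.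 **Neatness of $\tilde{\mathbf Q}$, and $b_{\ell i}$, $Q_{\ell i}$.** For each neat pair $(\ell,i)$, $i,\ell\in I$, fix a full $i$-th expansion $\tilde Q_\ell=\sum_{j=1}^rb_{\ell ij}\tilde{\mathbf Q}^{\lambda_j}$. $\tilde{\mathbf Q}$ is neat if for every neat pair $(\ell,i)$ this expansion is neat of level $s(\ell,i)$. Fix $b_{\ell i}\in K$ with $v(b_{\ell i})=-\nu_i(\tilde Q_\ell)=-\min_jv(b_{\ell ij})$; when $\ell\neq i_{\max}$, after renumbering so that $\tilde{\mathbf Q}^{\lambda_1}$ is divisible by $\tilde Q_i$ but by no $\tilde Q_{i'}$ with $i'<i$ and $v(b_{\ell i1})=\nu_i(\tilde Q_\ell)$ (possible by strong monicity), take $b_{\ell i}=1/b_{\ell i1}$. Put $Q_{\ell i}=b_{\ell i}\sum_jb_{\ell ij}\mathbf X^{\lambda_j}\in\mathcal O_K[\mathbf X]$. *)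

theory Defs
  imports
    "HOL-Algebra.Algebraic_Closure_Type"
    "HOL-Algebra.Generated_Fields"
    "HOL-Algebra.Ideal"
    "HOL-Library.Extended"
    "HOL-Library.Poly_Mapping"
begin

section \<open>Valuations and valued field extensions\<close>

text \<open>
  Krull valuations of arbitrary rank, written additively. Values lie in an ordered abelian group
  extended by \<open>\<infinity>\<close>; the element \<open>-\<infinity>\<close> of \<^typ>\<open>'g extended\<close> is never taken. Nonzero elements
  may have value \<open>\<infinity>\<close>. No surjectivity is required, so a single group can accommodate the values
  of a valuation and of its extensions.
\<close>

definition ring_valuation :: "('r::comm_ring_1 \<Rightarrow> 'g::linordered_ab_group_add extended) \<Rightarrow> bool"
  where "ring_valuation v \<longleftrightarrow>
    (\<forall>x. v x \<noteq> -\<infinity>) \<and> v 0 = \<infinity> \<and> v 1 = 0 \<and>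
    (\<forall>x y. v (x * y) = v x + v y) \<and> (\<forall>x y. min (v x) (v y) \<le> v (x + y))"

definition field_valuation :: "('l::field \<Rightarrow> 'g::linordered_ab_group_add extended) \<Rightarrow> bool"
  where "field_valuation v \<longleftrightarrow> ring_valuation v \<and> (\<forall>x. v x = \<infinity> \<longrightarrow> x = 0)"

definition value_group :: "('l \<Rightarrow> 'g extended) \<Rightarrow> 'g set"
  where "value_group v = {\<gamma>. \<exists>x. v x = Fin \<gamma>}"

text \<open>
  The field \<open>K\<close> is embedded in \<open>L\<close> by \<open>\<iota>\<close>; its valuation is \<open>v \<circ> \<iota>\<close>. The ramification index is the
  number of cosets of \<open>vK\<close> in \<open>vL\<close> (0 if infinite).
\<close>

definition ramification_index :: "('k \<Rightarrow> 'l) \<Rightarrow> ('l \<Rightarrow> 'g::linordered_ab_group_add extended) \<Rightarrow> nat"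
  where "ramification_index \<iota> v =
    card ((\<lambda>\<gamma>. (+) \<gamma> ` value_group (v \<circ> \<iota>)) ` value_group v)"

definition field_embedding :: "('k::field \<Rightarrow> 'l::field) \<Rightarrow> bool"
  where "field_embedding \<iota> \<longleftrightarrow> \<iota> \<in> ring_hom ring_of_type_algebra ring_of_type_algebra"

definition simple_algebraic_extension :: "('k::field \<Rightarrow> 'l::field) \<Rightarrow> 'l \<Rightarrow> bool"
  where "simple_algebraic_extension \<iota> \<eta> \<longleftrightarrow>
    field_embedding \<iota> \<and>
    (\<forall>y. \<exists>p. p \<noteq> 0 \<and> poly (map_poly \<iota> p) y = 0) \<and>
    generate_field ring_of_type_algebra (insert \<eta> (range \<iota>)) = UNIV"

definition min_poly :: "('k::field \<Rightarrow> 'l::field) \<Rightarrow> 'l \<Rightarrow> 'k poly"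
  where "min_poly \<iota> \<eta> = (THE g. Polynomial.lead_coeff g = 1 \<and> poly (map_poly \<iota> g) \<eta> = 0 \<and>
    (\<forall>h. h \<noteq> 0 \<and> poly (map_poly \<iota> h) \<eta> = 0 \<longrightarrow> Polynomial.degree g \<le> Polynomial.degree h))"


section \<open>Truncations and key polynomials\<close>

definition nu :: "('k::field \<Rightarrow> 'l::field) \<Rightarrow> ('l \<Rightarrow> 'g extended) \<Rightarrow> 'l \<Rightarrow> 'k poly \<Rightarrow> 'g extended"
  where "nu \<iota> v \<eta> f = v (poly (map_poly \<iota> f) \<eta>)"

text \<open>
  The \<open>q\<close>-expansion \<open>f = f\<^sub>0 + f\<^sub>1 q + \<dots> + f\<^sub>n q\<^sup>n\<close>, for monic nonconstant \<open>q\<close>, as a polynomial with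
  coefficients \<open>f\<^sub>j\<close> in \<open>K[x]\<close>.
\<close>

definition q_expansion :: "'k::field poly \<Rightarrow> 'k poly \<Rightarrow> 'k poly poly"
  where "q_expansion q f = (THE F. poly F q = f \<and>
    (\<forall>j. Polynomial.degree (Polynomial.coeff F j) < Polynomial.degree q))"

definition truncation ::
    "('k::field poly \<Rightarrow> 'g::linorder extended) \<Rightarrow> 'k poly \<Rightarrow> 'k poly \<Rightarrow> 'g extended"
  where "truncation \<nu> q f =
    Min ((\<lambda>j. \<nu> (Polynomial.coeff (q_expansion q f) j * q ^ j)) `
      {..Polynomial.degree (q_expansion q f)})"

definition complete_set :: "('k::field poly \<Rightarrow> 'g::linorder extended) \<Rightarrow> 'k poly set \<Rightarrow> bool"
  where "complete_set \<nu> S \<longleftrightarrow>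
    (\<forall>f. 0 < Polynomial.degree f \<longrightarrow>
      (\<exists>q\<in>S. Polynomial.degree q \<le> Polynomial.degree f \<and> truncation \<nu> q f = \<nu> f))"

definition extends_to_closure ::
    "('k::field alg_closure poly \<Rightarrow> 'g::linordered_ab_group_add extended) \<Rightarrow>
      ('k poly \<Rightarrow> 'g extended) \<Rightarrow> bool"
  where "extends_to_closure \<nu>bar \<nu> \<longleftrightarrow>
    ring_valuation \<nu>bar \<and> (\<forall>f. \<nu>bar (map_poly to_ac f) = \<nu> f)"

definition epsilon ::
    "('k::field alg_closure poly \<Rightarrow> 'g::linorder extended) \<Rightarrow> 'k poly \<Rightarrow> 'g extended"
  where "epsilon \<nu>bar f = Max ((\<lambda>a. \<nu>bar [:- a, 1:]) ` {a. poly (map_poly to_ac f) a = 0})"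

definition key_polynomial ::
    "('k::field alg_closure poly \<Rightarrow> 'g::linorder extended) \<Rightarrow> 'k poly \<Rightarrow> bool"
  where "key_polynomial \<nu>bar q \<longleftrightarrow>
    Polynomial.lead_coeff q = 1 \<and> 0 < Polynomial.degree q \<and>
    (\<forall>f. 0 < Polynomial.degree f \<and> Polynomial.degree f < Polynomial.degree q \<longrightarrow>
      epsilon \<nu>bar f < epsilon \<nu>bar q)"

text \<open>The well-ordered index set \<open>I\<close> is the universe of the type \<^typ>\<open>'i\<close>.\<close>

definition complete_key_sequence ::
    "('k::field poly \<Rightarrow> 'g::linorder extended) \<Rightarrow> ('k alg_closure poly \<Rightarrow> 'g extended) \<Rightarrow>
      ('i::wellorder \<Rightarrow> 'k poly) \<Rightarrow> bool"
  where "complete_key_sequence \<nu> \<nu>bar Q \<longleftrightarrow>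
    (\<forall>i. key_polynomial \<nu>bar (Q i)) \<and> strict_mono (\<lambda>i. epsilon \<nu>bar (Q i)) \<and>
    complete_set \<nu> (range Q)"


section \<open>The index set\<close>

definition imax :: "'i::wellorder"
  where "imax = (GREATEST i. True)"

abbreviation Istar :: "'i::wellorder set"
  where "Istar \<equiv> - {imax}"

definition key_degrees :: "('i \<Rightarrow> 'k::zero poly) \<Rightarrow> nat set"
  where "key_degrees Q = range (\<lambda>i. Polynomial.degree (Q i))"

text \<open>The degrees are \<open>n\<^sub>1 < \<dots> < n\<^bsub>w+1\<^esub>\<close>, numbered from 1.\<close>

definition ww :: "('i \<Rightarrow> 'k::zero poly) \<Rightarrow> nat"
  where "ww Q = card (key_degrees Q) - 1"

definition nn :: "('i \<Rightarrow> 'k::zero poly) \<Rightarrow> nat \<Rightarrow> nat"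
  where "nn Q q = sorted_list_of_set (key_degrees Q) ! (q - 1)"

definition block :: "('i \<Rightarrow> 'k::zero poly) \<Rightarrow> nat \<Rightarrow> 'i set"
  where "block Q q = {i. Polynomial.degree (Q i) = nn Q q}"

definition block_index :: "('i \<Rightarrow> 'k::zero poly) \<Rightarrow> 'i \<Rightarrow> nat"
  where "block_index Q i = (THE q. q \<in> {1..ww Q + 1} \<and> i \<in> block Q q)"

definition block_least :: "('i::wellorder \<Rightarrow> 'k::zero poly) \<Rightarrow> nat \<Rightarrow> 'i"
  where "block_least Q q = (LEAST i. i \<in> block Q q)"

text \<open>\<open>i - \<ell>\<^sub>q\<close> for \<open>i \<in> I\<^sup>(\<^sup>q\<^sup>)\<close>:\<close>

definition offset :: "('i::wellorder \<Rightarrow> 'k::zero poly) \<Rightarrow> 'i \<Rightarrow> nat"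
  where "offset Q i = card {k \<in> block Q (block_index Q i). k < i}"

text \<open>\<open>(deg Q\<^sub>k)\<^sub>+\<close>:\<close>

definition degree_plus :: "('i \<Rightarrow> 'k::zero poly) \<Rightarrow> 'i \<Rightarrow> nat"
  where "degree_plus Q k = nn Q (block_index Q k + 1)"

definition immediate_succ :: "'i::wellorder \<Rightarrow> 'i \<Rightarrow> bool"
  where "immediate_succ i l \<longleftrightarrow> i < l \<and> (\<forall>k. \<not> (i < k \<and> k < l))"

definition succ_rel :: "('i::wellorder \<Rightarrow> 'k::zero poly) \<Rightarrow> 'i \<Rightarrow> 'i \<Rightarrow> bool"
  where "succ_rel Q i l \<longleftrightarrow> i < l \<and> (immediate_succ i l \<or>
    (infinite (block Q (block_index Q i)) \<and> block_index Q l = block_index Q i + 1))"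

definition pair_level :: "('i::wellorder \<Rightarrow> 'k::zero poly) \<Rightarrow> 'i \<Rightarrow> 'i \<Rightarrow> nat"
  where "pair_level Q l i =
    (if immediate_succ i l then offset Q i else max (offset Q i) (offset Q l))"

definition neat_pair :: "('i::wellorder \<Rightarrow> 'k::zero poly) \<Rightarrow> 'i \<Rightarrow> 'i \<Rightarrow> bool"
  where "neat_pair Q l i \<longleftrightarrow> succ_rel Q i l \<and>
    (block_index Q i \<noteq> block_index Q l \<and>
      infinite (block Q (block_index Q i)) \<and> infinite (block Q (block_index Q l)) \<longrightarrow>
      offset Q i = offset Q l)"

definition Qtilde ::
    "('k::field \<Rightarrow> 'l::field) \<Rightarrow> 'l \<Rightarrow> ('i::wellorder \<Rightarrow> 'k poly) \<Rightarrow> ('i \<Rightarrow> 'k) \<Rightarrow> 'i \<Rightarrow> 'k poly"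
  where "Qtilde \<iota> \<eta> Q a i =
    (if i = imax then min_poly \<iota> \<eta> else Polynomial.smult (inverse (a i)) (Q i))"

text \<open>
  The normalization \<open>\<tilde>Q\<close> of the first key polynomial to \<open>x\<close> is required only if it lies in \<open>I\<^sup>*\<close>; it
  does unless \<open>L = K\<close>, in which case \<open>I\<close> is a singleton.
\<close>

definition normalized ::
    "('k::field \<Rightarrow> 'l::field) \<Rightarrow> ('l \<Rightarrow> 'g extended) \<Rightarrow> 'l \<Rightarrow>
      ('i::wellorder \<Rightarrow> 'k poly) \<Rightarrow> ('i \<Rightarrow> 'k) \<Rightarrow> bool"
  where "normalized \<iota> v \<eta> Q a \<longleftrightarrow>
    block Q (ww Q + 1) = {imax} \<and>
    (\<forall>q\<in>{1..ww Q + 1}. is_singleton (block Q q) \<or>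
      (\<exists>f :: nat \<Rightarrow> 'i. strict_mono f \<and> block Q q = range f)) \<and>
    (\<forall>i\<in>Istar. v (\<iota> (a i)) = nu \<iota> v \<eta> (Q i)) \<and>
    (block_least Q 1 \<in> Istar \<longrightarrow> Qtilde \<iota> \<eta> Q a (block_least Q 1) = [:0, 1:])"

definition strongly_monic ::
    "('k::field poly \<Rightarrow> 'g::linorder extended) \<Rightarrow> 'k poly \<Rightarrow> 'k poly \<Rightarrow> bool"
  where "strongly_monic \<nu> q f \<longleftrightarrow>
    Polynomial.lead_coeff (q_expansion q f) = 1 \<and>
    \<nu> (q ^ Polynomial.degree (q_expansion q f)) = truncation \<nu> q f"

definition successively_strongly_monic ::
    "('k::field poly \<Rightarrow> 'g::linorder extended) \<Rightarrow> ('i::wellorder \<Rightarrow> 'k poly) \<Rightarrow> bool"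
  where "successively_strongly_monic \<nu> Q \<longleftrightarrow>
    (\<forall>i\<in>Istar. \<forall>l\<in>Istar. succ_rel Q i l \<longrightarrow> strongly_monic \<nu> (Q i) (Q l))"


section \<open>Polynomials in the variables \<open>X\<^sub>i\<close> and full expansions\<close>

text \<open>
  Exponents are finitely supported maps \<^typ>\<open>'i \<Rightarrow>\<^sub>0 nat\<close>, and polynomials in the variables \<open>X\<^sub>i\<close> over
  \<open>K\<close> are finitely supported maps \<^typ>\<open>('i \<Rightarrow>\<^sub>0 nat) \<Rightarrow>\<^sub>0 'k\<close>, multiplied by convolution.
\<close>

definition monom_eval :: "('i \<Rightarrow> 'r::comm_ring_1) \<Rightarrow> ('i \<Rightarrow>\<^sub>0 nat) \<Rightarrow> 'r"
  where "monom_eval x m = (\<Prod>k\<in>Poly_Mapping.keys m. x k ^ Poly_Mapping.lookup m k)"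

definition mpoly_eval ::
    "('k::zero \<Rightarrow> 'r::comm_ring_1) \<Rightarrow> ('i \<Rightarrow> 'r) \<Rightarrow> (('i \<Rightarrow>\<^sub>0 nat) \<Rightarrow>\<^sub>0 'k) \<Rightarrow> 'r"
  where "mpoly_eval h x P =
    (\<Sum>m\<in>Poly_Mapping.keys P. h (Poly_Mapping.lookup P m) * monom_eval x m)"

definition mconst :: "'k::zero \<Rightarrow> (('i \<Rightarrow>\<^sub>0 nat) \<Rightarrow>\<^sub>0 'k)"
  where "mconst c = Poly_Mapping.single 0 c"

definition mvar :: "'i \<Rightarrow> (('i \<Rightarrow>\<^sub>0 nat) \<Rightarrow>\<^sub>0 'k::zero_neq_one)"
  where "mvar i = Poly_Mapping.single (Poly_Mapping.single i 1) 1"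

definition appears :: "(('i \<Rightarrow>\<^sub>0 nat) \<Rightarrow>\<^sub>0 'k::zero) \<Rightarrow> 'i \<Rightarrow> bool"
  where "appears F k \<longleftrightarrow> (\<exists>m\<in>Poly_Mapping.keys F. 0 < Poly_Mapping.lookup m k)"

text \<open>
  An expression \<open>\<Sum>\<^sub>j b\<^sub>j \<tilde>Q\<^bsup>\<lambda>\<^sub>j\<^esup>\<close>, with distinct \<open>\<lambda>\<^sub>j\<close> and nonzero \<open>b\<^sub>j\<close>, is recorded as the polynomial
  \<open>F = \<Sum>\<^sub>j b\<^sub>j X\<^bsup>\<lambda>\<^sub>j\<^esup>\<close>. The parameter \<open>T\<close> is the family of the \<open>\<tilde>Q\<^sub>k\<close>, and \<open>vK\<close> is the valuation of \<open>K\<close>.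
\<close>

definition full_expansion ::
    "('k::field poly \<Rightarrow> 'g::linorder extended) \<Rightarrow> ('k \<Rightarrow> 'g extended) \<Rightarrow>
      ('i::wellorder \<Rightarrow> 'k poly) \<Rightarrow> ('i \<Rightarrow> 'k poly) \<Rightarrow> 'i \<Rightarrow> 'k poly \<Rightarrow>
      (('i \<Rightarrow>\<^sub>0 nat) \<Rightarrow>\<^sub>0 'k) \<Rightarrow> bool"
  where "full_expansion \<nu> vK Q T i f F \<longleftrightarrow>
    i \<in> Istar \<and> f \<noteq> 0 \<and>
    f = mpoly_eval (\<lambda>c. [:c:]) T F \<and>
    (\<forall>m\<in>Poly_Mapping.keys F. \<forall>k. i < k \<longrightarrow> Poly_Mapping.lookup m k = 0) \<and>
    truncation \<nu> (Q i) f =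
      Min ((\<lambda>m. vK (Poly_Mapping.lookup F m)) ` Poly_Mapping.keys F) \<and>
    (\<forall>m\<in>Poly_Mapping.keys F. \<forall>k. k < i \<longrightarrow>
      real (Poly_Mapping.lookup m k) < real (degree_plus Q k) / real (Polynomial.degree (Q k))) \<and>
    (\<forall>q\<in>{1..ww Q}. \<forall>k\<in>block Q q. \<forall>k'\<in>block Q q. appears F k \<and> appears F k' \<longrightarrow> k = k')"

text \<open>\<open>j(f, q)\<close>, with \<^const>\<open>None\<close> for \<open>-\<infinity>\<close>:\<close>

definition jj ::
    "('i \<Rightarrow> 'k::zero poly) \<Rightarrow> (('i \<Rightarrow>\<^sub>0 nat) \<Rightarrow>\<^sub>0 'k) \<Rightarrow> nat \<Rightarrow> 'i option"
  where "jj Q F q =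
    (if \<exists>k\<in>block Q q. appears F k then Some (THE k. k \<in> block Q q \<and> appears F k) else None)"

definition neat_of_level ::
    "('i::wellorder \<Rightarrow> 'k::zero poly) \<Rightarrow> (('i \<Rightarrow>\<^sub>0 nat) \<Rightarrow>\<^sub>0 'k) \<Rightarrow> nat \<Rightarrow> bool"
  where "neat_of_level Q F s \<longleftrightarrow>
    (let A = {q \<in> {1..ww Q}. infinite (block Q q) \<and> jj Q F q \<noteq> None}
     in (\<forall>q\<in>A. offset Q (the (jj Q F q)) = s) \<and> (A = {} \<longrightarrow> s = 0))"

text \<open>
  \<open>E l i\<close> is the chosen full \<open>i\<close>-th expansion of \<open>\<tilde>Q\<^sub>l\<close>. Values of \<open>E\<close> outside neat pairs are
  irrelevant.
\<close>

definition neat_family ::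
    "('k::field poly \<Rightarrow> 'g::linorder extended) \<Rightarrow> ('k \<Rightarrow> 'g extended) \<Rightarrow>
      ('i::wellorder \<Rightarrow> 'k poly) \<Rightarrow> ('i \<Rightarrow> 'k poly) \<Rightarrow>
      ('i \<Rightarrow> 'i \<Rightarrow> (('i \<Rightarrow>\<^sub>0 nat) \<Rightarrow>\<^sub>0 'k)) \<Rightarrow> bool"
  where "neat_family \<nu> vK Q T E \<longleftrightarrow>
    (\<forall>l i. neat_pair Q l i \<longrightarrow>
      full_expansion \<nu> vK Q T i (T l) (E l i) \<and> neat_of_level Q (E l i) (pair_level Q l i))"

definition admissible_scalars ::
    "('k::field poly \<Rightarrow> 'g::linordered_ab_group_add extended) \<Rightarrow> ('k \<Rightarrow> 'g extended) \<Rightarrow>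
      ('i::wellorder \<Rightarrow> 'k poly) \<Rightarrow> ('i \<Rightarrow> 'k poly) \<Rightarrow>
      ('i \<Rightarrow> 'i \<Rightarrow> (('i \<Rightarrow>\<^sub>0 nat) \<Rightarrow>\<^sub>0 'k)) \<Rightarrow> ('i \<Rightarrow> 'i \<Rightarrow> 'k) \<Rightarrow> bool"
  where "admissible_scalars \<nu> vK Q T E b \<longleftrightarrow>
    (\<forall>l i. neat_pair Q l i \<longrightarrow>
      vK (b l i) = - truncation \<nu> (Q i) (T l) \<and>
      (l \<noteq> imax \<longrightarrow>
        (\<exists>m\<in>Poly_Mapping.keys (E l i).
          T i dvd monom_eval T m \<and> (\<forall>i'<i. \<not> T i' dvd monom_eval T m) \<and>
          vK (Poly_Mapping.lookup (E l i) m) = truncation \<nu> (Q i) (T l) \<and>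
          b l i = 1 / Poly_Mapping.lookup (E l i) m)))"

text \<open>\<open>Q\<^bsub>l i\<^esub>\<close>:\<close>

definition QQ ::
    "('i \<Rightarrow> 'i \<Rightarrow> (('i \<Rightarrow>\<^sub>0 nat) \<Rightarrow>\<^sub>0 'k::comm_ring_1)) \<Rightarrow> ('i \<Rightarrow> 'i \<Rightarrow> 'k) \<Rightarrow>
      'i \<Rightarrow> 'i \<Rightarrow> (('i \<Rightarrow>\<^sub>0 nat) \<Rightarrow>\<^sub>0 'k)"
  where "QQ E b l i = mconst (b l i) * E l i"

text \<open>The ring \<open>\<O>\<^sub>K[X\<^sub>i | i \<in> I\<^sup>*]\<close>, as a subring of the polynomial ring over \<open>K\<close>:\<close>

definition OKX :: "('k::field \<Rightarrow> 'g::linordered_ab_group_add extended) \<Rightarrow>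
    (('i::wellorder \<Rightarrow>\<^sub>0 nat) \<Rightarrow>\<^sub>0 'k) ring"
  where "OKX vK = ring_of_type_algebra
    \<lparr>carrier := {P. \<forall>m\<in>Poly_Mapping.keys P.
      0 \<le> vK (Poly_Mapping.lookup P m) \<and> Poly_Mapping.keys m \<subseteq> Istar}\<rparr>"

definition relation_ideal ::
    "('k::field \<Rightarrow> 'l::field) \<Rightarrow> ('l \<Rightarrow> 'g::linordered_ab_group_add extended) \<Rightarrow> 'l \<Rightarrow>
      ('i::wellorder \<Rightarrow> 'k poly) \<Rightarrow> (('i \<Rightarrow>\<^sub>0 nat) \<Rightarrow>\<^sub>0 'k) set"
  where "relation_ideal \<iota> v \<eta> T =
    a_kernel (OKX (v \<circ> \<iota>)) ring_of_type_algebra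
      (mpoly_eval \<iota> (\<lambda>i. poly (map_poly \<iota> (T i)) \<eta>))"

definition ideal_I1 ::
    "('k::field \<Rightarrow> 'g::linordered_ab_group_add extended) \<Rightarrow> ('i::wellorder \<Rightarrow> 'k poly) \<Rightarrow>
      ('i \<Rightarrow> 'i \<Rightarrow> (('i \<Rightarrow>\<^sub>0 nat) \<Rightarrow>\<^sub>0 'k)) \<Rightarrow> ('i \<Rightarrow> 'i \<Rightarrow> 'k) \<Rightarrow>
      (('i \<Rightarrow>\<^sub>0 nat) \<Rightarrow>\<^sub>0 'k) set"
  where "ideal_I1 vK Q E b = genideal (OKX vK)
    {mconst (b l i) * mvar l - QQ E b l i | i l. i \<in> Istar \<and> l \<in> Istar \<and> neat_pair Q l i}"

definition ideal_I2 ::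
    "('k::field \<Rightarrow> 'g::linordered_ab_group_add extended) \<Rightarrow> ('i::wellorder \<Rightarrow> 'k poly) \<Rightarrow>
      ('i \<Rightarrow> 'i \<Rightarrow> (('i \<Rightarrow>\<^sub>0 nat) \<Rightarrow>\<^sub>0 'k)) \<Rightarrow> ('i \<Rightarrow> 'i \<Rightarrow> 'k) \<Rightarrow>
      (('i \<Rightarrow>\<^sub>0 nat) \<Rightarrow>\<^sub>0 'k) set"
  where "ideal_I2 vK Q E b = genideal (OKX vK)
    {QQ E b imax i | i. i \<in> Istar \<and> succ_rel Q i imax}"

end

theory Submission
  imports Defs
begin

text \<open>
  An element \<open>F\<close> of the kernel becomes, after substituting \<open>\<tilde>Q\<^sub>i\<close> for \<open>X\<^sub>i\<close>, a multiple \<open>g h\<close> of \<open>g\<close> in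
  \<open>K[x]\<close>. For a late \<open>k\<close> in the last block of \<open>I\<^sup>*\<close>, the truncation \<open>\<nu>\<^sub>k\<close> is nonnegative on \<open>g h\<close>; as it is
  multiplicative, it is nonnegative on \<open>h / b\<close>, where \<open>b = b\<^bsub>imax,k\<^esub>\<close>. By completeness \<open>h / b\<close> is then the value of
  some \<open>H\<close> with coefficients in \<open>\<O>\<^sub>K\<close>, and \<open>F - H Q\<^bsub>imax,k\<^esub>\<close> vanishes already in \<open>K[x]\<close>. It remains to
  see that such relations lie in \<open>\<I>\<^sub>1\<close>. Up to a unit, each generator of \<open>\<I>\<^sub>1\<close> rewrites a power of \<open>X\<^sub>i\<close> as
  \<open>b\<^bsub>l i\<^esub> X\<^sub>l\<close> plus terms of smaller degree. Rewriting ends in monomials involving one variable per block, all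
  of one level, with exponents bounded as digits of a mixed radix system; their values have distinct degrees, so
  that a reduced relation is zero.

  The truncation at a key polynomial \<open>Q\<close> is multiplicative because it is the restriction of a Gauss valuation
  centred at a root of \<open>Q\<close> closest to \<open>x\<close>: coefficients of degree below \<open>deg Q\<close> have constant initial forms there,
  \<open>Q\<close> itself has a nonconstant one, and so the terms of a \<open>Q\<close>-expansion cannot cancel.
\<close>

section \<open>Valuations\<close>

text \<open>The finite lower bounds rule out -\<infinity> for both summands while still allowing
  \<infinity>.\<close>

lemma Fin_add_less:
  fixes x y :: "'g::linordered_ab_group_add extended"
  assumes "Fin a < x" "Fin b \<le> y"
  shows "Fin (a + b) < x + y"
  using assms by (cases x; cases y) (auto intro: add_less_le_mono)

lemma Fin_add_le:
  fixes x y :: "'g::linordered_ab_group_add extended"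
  assumes "Fin a \<le> x" "Fin b \<le> y"
  shows "Fin (a + b) \<le> x + y"
  using assms by (cases x; cases y) (auto intro: add_mono)

text \<open>Nonzero elements may have value \<infinity>, as happens for \<nu> on the multiples of
  the minimal polynomial. The locale thus covers \<open>v\<close>, \<nu>, its extension and the
  truncations alike.\<close>

locale ring_val =
  fixes v :: "'r::comm_ring_1 \<Rightarrow> 'g::linordered_ab_group_add extended"
  assumes ring_valuation: "ring_valuation v"
begin

lemma ne_Minf [simp]: "v x \<noteq> -\<infinity>"
  and zero [simp]: "v 0 = \<infinity>"
  and one [simp]: "v 1 = 0"
  and mult: "v (x * y) = v x + v y"
  and add: "min (v x) (v y) \<le> v (x + y)"
  using ring_valuation by (auto simp: ring_valuation_def)

text \<open>Twice this value is 0, and an ordered group has no torsion.\<close>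

lemma minus_one [simp]: "v (- 1) = 0"
proof -
  have *: "v (-1) + v (-1) = 0"
    using mult[of "-1" "-1"] by simp
  then show ?thesis
    by (cases "v (-1)") (auto simp: zero_extended_def)
qed

lemma uminus [simp]: "v (- x) = v x"
  using mult[of "-1" x] by simp

lemma add_ge: "\<gamma> \<le> v x \<Longrightarrow> \<gamma> \<le> v y \<Longrightarrow> \<gamma> \<le> v (x + y)"
  using add[of x y] by (metis min.boundedI order_trans)

lemma add_gr: "\<gamma> < v x \<Longrightarrow> \<gamma> < v y \<Longrightarrow> \<gamma> < v (x + y)"
  using add[of x y] by (metis min_less_iff_conj order.strict_trans2)

lemma diff_ge: "\<gamma> \<le> v x \<Longrightarrow> \<gamma> \<le> v y \<Longrightarrow> \<gamma> \<le> v (x - y)"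
  using add_ge[of \<gamma> x "-y"] by simp

lemma diff_gr: "\<gamma> < v x \<Longrightarrow> \<gamma> < v y \<Longrightarrow> \<gamma> < v (x - y)"
  using add_gr[of \<gamma> x "-y"] by simp

text \<open>A greater value of the sum would pass to x = (x + y) - y.\<close>

lemma add_eq:
  assumes "v x < v y"
  shows "v (x + y) = v x"
proof (rule antisym)
  show "v x \<le> v (x + y)"
    using assms by (intro add_ge) auto
  show "v (x + y) \<le> v x"
  proof (rule ccontr)
    assume "\<not> v (x + y) \<le> v x"
    then have "v x < v (x + y - y)"
      using assms by (intro diff_gr) auto
    then show False by simp
  qed
qed

lemma sum_ge: "(\<And>x. x \<in> A \<Longrightarrow> \<gamma> \<le> v (f x)) \<Longrightarrow> \<gamma> \<le> v (sum f A)"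
  by (induction A rule: infinite_finite_induct) (auto intro: add_ge)

text \<open>The bound is finite so that it stays strictly below \<infinity>, the value of an empty
  sum.\<close>

lemma sum_gr: "(\<And>x. x \<in> A \<Longrightarrow> Fin \<gamma> < v (f x)) \<Longrightarrow> Fin \<gamma> < v (sum f A)"
  by (induction A rule: infinite_finite_induct) (auto intro: add_gr)

lemma unit_finite:
  assumes "x * y = 1"
  obtains \<gamma> where "v x = Fin \<gamma>" "v y = Fin (- \<gamma>)"
proof -
  have "v x + v y = 0"
    using assms mult[of x y] by simp
  then show ?thesis
    by (cases "v x"; cases "v y") (auto simp: zero_extended_def add_eq_0_iff intro: that)
qed

lemma mult_nonneg: "0 \<le> v x \<Longrightarrow> 0 \<le> v y \<Longrightarrow> 0 \<le> v (x * y)"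
  using add_mono[of 0 "v x" 0 "v y"] by (simp add: mult)

lemma power_nonneg: "0 \<le> v x \<Longrightarrow> 0 \<le> v (x ^ n)"
  by (induction n) (auto intro: mult_nonneg)

lemma prod_nonneg: "(\<And>x. x \<in> A \<Longrightarrow> 0 \<le> v (f x)) \<Longrightarrow> 0 \<le> v (prod f A)"
  by (induction A rule: infinite_finite_induct) (auto intro: mult_nonneg)

end

section \<open>Gauss valuations\<close>

context ring_val
begin

text \<open>In the Gauss extension the variable has the value \<open>d\<close>, so that its \<open>j\<close>-th power has the value \<open>j d\<close>.\<close>

definition term_value :: "'g \<Rightarrow> 'r poly \<Rightarrow> nat \<Rightarrow> 'g extended"
  where "term_value d P j = v (Polynomial.coeff P j) + Fin (\<Sum>_<j. d)"

text \<open>The Gauss value of \<open>P\<close> is \<open>\<gamma>\<close>, and \<open>D\<close> is the degree of its initial form.\<close>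

definition initial :: "'g \<Rightarrow> 'g \<Rightarrow> nat \<Rightarrow> 'r poly \<Rightarrow> bool"
  where "initial d \<gamma> D P \<longleftrightarrow> (\<forall>j. Fin \<gamma> \<le> term_value d P j) \<and> term_value d P D = Fin \<gamma> \<and>
    (\<forall>j>D. Fin \<gamma> < term_value d P j)"

lemma term_value_add_ge:
  "\<gamma> \<le> term_value d P j \<Longrightarrow> \<gamma> \<le> term_value d R j \<Longrightarrow> \<gamma> \<le> term_value d (P + R) j"
  unfolding term_value_def
  using add[of "Polynomial.coeff P j" "Polynomial.coeff R j"]
  by (metis add_right_mono coeff_add min_def order_trans)

lemma term_value_0 [simp]: "term_value d 0 j = \<infinity>"
  by (simp add: term_value_def)

text \<open>The contribution of the variable moves into the bound, so that strict estimates concern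
  single coefficients in the base valuation.\<close>

lemma term_value_gr_iff: "Fin \<gamma> < term_value d P j \<longleftrightarrow> Fin (\<gamma> - (\<Sum>_<j. d)) < v (Polynomial.coeff P j)"
  unfolding term_value_def by (cases "v (Polynomial.coeff P j)") (auto simp: less_diff_eq algebra_simps)

lemma term_value_eq_iff: "term_value d P j = Fin \<gamma> \<longleftrightarrow> v (Polynomial.coeff P j) = Fin (\<gamma> - (\<Sum>_<j. d))"
  unfolding term_value_def by (cases "v (Polynomial.coeff P j)") (auto simp: eq_diff_eq)

lemma term_value_add_gr:
  "Fin \<gamma> < term_value d P j \<Longrightarrow> Fin \<gamma> < term_value d R j \<Longrightarrow> Fin \<gamma> < term_value d (P + R) j"
  by (simp add: term_value_gr_iff add_gr)

lemma term_value_sum_ge: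
  "(\<And>i. i \<in> A \<Longrightarrow> \<gamma> \<le> term_value d (p i) j) \<Longrightarrow> \<gamma> \<le> term_value d (sum p A) j"
  by (induction A rule: infinite_finite_induct) (auto intro: term_value_add_ge)

lemma term_value_sum_gr:
  "(\<And>i. i \<in> A \<Longrightarrow> Fin \<gamma> < term_value d (p i) j) \<Longrightarrow> Fin \<gamma> < term_value d (sum p A) j"
  by (induction A rule: infinite_finite_induct) (auto intro: term_value_add_gr)

text \<open>The Gauss value is the least term value and is attained, so each of two candidates
  bounds the other.\<close>

lemma initial_unique:
  assumes "initial d \<gamma> D P" "initial d \<gamma>' D' P"
  shows "\<gamma> = \<gamma>'"
proof (rule antisym)
  show "\<gamma> \<le> \<gamma>'" "\<gamma>' \<le> \<gamma>"
    using assms unfolding initial_def by (metis less_eq_extended.simps(1))+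
qed

text \<open>Strictness is asked only from index D on: below D, terms of R may reach the value
  \<gamma> without moving the degree of the initial form.\<close>

lemma initial_add:
  assumes "initial d \<gamma> D P" "\<And>j. Fin \<gamma> \<le> term_value d R j" "\<And>j. j \<ge> D \<Longrightarrow> Fin \<gamma> < term_value d R j"
  shows "initial d \<gamma> D (P + R)"
proof -
  have "term_value d (P + R) D = Fin \<gamma>"
    using assms(1) assms(3)[of D]
    by (auto simp: initial_def term_value_gr_iff term_value_eq_iff add_eq)
  then show ?thesis
    using assms unfolding initial_def
    by (auto intro: term_value_add_ge term_value_add_gr)
qed

lemma sum_const_add: "(\<Sum>_<m + (n::nat). d) = (\<Sum>_<m. d) + (\<Sum>_<n. d :: 'g)"
  by (induction n) (auto simp: add.assoc)

text \<open>This is Gauss's lemma: at index D + D' the product of the two leading coefficients alone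
  has the least value, so nothing can cancel it, and all later terms lie strictly higher.\<close>

lemma initial_mult:
  assumes "initial d \<gamma> D P" "initial d \<gamma>' D' R"
  shows "initial d (\<gamma> + \<gamma>') (D + D') (P * R)"
proof -
  let ?e = "\<lambda>n::nat. (\<Sum>_<n. d)"
  define t where "t n i = Polynomial.coeff P i * Polynomial.coeff R (n - i)" for n i
  have tv: "v (t n i) + Fin (?e n) = term_value d P i + term_value d R (n - i)" if "i \<le> n" for i n
    using sum_const_add[where m = i and n = "n - i" and d = d] that
    by (simp add: t_def mult term_value_def add.left_commute add.assoc flip: plus_extended.simps)
  \<comment> \<open>The shift by a multiple of d is finite, so it can be moved across a comparison
    even when x is infinite.\<close>
  have shift_le: "Fin (\<gamma> + \<gamma>' - ?e n) \<le> x \<longleftrightarrow> Fin (\<gamma> + \<gamma>') \<le> x + Fin (?e n)"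
   and shift_less: "Fin (\<gamma> + \<gamma>' - ?e n) < x \<longleftrightarrow> Fin (\<gamma> + \<gamma>') < x + Fin (?e n)"
   and shift_eq: "x = Fin (\<gamma> + \<gamma>' - ?e n) \<longleftrightarrow> x + Fin (?e n) = Fin (\<gamma> + \<gamma>')" for x n
    by (cases x; auto simp: diff_le_eq diff_less_eq eq_diff_eq)+
  have ge: "Fin (\<gamma> + \<gamma>' - ?e n) \<le> v (t n i)" if "i \<le> n" for i n
    using assms that unfolding shift_le by (auto simp: initial_def tv intro!: Fin_add_le)
  have gr: "Fin (\<gamma> + \<gamma>' - ?e n) < v (t n i)" if "i \<le> n" "i > D \<or> n - i > D'" for i n
  proof -
    have "Fin (\<gamma> + \<gamma>') < term_value d P i + term_value d R (n - i)"
      using that(2)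
    proof
      assume "i > D"
      then show ?thesis
        using assms by (intro Fin_add_less) (auto simp: initial_def)
    next
      assume "n - i > D'"
      then have "Fin (\<gamma>' + \<gamma>) < term_value d R (n - i) + term_value d P i"
        using assms by (intro Fin_add_less) (auto simp: initial_def)
      then show ?thesis by (simp add: add.commute)
    qed
    then show ?thesis
      unfolding shift_less by (simp add: tv that)
  qed
  have coeff: "Polynomial.coeff (P * R) n = (\<Sum>i\<le>n. t n i)" for n
    by (simp add: coeff_mult t_def)
  have 1: "Fin (\<gamma> + \<gamma>') \<le> term_value d (P * R) n" for n
    unfolding term_value_def coeff by (subst shift_le[symmetric], rule sum_ge) (auto intro: ge)
  have 2: "Fin (\<gamma> + \<gamma>') < term_value d (P * R) n" if "n > D + D'" for n
    unfolding term_value_def coeff using that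
    by (subst shift_less[symmetric], intro sum_gr gr) auto
  have 3: "term_value d (P * R) (D + D') = Fin (\<gamma> + \<gamma>')"
  proof -
    let ?n = "D + D'"
    have "Polynomial.coeff (P * R) ?n = t ?n D + (\<Sum>i\<in>{..?n} - {D}. t ?n i)"
      unfolding coeff by (subst sum.remove[of _ D]) auto
    moreover have *: "v (t ?n D) = Fin (\<gamma> + \<gamma>' - ?e ?n)"
      unfolding shift_eq using assms by (simp add: tv initial_def)
    \<comment> \<open>If i differs from D, then i > D or D + D' - i > D', so all these products lie
      strictly higher.\<close>
    moreover have "Fin (\<gamma> + \<gamma>' - ?e ?n) < v (\<Sum>i\<in>{..?n} - {D}. t ?n i)"
      by (rule sum_gr, rule gr) auto
    ultimately have "v (Polynomial.coeff (P * R) ?n) = Fin (\<gamma> + \<gamma>' - ?e ?n)"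
      using add_eq by metis
    then show ?thesis
      unfolding term_value_def shift_eq .
  qed
  from 1 2 3 show ?thesis
    by (auto simp: initial_def)
qed

lemma initial_one: "initial d 0 0 1"
  by (auto simp: initial_def term_value_def coeff_1 zero_extended_def)

text \<open>Among the summands of least value, the one whose initial form has the largest degree
  supplies the leading term; distinct degrees keep the others from cancelling it.\<close>

lemma initial_sum:
  assumes "finite A" "A \<noteq> {}" "\<And>i. i \<in> A \<Longrightarrow> initial d (\<gamma> i) (D i) (p i)" "inj_on D A"
  shows "\<exists>D'. initial d (Min (\<gamma> ` A)) D' (sum p A)"
proof -
  let ?m = "Min (\<gamma> ` A)"
  have m: "?m \<le> \<gamma> i" if "i \<in> A" for i
    using assms(1) that by auto
  define B where "B = {i \<in> A. \<gamma> i = ?m}"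
  have "?m \<in> \<gamma> ` A"
    using assms(1,2) by (intro Min_in) auto
  then have B: "finite B" "B \<noteq> {}"
    using assms(1) by (auto simp: B_def)
  then obtain i0 where i0: "i0 \<in> B" "\<And>i. i \<in> B \<Longrightarrow> D i \<le> D i0"
    using Max_in[of "D ` B"] Max_ge[of "D ` B"] by fastforce
  then have iA: "i0 \<in> A" and g0: "\<gamma> i0 = ?m" by (auto simp: B_def)
  have less: "D i < D i0" if "i \<in> A - {i0}" "\<gamma> i = ?m" for i
    using i0(2)[of i] that assms(4) iA by (auto simp: B_def inj_on_def order.strict_iff_order)
  have "initial d ?m (D i0) (p i0 + sum p (A - {i0}))"
  proof (rule initial_add)
    show "initial d ?m (D i0) (p i0)"
      using assms(3)[OF iA] g0 by simp
    show "Fin ?m \<le> term_value d (sum p (A - {i0})) j" for j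
    proof (rule term_value_sum_ge)
      fix i assume "i \<in> A - {i0}"
      then show "Fin ?m \<le> term_value d (p i) j"
        using assms(3)[of i] m[of i] unfolding initial_def
        by (metis Diff_iff less_eq_extended.simps(1) order_trans)
    qed
    show "Fin ?m < term_value d (sum p (A - {i0})) j" if j: "j \<ge> D i0" for j
    proof (rule term_value_sum_gr)
      fix i assume i: "i \<in> A - {i0}"
      show "Fin ?m < term_value d (p i) j"
      proof (cases "\<gamma> i = ?m")
        case True
        then show ?thesis
          using less[OF i True] assms(3)[of i] i j unfolding initial_def by auto
      next
        case False
        then have "Fin ?m < Fin (\<gamma> i)"
          using m[of i] i by auto
        also have "Fin (\<gamma> i) \<le> term_value d (p i) j"
          using assms(3)[of i] i by (auto simp: initial_def)
        finally show ?thesis .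
      qed
    qed
  qed
  then show ?thesis
    using sum.remove[OF assms(1) iA, of p] by auto
qed

end

section \<open>Expansions and truncations\<close>

text \<open>Serves both embeddings of K, into L and into its algebraic closure.\<close>

locale field_homomorphism =
  fixes h :: "'a::field \<Rightarrow> 'b::field"
  assumes hom_add: "h (x + y) = h x + h y"
    and hom_mult: "h (x * y) = h x * h y"
    and hom_one [simp]: "h 1 = 1"
begin

lemma hom_zero [simp]: "h 0 = 0"
  using hom_add[of 0 0] by (simp only: add_0_right add_cancel_right_right)

lemma hom_sum: "h (sum f A) = (\<Sum>x\<in>A. h (f x))"
  by (induction A rule: infinite_finite_induct) (auto simp: hom_add)

lemma hom_eq_0_iff [simp]: "h x = 0 \<longleftrightarrow> x = 0"
proof
  show "x = 0" if "h x = 0"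
  proof (rule ccontr)
    assume "x \<noteq> 0"
    then have "h x * h (inverse x) = 1"
      by (simp flip: hom_mult)
    with that show False by simp
  qed
qed simp

lemma map_poly_add: "map_poly h (p + q) = map_poly h p + map_poly h q"
  by (rule poly_eqI) (simp add: coeff_map_poly hom_add)

lemma map_poly_diff: "map_poly h (p - q) = map_poly h p - map_poly h q"
  using map_poly_add[of "p - q" q] by simp

lemma map_poly_mult: "map_poly h (p * q) = map_poly h p * map_poly h q"
  by (rule poly_eqI) (simp add: coeff_map_poly coeff_mult hom_sum hom_mult)

lemma map_poly_sum: "map_poly h (sum f A) = (\<Sum>x\<in>A. map_poly h (f x))"
  by (induction A rule: infinite_finite_induct) (auto simp: map_poly_add)

lemma map_poly_power: "map_poly h (p ^ n) = map_poly h p ^ n"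
  by (induction n) (auto simp: map_poly_mult)

lemma degree_map_poly [simp]: "Polynomial.degree (map_poly h p) = Polynomial.degree p"
  by (rule Polynomial.degree_map_poly) auto

lemma map_poly_eq_0_iff [simp]: "map_poly h p = 0 \<longleftrightarrow> p = 0"
  by (auto simp: poly_eq_iff coeff_map_poly)

end

interpretation to_ac: field_homomorphism to_ac
  by unfold_locales auto

text \<open>Repeated division by q: the remainder is the lowest coefficient, and the quotient is
  expanded further.\<close>

lemma q_expansion_exists:
  fixes q f :: "'k::field poly"
  assumes "0 < Polynomial.degree q"
  shows "\<exists>F. poly F q = f \<and> (\<forall>j. Polynomial.degree (Polynomial.coeff F j) < Polynomial.degree q)"
proof (induction "Polynomial.degree f" arbitrary: f rule: less_induct)
  case less
  show ?case
  proof (cases "Polynomial.degree f < Polynomial.degree q")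
    case True
    then show ?thesis
      using assms by (intro exI[of _ "[:f:]"]) (auto simp: coeff_pCons split: nat.splits)
  next
    case False
    then have "Polynomial.degree (f div q) < Polynomial.degree f"
      using assms by (intro degree_div_less) auto
    from less[OF this] obtain F where F: "poly F q = f div q"
      "\<forall>j. Polynomial.degree (Polynomial.coeff F j) < Polynomial.degree q"
      by blast
    have "q \<noteq> 0" using assms by auto
    then have "Polynomial.degree (f mod q) < Polynomial.degree q"
      using degree_mod_less[of q f] assms by auto
    with F show ?thesis
      by (intro exI[of _ "pCons (f mod q) F"]) (auto simp: coeff_pCons split: nat.splits)
  qed
qed

text \<open>Reduction modulo q isolates the lowest coefficient; after cancelling q the argument
  repeats.\<close>

lemma q_expansion_unique:
  fixes q :: "'k::field poly"
  assumes "poly F q = poly G q"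
    and "\<And>j. Polynomial.degree (Polynomial.coeff F j) < Polynomial.degree q"
    and "\<And>j. Polynomial.degree (Polynomial.coeff G j) < Polynomial.degree q"
  shows "F = G"
  using assms
proof (induction F G rule: poly_induct2)
  case (pCons a F b G)
  have q: "q \<noteq> 0" using pCons.prems(2)[of 0] by auto
  have deg: "Polynomial.degree a < Polynomial.degree q" "Polynomial.degree b < Polynomial.degree q"
    using pCons.prems(2)[of 0] pCons.prems(3)[of 0] by auto
  have eq: "a + q * poly F q = b + q * poly G q"
    using pCons.prems(1) by simp
  then have "(a + q * poly F q) mod q = (b + q * poly G q) mod q"
    by simp
  then have ab: "a = b"
    using deg by (simp add: mod_poly_less)
  with eq q have "poly F q = poly G q" by simp
  then have "F = G"
    using pCons.prems(2)[of "Suc _"] pCons.prems(3)[of "Suc _"] by (intro pCons.IH) auto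
  with ab show ?case by simp
qed simp

lemma q_expansion_eqI:
  fixes q :: "'k::field poly"
  assumes "poly F q = f"
    and "\<And>j. Polynomial.degree (Polynomial.coeff F j) < Polynomial.degree q"
  shows "q_expansion q f = F"
  unfolding q_expansion_def using assms
  by (intro the_equality) (auto intro: q_expansion_unique)

lemma
  fixes q :: "'k::field poly"
  assumes "0 < Polynomial.degree q"
  shows poly_q_expansion: "poly (q_expansion q f) q = f"
    and degree_coeff_q_expansion:
      "Polynomial.degree (Polynomial.coeff (q_expansion q f) j) < Polynomial.degree q"
  using q_expansion_exists[OF assms, of f] q_expansion_eqI[of _ q f] by auto

lemma q_expansion_add:
  fixes q :: "'k::field poly"
  assumes "0 < Polynomial.degree q"
  shows "q_expansion q (f + g) = q_expansion q f + q_expansion q g"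
  using assms
  by (intro q_expansion_eqI)
    (auto simp: poly_q_expansion intro: degree_add_less degree_coeff_q_expansion)

lemma q_expansion_0 [simp]: "0 < Polynomial.degree q \<Longrightarrow> q_expansion q (0::'k::field poly) = 0"
  by (rule q_expansion_eqI) auto

text \<open>Coefficients beyond the degree vanish and have value \<infinity>, so the finite minimum
  may be tested on all indices.\<close>

lemma truncation_ge_iff:
  fixes q :: "'k::field poly" and \<nu> :: "'k poly \<Rightarrow> 'g::linordered_ab_group_add extended"
  assumes "ring_val \<nu>"
  shows "\<gamma> \<le> truncation \<nu> q f \<longleftrightarrow> (\<forall>j. \<gamma> \<le> \<nu> (Polynomial.coeff (q_expansion q f) j * q ^ j))"
proof -
  interpret \<nu>: ring_val \<nu> by fact
  have "\<gamma> \<le> \<nu> (Polynomial.coeff (q_expansion q f) j * q ^ j)"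
    if "j > Polynomial.degree (q_expansion q f)" for j
    using that by (simp add: coeff_eq_0)
  then show ?thesis
    unfolding truncation_def by (subst Min_ge_iff) (auto simp: not_le[symmetric])
qed

section \<open>Truncations at key polynomials as Gauss valuations\<close>

locale closure_valuation =
  fixes \<nu>bar :: "'k::field alg_closure poly \<Rightarrow> 'g::linordered_ab_group_add extended"
    and \<nu> :: "'k poly \<Rightarrow> 'g extended"
  assumes extends: "extends_to_closure \<nu>bar \<nu>"
begin

sublocale bar: ring_val \<nu>bar
  using extends by unfold_locales (simp add: extends_to_closure_def)

lemma bar_map_poly: "\<nu>bar (map_poly to_ac f) = \<nu> f"
  using extends by (simp add: extends_to_closure_def)

sublocale ring_val \<nu>
  by unfold_locales (auto simp: ring_valuation_def to_ac.map_poly_mult to_ac.map_poly_add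
    bar.mult bar.add simp flip: bar_map_poly)

text \<open>The induced valuation on the algebraic closure, which is the base of the Gauss
  valuations centred at roots.\<close>

sublocale const: ring_val "\<lambda>c. \<nu>bar [:c:]"
proof
  have "\<nu>bar [:x * y:] = \<nu>bar [:x:] + \<nu>bar [:y:]"
    "min (\<nu>bar [:x:]) (\<nu>bar [:y:]) \<le> \<nu>bar [:x + y:]" for x y
    using bar.mult[of "[:x:]" "[:y:]"] bar.add[of "[:x:]" "[:y:]"] by (simp_all add: mult.commute)
  moreover have "\<nu>bar [:1:] = 0"
    using bar.one by (simp only: one_pCons)
  ultimately show "ring_valuation (\<lambda>c. \<nu>bar [:c:])"
    by (simp add: ring_valuation_def)
qed

lemma finite_roots:
  "Polynomial.degree f > 0 \<Longrightarrow> finite {a. poly (map_poly to_ac f) a = (0::'k alg_closure)}"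
  by (intro poly_roots_finite) auto

lemma epsilon_ge:
  assumes "Polynomial.degree f > 0" "poly (map_poly to_ac f) a = 0"
  shows "\<nu>bar [:- a, 1:] \<le> epsilon \<nu>bar f"
  unfolding epsilon_def using assms finite_roots by (intro Max_ge) auto

text \<open>The maximum is over a finite set, nonempty because the closure contains a root.\<close>

lemma epsilon_attained:
  assumes "Polynomial.degree f > 0"
  obtains a where "poly (map_poly to_ac f) a = 0" "epsilon \<nu>bar f = \<nu>bar [:- a, 1:]"
proof -
  have "\<exists>a. poly (map_poly to_ac f) a = 0"
    using assms by (intro alg_closed_imp_poly_has_root) simp
  then have "epsilon \<nu>bar f \<in> (\<lambda>a. \<nu>bar [:- a, 1:]) ` {a. poly (map_poly to_ac f) a = 0}"
    unfolding epsilon_def using finite_roots[OF assms] by (intro Max_in) auto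
  then show ?thesis using that by auto
qed

text \<open>
  Around a centre \<open>\<alpha>\<close> at distance \<open>d\<close> from the variable, a linear factor whose root is strictly farther
  away than \<open>\<alpha>\<close> has a constant initial form, and one whose root is as close as \<open>\<alpha>\<close> a linear one.
\<close>

lemma initial_of_roots:
  fixes P :: "'k alg_closure poly"
  assumes \<alpha>: "\<nu>bar [:- \<alpha>, 1:] = Fin d"
    and "P \<noteq> 0" "\<And>c. poly P c = 0 \<Longrightarrow> \<nu>bar [:- c, 1:] \<le> Fin d"
  shows "\<exists>\<gamma> D. \<nu>bar P = Fin \<gamma> \<and> const.initial d \<gamma> D (pcompose P [:\<alpha>, 1:]) \<and>
    (D = 0 \<longleftrightarrow> (\<forall>c. poly P c = 0 \<longrightarrow> \<nu>bar [:- c, 1:] < Fin d))"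
  using assms(2,3)
proof (induction "Polynomial.degree P" arbitrary: P)
  case 0
  then obtain c where c: "P = [:c:]" "c \<noteq> 0"
    by (metis degree_eq_zeroE pCons_eq_0_iff)
  obtain \<gamma> where \<gamma>: "\<nu>bar [:c:] = Fin \<gamma>"
    using const.unit_finite[of c "inverse c"] c by auto
  show ?case
    using c \<gamma> by (intro exI[of _ \<gamma>] exI[of _ 0])
      (auto simp: const.initial_def const.term_value_def zero_extended_def coeff_pCons split: nat.splits)
next
  case (Suc n)
  obtain c where c: "poly P c = 0"
    using alg_closed_imp_poly_has_root[of P] Suc.hyps(2) by auto
  then obtain R where R: "P = [:- c, 1:] * R"
    by (metis poly_eq_0_iff_dvd dvd_def)
  with Suc.prems have "R \<noteq> 0" by auto
  then have deg: "Polynomial.degree P = Suc (Polynomial.degree R)"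
    unfolding R by (subst degree_mult_eq) auto
  from Suc.hyps(1)[of R] deg Suc.hyps(2) Suc.prems \<open>R \<noteq> 0\<close> obtain \<gamma> D where IH:
    "\<nu>bar R = Fin \<gamma>" "const.initial d \<gamma> D (pcompose R [:\<alpha>, 1:])"
    "D = 0 \<longleftrightarrow> (\<forall>c. poly R c = 0 \<longrightarrow> \<nu>bar [:- c, 1:] < Fin d)"
    unfolding R by auto
  have c_le: "\<nu>bar [:- c, 1:] \<le> Fin d"
    using Suc.prems c by auto
  then obtain \<gamma>' where \<gamma>': "\<nu>bar [:- c, 1:] = Fin \<gamma>'"
    by (cases "\<nu>bar [:- c, 1:]") auto
  \<comment> \<open>After the substitution the factor has the constant term \<alpha> - c. It has
    value \<gamma>' if \<gamma>' < d, and then dominates; otherwise its value is at least d, and the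
    linear term leads.\<close>
  have diff: "[:\<alpha> - c:] = [:- c, 1:] - [:- \<alpha>, 1:]"
    by simp
  have "\<exists>D'. const.initial d \<gamma>' D' [:\<alpha> - c, 1:] \<and> (D' = 0 \<longleftrightarrow> \<gamma>' < d)"
  proof (cases "\<gamma>' < d")
    case True
    have "\<nu>bar [:\<alpha> - c:] = Fin \<gamma>'"
      using bar.add_eq[of "[:- c, 1:]" "- [:- \<alpha>, 1:]"] True \<alpha> \<gamma>' bar.uminus[of "[:- \<alpha>, 1:]"]
      unfolding diff by simp
    then show ?thesis
      using True by (intro exI[of _ 0])
       (auto simp: const.initial_def const.term_value_def zero_extended_def coeff_pCons one_pCons[symmetric] split: nat.splits
        simp del: pCons_one)
  next
    case False
    then have [simp]: "\<gamma>' = d" using c_le \<gamma>' by auto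
    have "Fin d \<le> \<nu>bar [:\<alpha> - c:]"
      unfolding diff using \<gamma>' \<alpha> by (intro bar.diff_ge) auto
    then show ?thesis
      by (intro exI[of _ 1])
       (auto simp: const.initial_def const.term_value_def zero_extended_def[symmetric] coeff_pCons one_pCons[symmetric] split: nat.splits
        simp del: pCons_one)
  qed
  then obtain D' where D': "const.initial d \<gamma>' D' [:\<alpha> - c, 1:]" "D' = 0 \<longleftrightarrow> \<gamma>' < d"
    by blast
  have "pcompose P [:\<alpha>, 1:] = [:\<alpha> - c, 1:] * pcompose R [:\<alpha>, 1:]"
    by (simp add: R pcompose_mult pcompose_pCons del: mult_pCons_left)
  then have "const.initial d (\<gamma>' + \<gamma>) (D' + D) (pcompose P [:\<alpha>, 1:])"
    using const.initial_mult[OF D'(1) IH(2)] by simp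
  moreover have "\<nu>bar P = Fin (\<gamma>' + \<gamma>)"
    by (simp add: R bar.mult \<gamma>' IH(1) del: mult_pCons_left)
  moreover have "D' + D = 0 \<longleftrightarrow> (\<forall>c. poly P c = 0 \<longrightarrow> \<nu>bar [:- c, 1:] < Fin d)"
    using D'(2) IH(3) \<gamma>' by (auto simp: R)
  ultimately show ?case by blast
qed

text \<open>Since \<open>epsilon\<close> is the distance of the nearest root, the initial form is
  constant exactly when no root is as near as \<alpha>. Constants are listed apart because they have
  no roots.\<close>

lemma initial_map_poly:
  assumes \<alpha>: "\<nu>bar [:- \<alpha>, 1:] = Fin d"
    and "f \<noteq> 0" "Polynomial.degree f > 0 \<Longrightarrow> epsilon \<nu>bar f \<le> Fin d"
  obtains \<gamma> D where "\<nu> f = Fin \<gamma>" "const.initial d \<gamma> D (pcompose (map_poly to_ac f) [:\<alpha>, 1:])"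
    "D = 0 \<longleftrightarrow> Polynomial.degree f = 0 \<or> epsilon \<nu>bar f < Fin d"
proof -
  have pos: "Polynomial.degree f > 0" if "poly (map_poly to_ac f) c = 0" for c
  proof (rule ccontr)
    assume "\<not> Polynomial.degree f > 0"
    then obtain e where "f = [:e:]" using degree_eq_zeroE by blast
    with that \<open>f \<noteq> 0\<close> show False by (auto simp: map_poly_pCons)
  qed
  have "\<nu>bar [:- c, 1:] \<le> Fin d" if "poly (map_poly to_ac f) c = 0" for c
    using epsilon_ge[OF pos that] assms(3) pos that by force
  with initial_of_roots[OF \<alpha>, of "map_poly to_ac f"] \<open>f \<noteq> 0\<close> obtain \<gamma> D where *:
    "\<nu> f = Fin \<gamma>" "const.initial d \<gamma> D (pcompose (map_poly to_ac f) [:\<alpha>, 1:])"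
    "D = 0 \<longleftrightarrow> (\<forall>c. poly (map_poly to_ac f) c = 0 \<longrightarrow> \<nu>bar [:- c, 1:] < Fin d)"
    by (auto simp: bar_map_poly)
  have "(\<forall>c. poly (map_poly to_ac f) c = 0 \<longrightarrow> \<nu>bar [:- c, 1:] < Fin d) \<longleftrightarrow>
    Polynomial.degree f = 0 \<or> epsilon \<nu>bar f < Fin d"
    using pos epsilon_ge[of f] epsilon_attained[of f]
    by (metis gr0I less_numeral_extra(3) order.strict_trans1)
  with * show ?thesis using that by metis
qed

text \<open>
  The terms of the \<open>q\<close>-expansion have initial forms of distinct degrees, so they cannot cancel and
  the truncation is the restriction of a Gauss valuation.
\<close>

lemma initial_truncation:
  assumes q: "key_polynomial \<nu>bar q" and \<alpha>: "\<nu>bar [:- \<alpha>, 1:] = Fin d" "epsilon \<nu>bar q = Fin d"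
    and "f \<noteq> 0"
  obtains \<gamma> D where "truncation \<nu> q f = Fin \<gamma>"
    "const.initial d \<gamma> D (pcompose (map_poly to_ac f) [:\<alpha>, 1:])"
proof -
  let ?S = "\<lambda>f. pcompose (map_poly to_ac f) [:\<alpha>, 1:]"
  let ?F = "q_expansion q f"
  let ?c = "Polynomial.coeff ?F"
  have degq: "0 < Polynomial.degree q" and q0: "q \<noteq> 0"
    using q by (auto simp: key_polynomial_def)
  \<comment> \<open>Some root of q attains \<open>epsilon\<close>, so the initial form of q is not
    constant; the powers of q then have initial forms of pairwise distinct degrees.\<close>
  obtain \<gamma>q Dq where Dq: "\<nu> q = Fin \<gamma>q" "const.initial d \<gamma>q Dq (?S q)" "Dq > 0"
    using initial_map_poly[OF \<alpha>(1) q0] \<alpha>(2) degq by (metis gr0I less_irrefl order_refl)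
  have powq: "\<exists>\<gamma>. \<nu> (q ^ j) = Fin \<gamma> \<and> const.initial d \<gamma> (j * Dq) (?S (q ^ j))" for j
  proof (induction j)
    case 0
    then show ?case using const.initial_one by (auto simp: zero_extended_def pcompose_1)
  next
    case (Suc j)
    then obtain \<gamma> where "\<nu> (q ^ j) = Fin \<gamma>" "const.initial d \<gamma> (j * Dq) (?S (q ^ j))" by blast
    then show ?case
      using const.initial_mult[OF Dq(2), of \<gamma> "j * Dq" "?S (q ^ j)"] Dq(1)
      by (intro exI[of _ "\<gamma>q + \<gamma>"]) (auto simp: mult to_ac.map_poly_mult pcompose_mult)
  qed
  have coeffq: "\<exists>\<gamma>. \<nu> (?c j) = Fin \<gamma> \<and> const.initial d \<gamma> 0 (?S (?c j))" if nz: "?c j \<noteq> 0" for j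
  proof -
    \<comment> \<open>This is where the defining property of a key polynomial enters: expansion
      coefficients have smaller degree than q, so none of their roots is as near as
      \<alpha>.\<close>
    have less: "Polynomial.degree (?c j) > 0 \<Longrightarrow> epsilon \<nu>bar (?c j) < Fin d"
      using q degree_coeff_q_expansion[OF degq, of f j] \<alpha>(2) by (auto simp: key_polynomial_def)
    then obtain \<gamma> D where *: "\<nu> (?c j) = Fin \<gamma>" "const.initial d \<gamma> D (?S (?c j))"
      "D = 0 \<longleftrightarrow> Polynomial.degree (?c j) = 0 \<or> epsilon \<nu>bar (?c j) < Fin d"
      using initial_map_poly[OF \<alpha>(1) nz] by (metis order.strict_implies_order)
    with less have "D = 0" by auto
    with * show ?thesis by auto
  qed
  \<comment> \<open>Vanishing coefficients are left out, as the zero polynomial has no initial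
    form.\<close>
  define A where "A = {j. ?c j \<noteq> 0}"
  have fin: "finite A"
    unfolding A_def using MOST_coeff_eq_0[of ?F] by (simp add: eventually_cofinite)
  have "?F \<noteq> 0" using poly_q_expansion[OF degq, of f] \<open>f \<noteq> 0\<close> by auto
  then have ne: "A \<noteq> {}" by (auto simp: A_def poly_eq_iff)
  have "\<forall>j\<in>A. \<exists>\<gamma>. \<nu> (?c j * q ^ j) = Fin \<gamma> \<and> const.initial d \<gamma> (j * Dq) (?S (?c j * q ^ j))"
  proof
    fix j assume "j \<in> A"
    then obtain \<gamma> \<gamma>' where "\<nu> (?c j) = Fin \<gamma>" "const.initial d \<gamma> 0 (?S (?c j))"
      "\<nu> (q ^ j) = Fin \<gamma>'" "const.initial d \<gamma>' (j * Dq) (?S (q ^ j))"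
      using coeffq powq unfolding A_def by blast
    then show "\<exists>\<gamma>. \<nu> (?c j * q ^ j) = Fin \<gamma> \<and> const.initial d \<gamma> (j * Dq) (?S (?c j * q ^ j))"
      using const.initial_mult[of d \<gamma> 0 "?S (?c j)" \<gamma>' "j * Dq" "?S (q ^ j)"]
      by (intro exI[of _ "\<gamma> + \<gamma>'"]) (auto simp: mult to_ac.map_poly_mult pcompose_mult)
  qed
  then obtain \<gamma> where \<gamma>: "\<And>j. j \<in> A \<Longrightarrow> \<nu> (?c j * q ^ j) = Fin (\<gamma> j)"
    "\<And>j. j \<in> A \<Longrightarrow> const.initial d (\<gamma> j) (j * Dq) (?S (?c j * q ^ j))"
    by metis
  have "inj_on (\<lambda>j. j * Dq) A"
    using Dq(3) by (auto simp: inj_on_def)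
  then obtain D where D: "const.initial d (Min (\<gamma> ` A)) D (\<Sum>j\<in>A. ?S (?c j * q ^ j))"
    using const.initial_sum[of A d \<gamma>, OF fin ne \<gamma>(2)] by blast
  have "f = (\<Sum>j\<le>Polynomial.degree ?F. ?c j * q ^ j)"
    using poly_q_expansion[OF degq, of f] by (simp add: poly_altdef)
  also have "\<dots> = (\<Sum>j\<in>A. ?c j * q ^ j)"
    by (rule sum.mono_neutral_right) (auto simp: A_def intro: le_degree)
  finally have "?S f = ?S (\<Sum>j\<in>A. ?c j * q ^ j)"
    by (rule arg_cong)
  then have "?S f = (\<Sum>j\<in>A. ?S (?c j * q ^ j))"
    by (simp only: to_ac.map_poly_sum pcompose_sum)
  moreover have "truncation \<nu> q f = Fin (Min (\<gamma> ` A))"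
  proof (rule antisym)
    have "\<nu> (?c j * q ^ j) \<ge> Fin (Min (\<gamma> ` A))" for j
      using \<gamma>(1)[of j] fin by (cases "j \<in> A") (auto simp: A_def)
    then show "Fin (Min (\<gamma> ` A)) \<le> truncation \<nu> q f"
      by (subst truncation_ge_iff) (auto intro: ring_val_axioms)
    have "Min (\<gamma> ` A) \<in> \<gamma> ` A"
      using fin ne by (intro Min_in) auto
    then obtain j where "j \<in> A" "\<gamma> j = Min (\<gamma> ` A)"
      by (metis imageE)
    then show "truncation \<nu> q f \<le> Fin (Min (\<gamma> ` A))"
      using \<gamma>(1)[of j] truncation_ge_iff[OF ring_val_axioms, of "truncation \<nu> q f" q f] by (metis order_refl)
  qed
  ultimately show ?thesis using that D by metis
qed

lemma truncation_le:
  assumes "0 < Polynomial.degree q"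
  shows "truncation \<nu> q f \<le> \<nu> f"
proof -
  have "f = (\<Sum>j\<le>Polynomial.degree (q_expansion q f). Polynomial.coeff (q_expansion q f) j * q ^ j)"
    using poly_q_expansion[OF assms, of f] by (simp add: poly_altdef)
  moreover have "truncation \<nu> q f \<le> \<nu> \<dots>"
    using truncation_ge_iff[OF ring_val_axioms, of "truncation \<nu> q f" q f] by (intro sum_ge) auto
  ultimately show ?thesis by simp
qed

lemma truncation_0 [simp]: "0 < Polynomial.degree q \<Longrightarrow> truncation \<nu> q 0 = \<infinity>"
  by (simp add: truncation_def)

lemma truncation_add_ge:
  assumes "0 < Polynomial.degree q" "\<gamma> \<le> truncation \<nu> q f" "\<gamma> \<le> truncation \<nu> q g"
  shows "\<gamma> \<le> truncation \<nu> q (f + g)"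
  using assms unfolding truncation_ge_iff[OF ring_val_axioms]
  by (auto simp: q_expansion_add distrib_right intro: add_ge)

lemma truncation_finite:
  assumes "key_polynomial \<nu>bar q" "epsilon \<nu>bar q = Fin d" "f \<noteq> 0"
  obtains \<gamma> where "truncation \<nu> q f = Fin \<gamma>"
  using assms epsilon_attained[of q] initial_truncation[OF assms(1)]
  by (metis key_polynomial_def)

text \<open>Both sides are the Gauss value at a root of q nearest to the variable, since no root of
  f is nearer.\<close>

lemma truncation_eq:
  assumes q: "key_polynomial \<nu>bar q" "epsilon \<nu>bar q = Fin d"
    and "Polynomial.degree f = 0 \<or> epsilon \<nu>bar f \<le> epsilon \<nu>bar q"
  shows "truncation \<nu> q f = \<nu> f"
proof (cases "f = 0")
  case False
  from q obtain \<alpha> where \<alpha>: "\<nu>bar [:- \<alpha>, 1:] = Fin d"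
    using epsilon_attained[of q] by (metis key_polynomial_def)
  show ?thesis
    using initial_truncation[OF q(1) \<alpha> q(2) False] initial_map_poly[OF \<alpha> False] const.initial_unique
    by (metis assms(3) q(2) less_irrefl)
qed (use q in \<open>auto simp: key_polynomial_def\<close>)

text \<open>Gauss's lemma, transferred along the identification of the truncation with a Gauss
  value.\<close>

lemma truncation_mult:
  assumes q: "key_polynomial \<nu>bar q" "epsilon \<nu>bar q = Fin d"
  shows "truncation \<nu> q (f * g) = truncation \<nu> q f + truncation \<nu> q g"
proof -
  have degq: "0 < Polynomial.degree q"
    using q by (auto simp: key_polynomial_def)
  from q obtain \<alpha> where \<alpha>: "\<nu>bar [:- \<alpha>, 1:] = Fin d"
    using epsilon_attained[of q] by (metis key_polynomial_def)
  note init = initial_truncation[OF q(1) \<alpha> q(2)]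
  \<comment> \<open>Zero factors are treated apart, since only nonzero polynomials have initial
    forms.\<close>
  consider "f = 0" "g = 0" | "f \<noteq> 0" "g = 0" | "f = 0" "g \<noteq> 0" | "f \<noteq> 0" "g \<noteq> 0"
    by blast
  then show ?thesis
  proof cases
    case 1
    then show ?thesis using degq by simp
  next
    case 2
    then show ?thesis using init[OF 2(1)] degq by (metis mult_zero_right plus_extended.simps(2) truncation_0)
  next
    case 3
    then show ?thesis using init[OF 3(2)] degq by (metis mult_zero_left plus_extended.simps(3) truncation_0)
  next
    case 4
    obtain \<gamma> D where 1: "truncation \<nu> q f = Fin \<gamma>"
      "const.initial d \<gamma> D (pcompose (map_poly to_ac f) [:\<alpha>, 1:])"
      using init[OF 4(1)] .
    obtain \<gamma>' D' where 2: "truncation \<nu> q g = Fin \<gamma>'"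
      "const.initial d \<gamma>' D' (pcompose (map_poly to_ac g) [:\<alpha>, 1:])"
      using init[OF 4(2)] .
    obtain \<gamma>'' D'' where 3: "truncation \<nu> q (f * g) = Fin \<gamma>''"
      "const.initial d \<gamma>'' D'' (pcompose (map_poly to_ac (f * g)) [:\<alpha>, 1:])"
      using init[of "f * g"] 4 by auto
    have "const.initial d (\<gamma> + \<gamma>') (D + D') (pcompose (map_poly to_ac (f * g)) [:\<alpha>, 1:])"
      using const.initial_mult[OF 1(2) 2(2)] by (simp add: to_ac.map_poly_mult pcompose_mult)
    with 3(2) have "\<gamma>'' = \<gamma> + \<gamma>'"
      by (rule const.initial_unique)
    with 1 2 3 show ?thesis by simp
  qed
qed

lemma truncation_ring_val:
  assumes q: "key_polynomial \<nu>bar q" "epsilon \<nu>bar q = Fin d"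
  shows "ring_val (truncation \<nu> q)"
proof
  have degq: "0 < Polynomial.degree q"
    using q by (auto simp: key_polynomial_def)
  have "truncation \<nu> q f \<noteq> -\<infinity>" for f
  proof (cases "f = 0")
    case False
    then show ?thesis using truncation_finite[OF q, of f] by force
  qed (use degq in simp)
  moreover have "truncation \<nu> q 1 = 0"
    using truncation_eq[OF q] by simp
  ultimately show "ring_valuation (truncation \<nu> q)"
    using degq by (auto simp: ring_valuation_def truncation_mult[OF q] intro: truncation_add_ge)
qed

end

section \<open>Polynomials in the variables \<open>X\<^sub>i\<close>\<close>

lemma poly_mapping_sum_single: "P = (\<Sum>m\<in>Poly_Mapping.keys P. Poly_Mapping.single m (Poly_Mapping.lookup P m))"
  by (rule poly_mapping_eqI) (auto simp: lookup_sum lookup_single when_def in_keys_iff)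

text \<open>A larger index set lets monomials with different supports be handled over a common
  one.\<close>

lemma monom_eval_superset:
  "finite A \<Longrightarrow> Poly_Mapping.keys m \<subseteq> A \<Longrightarrow> monom_eval x m = (\<Prod>k\<in>A. x k ^ Poly_Mapping.lookup m k)"
  unfolding monom_eval_def by (rule prod.mono_neutral_left) (auto simp: in_keys_iff)

lemma monom_eval_0 [simp]: "monom_eval x 0 = 1"
  by (simp add: monom_eval_def)

lemma monom_eval_single [simp]: "monom_eval x (Poly_Mapping.single i n) = x i ^ n"
  by (cases "n = 0") (auto simp: monom_eval_def)

lemma monom_eval_add: "monom_eval x (m + n) = monom_eval x m * monom_eval x n"
proof -
  let ?A = "Poly_Mapping.keys m \<union> Poly_Mapping.keys n"
  have "monom_eval x (m + n) = (\<Prod>k\<in>?A. x k ^ Poly_Mapping.lookup (m + n) k)"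
    using Poly_Mapping.keys_add[of m n] by (intro monom_eval_superset) auto
  then show ?thesis
    by (simp add: monom_eval_superset[of ?A] lookup_add power_add prod.distrib)
qed

lemma poly_mapping_mult_eq:
  "P * R = (\<Sum>m\<in>Poly_Mapping.keys P. \<Sum>n\<in>Poly_Mapping.keys R.
    Poly_Mapping.single (m + n) (Poly_Mapping.lookup P m * Poly_Mapping.lookup R n))"
  by (subst poly_mapping_sum_single[of P], subst poly_mapping_sum_single[of R], subst sum.swap)
    (simp add: sum_distrib_left sum_distrib_right mult_single)

text \<open>Used for two coefficient maps: constants into K[x], and K into L.\<close>

locale ring_homomorphism =
  fixes h :: "'a::comm_ring_1 \<Rightarrow> 'b::comm_ring_1"
  assumes h_add: "h (x + y) = h x + h y"
    and h_mult: "h (x * y) = h x * h y"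
    and h_one: "h 1 = 1"
begin

lemma h_zero [simp]: "h 0 = 0"
  using h_add[of 0 0] by (simp only: add_0_right add_cancel_right_right)

lemma mpoly_eval_superset:
  "finite A \<Longrightarrow> Poly_Mapping.keys P \<subseteq> A \<Longrightarrow>
    mpoly_eval h x P = (\<Sum>m\<in>A. h (Poly_Mapping.lookup P m) * monom_eval x m)"
  unfolding mpoly_eval_def by (rule sum.mono_neutral_left) (auto simp: in_keys_iff)

lemma mpoly_eval_0 [simp]: "mpoly_eval h x 0 = 0"
  by (simp add: mpoly_eval_def)

lemma mpoly_eval_add: "mpoly_eval h x (P + R) = mpoly_eval h x P + mpoly_eval h x R"
proof -
  let ?A = "Poly_Mapping.keys P \<union> Poly_Mapping.keys R"
  have "mpoly_eval h x (P + R) = (\<Sum>m\<in>?A. h (Poly_Mapping.lookup (P + R) m) * monom_eval x m)"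
    using Poly_Mapping.keys_add[of P R] by (intro mpoly_eval_superset) auto
  then show ?thesis
    by (simp add: mpoly_eval_superset[of ?A] lookup_add h_add distrib_right sum.distrib)
qed

lemma mpoly_eval_sum: "mpoly_eval h x (sum f A) = (\<Sum>i\<in>A. mpoly_eval h x (f i))"
  by (induction A rule: infinite_finite_induct) (auto simp: mpoly_eval_add)

lemma mpoly_eval_uminus: "mpoly_eval h x (- P) = - mpoly_eval h x P"
  using mpoly_eval_add[of x P "-P"] by (simp add: eq_neg_iff_add_eq_0 add.commute)

lemma mpoly_eval_diff: "mpoly_eval h x (P - R) = mpoly_eval h x P - mpoly_eval h x R"
  using mpoly_eval_add[of x P "-R"] by (simp add: mpoly_eval_uminus)

lemma mpoly_eval_single [simp]: "mpoly_eval h x (Poly_Mapping.single m c) = h c * monom_eval x m"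
  by (cases "c = 0") (auto simp: mpoly_eval_def)

lemma mpoly_eval_mult: "mpoly_eval h x (P * R) = mpoly_eval h x P * mpoly_eval h x R"
proof -
  have "P * R = (\<Sum>m\<in>Poly_Mapping.keys P. \<Sum>n\<in>Poly_Mapping.keys R.
      Poly_Mapping.single (m + n) (Poly_Mapping.lookup P m * Poly_Mapping.lookup R n))"
    by (rule poly_mapping_mult_eq)
  then have "mpoly_eval h x (P * R) = (\<Sum>m\<in>Poly_Mapping.keys P. \<Sum>n\<in>Poly_Mapping.keys R.
      h (Poly_Mapping.lookup P m * Poly_Mapping.lookup R n) * monom_eval x (m + n))"
    by (simp add: mpoly_eval_sum)
  also have "\<dots> = mpoly_eval h x P * mpoly_eval h x R"
    unfolding mpoly_eval_def sum_product
    by (intro sum.cong refl) (simp add: h_mult monom_eval_add ac_simps)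
  finally show ?thesis .
qed

lemma mpoly_eval_mconst [simp]: "mpoly_eval h x (mconst c) = h c"
  by (simp add: mconst_def)

lemma mpoly_eval_mvar [simp]: "mpoly_eval h x (mvar i) = x i"
  by (simp add: mvar_def h_one)

end

lemma mpoly_single_eq:
  "Poly_Mapping.single m c = mconst c * (Poly_Mapping.single m 1 :: ('i \<Rightarrow>\<^sub>0 nat) \<Rightarrow>\<^sub>0 'k::comm_ring_1)"
  by (simp add: mconst_def mult_single)

lemma lookup_mconst_mult:
  "Poly_Mapping.lookup (mconst c * P) m = c * Poly_Mapping.lookup (P :: ('i \<Rightarrow>\<^sub>0 nat) \<Rightarrow>\<^sub>0 'k::comm_ring_1) m"
proof -
  have "mconst c * P = (\<Sum>n\<in>Poly_Mapping.keys P. Poly_Mapping.single n (c * Poly_Mapping.lookup P n))"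
    by (subst poly_mapping_sum_single[of P]) (simp add: mconst_def sum_distrib_left mult_single)
  then show ?thesis
    by (auto simp: lookup_sum lookup_single when_def in_keys_iff)
qed

interpretation pconst: ring_homomorphism "\<lambda>c::'k::comm_ring_1. [:c:]"
  by unfold_locales (auto simp: one_pCons mult.commute)

section \<open>The polynomial ring over the valuation ring\<close>

locale field_val = ring_val v for v :: "'k::field \<Rightarrow> 'g::linordered_ab_group_add extended"
begin

abbreviation RX :: "(('i::wellorder \<Rightarrow>\<^sub>0 nat) \<Rightarrow>\<^sub>0 'k) ring"
  where "RX \<equiv> OKX v"

text \<open>Coefficients outside the support are 0, of value \<infinity>, so integrality may be
  required at every exponent.\<close>

lemma carrier_iff: "P \<in> carrier RX \<longleftrightarrow>
    (\<forall>m. 0 \<le> v (Poly_Mapping.lookup P m)) \<and> (\<forall>m\<in>Poly_Mapping.keys P. Poly_Mapping.keys m \<subseteq> Istar)"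
proof -
  have "0 \<le> v (Poly_Mapping.lookup P m)" if "m \<notin> Poly_Mapping.keys P" for m
    using that by (simp add: in_keys_iff)
  then show ?thesis
    by (auto simp: OKX_def)
qed

lemma RX_simps [simp]: "x \<otimes>\<^bsub>RX\<^esub> y = x * y" "x \<oplus>\<^bsub>RX\<^esub> y = x + y" "\<zero>\<^bsub>RX\<^esub> = 0" "\<one>\<^bsub>RX\<^esub> = 1"
  by (simp_all add: OKX_def ring_of_type_algebra_def)

lemma carrier_add: "P \<in> carrier RX \<Longrightarrow> R \<in> carrier RX \<Longrightarrow> P + R \<in> carrier RX"
  using Poly_Mapping.keys_add[of P R] unfolding carrier_iff by (auto simp: lookup_add intro: add_ge)

lemma carrier_uminus: "P \<in> carrier RX \<Longrightarrow> - P \<in> carrier RX"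
  by (auto simp: carrier_iff)

lemma carrier_diff: "P \<in> carrier RX \<Longrightarrow> R \<in> carrier RX \<Longrightarrow> P - R \<in> carrier RX"
  using carrier_add[of P "-R"] carrier_uminus[of R] by simp

lemma carrier_zero: "0 \<in> carrier RX"
  by (simp add: carrier_iff)

lemma carrier_sum: "(\<And>i. i \<in> A \<Longrightarrow> f i \<in> carrier RX) \<Longrightarrow> sum f A \<in> carrier RX"
  by (induction A rule: infinite_finite_induct) (auto intro: carrier_add carrier_zero)

lemma carrier_single:
  "0 \<le> v c \<Longrightarrow> Poly_Mapping.keys m \<subseteq> Istar \<Longrightarrow> Poly_Mapping.single m c \<in> carrier RX"
  by (auto simp: carrier_iff lookup_single when_def)

lemma carrier_mult:
  assumes "P \<in> carrier RX" "R \<in> carrier RX"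
  shows "P * R \<in> carrier RX"
proof -
  have "P * R = (\<Sum>m\<in>Poly_Mapping.keys P. \<Sum>n\<in>Poly_Mapping.keys R.
      Poly_Mapping.single (m + n) (Poly_Mapping.lookup P m * Poly_Mapping.lookup R n))"
    by (rule poly_mapping_mult_eq)
  also have "\<dots> \<in> carrier RX"
  proof (intro carrier_sum carrier_single mult_nonneg)
    fix m n assume "m \<in> Poly_Mapping.keys P" "n \<in> Poly_Mapping.keys R"
    then show "Poly_Mapping.keys (m + n) \<subseteq> Istar"
      using assms Poly_Mapping.keys_add[of m n] unfolding carrier_iff by blast
  qed (use assms in \<open>auto simp: carrier_iff\<close>)
  finally show ?thesis .
qed

lemma carrier_one: "1 \<in> carrier RX"
  using carrier_single[of 1 0] by (simp flip: single_one)

lemma carrier_mconst: "0 \<le> v c \<Longrightarrow> mconst c \<in> carrier RX"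
  by (simp add: mconst_def carrier_single)

lemma carrier_mvar: "i \<in> Istar \<Longrightarrow> mvar i \<in> carrier RX"
  by (simp add: mvar_def carrier_single)

lemma cring_RX: "cring RX"
proof (intro cringI abelian_groupI comm_monoidI)
  fix P :: "('i::wellorder \<Rightarrow>\<^sub>0 nat) \<Rightarrow>\<^sub>0 'k" assume "P \<in> carrier RX"
  then show "\<exists>y\<in>carrier RX. y \<oplus>\<^bsub>RX\<^esub> P = \<zero>\<^bsub>RX\<^esub>"
    by (intro bexI[of _ "- P"]) (auto intro: carrier_uminus)
qed (auto simp: algebra_simps carrier_one carrier_zero intro: carrier_add carrier_mult)

lemma
  assumes J: "ideal J (RX :: (('i::wellorder \<Rightarrow>\<^sub>0 nat) \<Rightarrow>\<^sub>0 'k) ring)"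
  shows ideal_zero: "0 \<in> J"
    and ideal_add: "P \<in> J \<Longrightarrow> R \<in> J \<Longrightarrow> P + R \<in> J"
    and ideal_mult: "P \<in> J \<Longrightarrow> S \<in> carrier RX \<Longrightarrow> S * P \<in> J"
    and ideal_uminus: "P \<in> J \<Longrightarrow> - P \<in> J"
proof -
  interpret ideal J RX by fact
  show "0 \<in> J" using additive_subgroup.zero_closed[OF is_additive_subgroup] by simp
  show "P \<in> J \<Longrightarrow> R \<in> J \<Longrightarrow> P + R \<in> J" using additive_subgroup.a_closed[OF is_additive_subgroup, of P R] by simp
  show mult: "P \<in> J \<Longrightarrow> S \<in> carrier RX \<Longrightarrow> S * P \<in> J" for P S using I_l_closed[of P S] by simp
  show "P \<in> J \<Longrightarrow> - P \<in> J"
    using mult[of P "-1"] carrier_uminus[OF carrier_one] by simp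
qed

end

section \<open>The blocks of the index set\<close>

text \<open>Collects the combinatorics of the degrees, separated from all valuations.\<close>

locale degree_blocks =
  fixes Q :: "'i::wellorder \<Rightarrow> 'k::field poly"
  assumes finite_degrees: "finite (key_degrees Q)"
    and degree_mono: "i \<le> j \<Longrightarrow> Polynomial.degree (Q i) \<le> Polynomial.degree (Q j)"
    and last_block: "block Q (ww Q + 1) = {imax}"
    and block_shape: "q \<in> {1..ww Q + 1} \<Longrightarrow> is_singleton (block Q q) \<or>
      (\<exists>f :: nat \<Rightarrow> 'i. strict_mono f \<and> block Q q = range f)"
begin

abbreviation deg :: "'i \<Rightarrow> nat" where "deg i \<equiv> Polynomial.degree (Q i)"

lemma degree_less_imp: "deg i < deg j \<Longrightarrow> i < j"
  using degree_mono[of j i] by (metis not_le)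

text \<open>The natural subtraction in \<open>ww\<close> is exact because the finite set of degrees
  is nonempty.\<close>

lemma card_degrees: "card (key_degrees Q) = ww Q + 1"
proof -
  have "key_degrees Q \<noteq> {}" by (auto simp: key_degrees_def)
  then have "card (key_degrees Q) > 0" using finite_degrees by (simp add: card_gt_0_iff)
  then show ?thesis by (simp add: ww_def)
qed

lemma nn_less: "1 \<le> q \<Longrightarrow> q < q' \<Longrightarrow> q' \<le> ww Q + 1 \<Longrightarrow> nn Q q < nn Q q'"
  unfolding nn_def using sorted_list_of_set.strict_sorted_key_list_of_set[of "key_degrees Q"] card_degrees
  by (auto simp: sorted_wrt_iff_nth_less)

lemma nn_less_iff:
  "q \<in> {1..ww Q + 1} \<Longrightarrow> q' \<in> {1..ww Q + 1} \<Longrightarrow> nn Q q < nn Q q' \<longleftrightarrow> q < q'"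
  using nn_less[of q q'] nn_less[of q' q] by (cases q q' rule: linorder_cases) auto

lemma nn_eq_iff:
  "q \<in> {1..ww Q + 1} \<Longrightarrow> q' \<in> {1..ww Q + 1} \<Longrightarrow> nn Q q = nn Q q' \<longleftrightarrow> q = q'"
  using nn_less[of q q'] nn_less[of q' q] by (cases q q' rule: linorder_cases) auto

lemma nn_mem: "q \<in> {1..ww Q + 1} \<Longrightarrow> nn Q q \<in> key_degrees Q"
  unfolding nn_def using nth_mem[of "q - 1" "sorted_list_of_set (key_degrees Q)"] card_degrees finite_degrees
  by auto

lemma degree_eq_nn: "\<exists>q\<in>{1..ww Q + 1}. deg i = nn Q q"
proof -
  have "deg i \<in> set (sorted_list_of_set (key_degrees Q))"
    using finite_degrees by (auto simp: key_degrees_def)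
  then obtain n where "n < ww Q + 1" "sorted_list_of_set (key_degrees Q) ! n = deg i"
    using card_degrees by (auto simp: in_set_conv_nth)
  \<comment> \<open>Blocks are numbered from 1, list positions from 0.\<close>
  then show ?thesis
    by (intro bexI[of _ "n + 1"]) (auto simp: nn_def)
qed

lemma block_index: "block_index Q i \<in> {1..ww Q + 1}" "deg i = nn Q (block_index Q i)"
proof -
  obtain q where q: "q \<in> {1..ww Q + 1}" "deg i = nn Q q"
    using degree_eq_nn by blast
  have "block_index Q i = q"
    unfolding block_index_def block_def using q nn_eq_iff by (intro the_equality) auto
  with q show "block_index Q i \<in> {1..ww Q + 1}" "deg i = nn Q (block_index Q i)"
    by simp_all
qed

lemma block_index_eqI: "q \<in> {1..ww Q + 1} \<Longrightarrow> deg i = nn Q q \<Longrightarrow> block_index Q i = q"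
  using nn_eq_iff block_index by metis

lemma block_block_index: "block Q (block_index Q i) = {j. deg j = deg i}"
  by (simp add: block_def block_index(2)[symmetric])

lemma block_index_less_iff: "block_index Q i < block_index Q j \<longleftrightarrow> deg i < deg j"
  using nn_less_iff block_index by metis

lemma block_index_eq_iff: "block_index Q i = block_index Q j \<longleftrightarrow> deg i = deg j"
  using nn_eq_iff block_index by metis

lemma block_index_imax: "block_index Q imax = ww Q + 1"
  using last_block by (intro block_index_eqI) (auto simp: block_def)

text \<open>The last block contains only \<open>imax\<close>, so no other index reaches the maximal
  degree; membership in \<open>Istar\<close> can be read off from degrees.\<close>

lemma Istar_iff: "i \<in> Istar \<longleftrightarrow> deg i < deg imax"
proof -
  have "deg i = deg imax \<longleftrightarrow> i = imax"
    using last_block block_block_index[of imax] block_index_imax by auto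
  moreover have "deg i \<le> deg imax"
    using block_index(1)[of i] block_index_less_iff[of imax i] block_index_imax by (simp add: not_less[symmetric])
  ultimately show ?thesis by auto
qed

lemma Istar_block_index: "i \<in> Istar \<longleftrightarrow> block_index Q i \<in> {1..ww Q}"
  using block_index(1)[of i] block_index_less_iff[of i imax] block_index_imax Istar_iff[of i] by auto

lemma le_imax: "(i::'i) \<le> imax"
  using Istar_iff[of i] degree_less_imp[of i imax] by (cases "i = imax") auto

text \<open>No degree of the sequence lies strictly between two consecutive ones.\<close>

lemma degree_plus_le: "deg k < deg j \<Longrightarrow> degree_plus Q k \<le> deg j"
  using block_index_less_iff[of k j] block_index(1)[of k] block_index[of j]
    nn_less_iff[of "block_index Q j" "block_index Q k + 1"]
  unfolding degree_plus_def by (auto simp: not_less[symmetric])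

lemma degree_plus_attained:
  assumes "k \<in> Istar"
  obtains j where "deg j = degree_plus Q k" "block_index Q j = block_index Q k + 1" "deg k < deg j"
proof -
  have q: "block_index Q k + 1 \<in> {1..ww Q + 1}"
    using assms Istar_block_index by auto
  then obtain j where j: "deg j = degree_plus Q k"
    using nn_mem[OF q] unfolding degree_plus_def key_degrees_def by auto
  then have "block_index Q j = block_index Q k + 1"
    using q by (intro block_index_eqI) (auto simp: degree_plus_def)
  moreover from this have "deg k < deg j"
    by (simp flip: block_index_less_iff)
  ultimately show ?thesis using that j by blast
qed

text \<open>A block is a singleton or infinite, so a finite one consists of i alone.\<close>

lemma finite_block:
  assumes "finite (block Q (block_index Q i))"
  shows "deg j = deg i \<longleftrightarrow> j = i" "offset Q i = 0"
proof -
  let ?B = "block Q (block_index Q i)"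
  have "is_singleton ?B"
    using block_shape[OF block_index(1)[of i]] assms
    by (metis infinite_UNIV_nat finite_imageD strict_mono_imp_inj_on)
  moreover have "i \<in> ?B"
    by (simp add: block_block_index)
  ultimately have B: "?B = {i}"
    by (auto simp: is_singleton_def)
  then show "deg j = deg i \<longleftrightarrow> j = i"
    using block_block_index[of i] by auto
  have "{k \<in> ?B. k < i} = {}" using B by auto
  then show "offset Q i = 0" by (simp only: offset_def card.empty)
qed

text \<open>The enumeration is by offset. By monotonicity of degrees, an index between two
  neighbours would lie in the same block, so neighbours in the block are neighbours in I.\<close>

lemma infinite_block:
  assumes "infinite (block Q (block_index Q i))"
  obtains f where "strict_mono f" "\<And>j. deg j = deg i \<longleftrightarrow> j \<in> range f" "\<And>n. offset Q (f n) = n"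
    "\<And>n. immediate_succ (f n) (f (Suc n))"
proof -
  let ?B = "block Q (block_index Q i)"
  obtain f :: "nat \<Rightarrow> 'i" where f: "strict_mono f" "?B = range f"
    using block_shape[OF block_index(1)[of i]] assms by (metis is_singleton_def finite.simps)
  then have deg: "deg j = deg i \<longleftrightarrow> j \<in> range f" for j
    using block_block_index by auto
  moreover have "offset Q (f n) = n" for n
  proof -
    have "block_index Q (f n) = block_index Q i"
      using deg block_index_eq_iff by auto
    then have "{k \<in> block Q (block_index Q (f n)). k < f n} = f ` {..<n}"
      using f by (auto simp: strict_mono_less)
    moreover have "inj_on f {..<n}"
      by (rule inj_on_subset[OF strict_mono_imp_inj_on[OF f(1)] subset_UNIV])
    ultimately show ?thesis
      by (simp add: offset_def card_image)
  qed
  moreover have "immediate_succ (f n) (f (Suc n))" for n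
  proof -
    have "\<not> (f n < k \<and> k < f (Suc n))" for k
    proof
      assume k: "f n < k \<and> k < f (Suc n)"
      then have "deg (f n) \<le> deg k" "deg k \<le> deg (f (Suc n))"
        by (auto intro: degree_mono)
      moreover have "deg (f n) = deg i" "deg (f (Suc n)) = deg i"
        using deg by auto
      ultimately have "deg k = deg i" by simp
      then obtain m where "k = f m" using deg by auto
      with k f(1) show False by (auto simp: strict_mono_less)
    qed
    then show ?thesis
      using f(1) by (simp add: immediate_succ_def strict_mono_less)
  qed
  ultimately show ?thesis using that f(1) by blast
qed

lemma offset_inj:
  assumes "deg i = deg j" "offset Q i = offset Q j"
  shows "i = j"
proof (cases "finite (block Q (block_index Q j))")
  case True
  then show ?thesis using finite_block(1) assms by blast
next
  case False
  then obtain f where "\<And>k. deg k = deg j \<longleftrightarrow> k \<in> range f" "\<And>n. offset Q (f n) = n"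
    using infinite_block by metis
  with assms show ?thesis by (metis rangeE)
qed

end

section \<open>Mixed radix expansions\<close>

text \<open>With f the degrees of the key polynomials, this is the degree of the value of a
  monomial. Other choices of f serve in the termination measure of the rewriting.\<close>

definition weight :: "('i \<Rightarrow> nat) \<Rightarrow> ('i \<Rightarrow>\<^sub>0 nat) \<Rightarrow> nat"
  where "weight f m = (\<Sum>k\<in>Poly_Mapping.keys m. Poly_Mapping.lookup m k * f k)"

lemma weight_superset:
  "finite A \<Longrightarrow> Poly_Mapping.keys m \<subseteq> A \<Longrightarrow> weight f m = (\<Sum>k\<in>A. Poly_Mapping.lookup m k * f k)"
  unfolding weight_def by (rule sum.mono_neutral_left) (auto simp: in_keys_iff)

lemma weight_single [simp]: "weight f (Poly_Mapping.single i n) = n * f i"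
  by (cases "n = 0") (auto simp: weight_def)

lemma weight_add: "weight f (m + n) = weight f m + weight f n"
proof -
  let ?A = "Poly_Mapping.keys m \<union> Poly_Mapping.keys n"
  have "weight f (m + n) = (\<Sum>k\<in>?A. Poly_Mapping.lookup (m + n) k * f k)"
    using Poly_Mapping.keys_add[of m n] by (intro weight_superset) auto
  then show ?thesis
    by (simp add: weight_superset[of ?A] lookup_add distrib_right sum.distrib)
qed

text \<open>Exponents on \<open>S\<close>, read as digits in the mixed radix system of the degrees; the digit at the last
  element of \<open>S\<close> is unbounded.\<close>

definition digits :: "('i::wellorder \<Rightarrow> 'k::zero poly) \<Rightarrow> 'i set \<Rightarrow> ('i \<Rightarrow>\<^sub>0 nat) \<Rightarrow> bool"
  where "digits Q S m \<longleftrightarrow> Poly_Mapping.keys m \<subseteq> S \<and>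
    (\<forall>k\<in>S. (\<exists>k'\<in>S. k < k') \<longrightarrow> Poly_Mapping.lookup m k * Polynomial.degree (Q k) < degree_plus Q k)"

text \<open>Each place value divides the next, as mixed radix notation requires.\<close>

locale radix = degree_blocks +
  assumes degree_pos: "0 < deg i"
    and degree_dvd: "i \<in> Istar \<Longrightarrow> j \<in> Istar \<Longrightarrow> deg j = degree_plus Q i \<Longrightarrow> deg i dvd deg j"
begin

text \<open>At the largest index j < k in use, divisibility turns the strict digit bound into room
  for one more copy of the degree at j, and by induction that copy exceeds everything below
  j.\<close>

lemma digits_partial_less:
  assumes "S \<subseteq> Istar" "inj_on deg S" "digits Q S m" "k \<in> S"
  shows "(\<Sum>j\<in>Poly_Mapping.keys m \<inter> {..<k}. Poly_Mapping.lookup m j * deg j) < deg k"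
  using assms(4)
proof (induction k rule: less_induct)
  case (less k)
  let ?A = "Poly_Mapping.keys m \<inter> {..<k}"
  show ?case
  proof (cases "?A = {}")
    case True
    show ?thesis using degree_pos[of k] by (simp only: True sum.empty)
  next
    case False
    define j where "j = Max ?A"
    have fin: "finite ?A" by simp
    have j: "j \<in> ?A" "\<And>j'. j' \<in> ?A \<Longrightarrow> j' \<le> j"
      unfolding j_def using Max_in[OF fin False] Max_ge[OF fin] by auto
    then have jS: "j \<in> S" "j < k" using assms(3) by (auto simp: digits_def)
    have A: "?A = insert j (Poly_Mapping.keys m \<inter> {..<j})"
    proof (intro equalityI subsetI)
      fix x assume "x \<in> ?A"
      then show "x \<in> insert j (Poly_Mapping.keys m \<inter> {..<j})"
        using j(2)[of x] by (auto simp: order.strict_iff_order)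
    next
      fix x assume "x \<in> insert j (Poly_Mapping.keys m \<inter> {..<j})"
      then show "x \<in> ?A" using j(1) by auto
    qed
    have degjk: "deg j < deg k"
      using jS less.prems assms(2) degree_mono[of j k]
      by (metis inj_on_eq_iff order.strict_iff_order)
    obtain l where l: "deg l = degree_plus Q j"
      using degree_plus_attained[of j] jS assms(1) by blast
    have "deg l \<le> deg k"
      using degree_plus_le[OF degjk] l by simp
    then have "l \<in> Istar"
      using assms(1) less.prems Istar_iff[of l] Istar_iff[of k] by auto
    then have "deg j dvd deg l"
      using degree_dvd[of j l] jS assms(1) l by auto
    moreover have "Poly_Mapping.lookup m j * deg j < deg l"
      using assms(3) jS less.prems l by (auto simp: digits_def)
    ultimately have "(Poly_Mapping.lookup m j + 1) * deg j \<le> deg l"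
      by (metis Suc_eq_plus1 Suc_leI dvdE mult.commute mult_le_mono2 nat_mult_less_cancel_disj)
    moreover have "(\<Sum>i\<in>?A. Poly_Mapping.lookup m i * deg i)
        = Poly_Mapping.lookup m j * deg j + (\<Sum>i\<in>Poly_Mapping.keys m \<inter> {..<j}. Poly_Mapping.lookup m i * deg i)"
      unfolding A by (subst sum.insert) auto
    ultimately show ?thesis
      using less.IH[OF jS(2) jS(1)] \<open>deg l \<le> deg k\<close> by simp
  qed
qed

text \<open>A gain of one at the highest differing digit outweighs all lower digits
  together.\<close>

lemma digits_weight_less:
  assumes S: "S \<subseteq> Istar" "inj_on deg S" and m: "digits Q S m" and m': "digits Q S m'"
    and k: "Poly_Mapping.lookup m k < Poly_Mapping.lookup m' k"
    and eq: "\<And>j. j > k \<Longrightarrow> Poly_Mapping.lookup m j = Poly_Mapping.lookup m' j"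
  shows "weight deg m < weight deg m'"
proof -
  let ?A = "Poly_Mapping.keys m \<union> Poly_Mapping.keys m'"
  have kA: "k \<in> ?A" "k \<in> S" using k m' by (auto simp: in_keys_iff digits_def)
  have split: "(\<Sum>j\<in>?A. f j) = (\<Sum>j\<in>?A \<inter> {..<k}. f j) + f k + (\<Sum>j\<in>?A \<inter> {k<..}. f j)"
    for f :: "_ \<Rightarrow> nat"
  proof -
    have "?A = (?A \<inter> {..<k}) \<union> {k} \<union> (?A \<inter> {k<..})" using kA by auto
    then have "sum f ?A = sum f ((?A \<inter> {..<k}) \<union> {k} \<union> (?A \<inter> {k<..}))" by (rule arg_cong)
    also have "\<dots> = (\<Sum>j\<in>?A \<inter> {..<k}. f j) + f k + (\<Sum>j\<in>?A \<inter> {k<..}. f j)"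
      by (subst sum.union_disjoint; (subst sum.union_disjoint)?) auto
    finally show ?thesis .
  qed
  have "(\<Sum>j\<in>?A \<inter> {..<k}. Poly_Mapping.lookup m j * deg j)
      = (\<Sum>j\<in>Poly_Mapping.keys m \<inter> {..<k}. Poly_Mapping.lookup m j * deg j)"
    by (rule sum.mono_neutral_right) (auto simp: in_keys_iff)
  also have "\<dots> < deg k"
    using digits_partial_less[OF S m kA(2)] .
  finally have 1: "(\<Sum>j\<in>?A \<inter> {..<k}. Poly_Mapping.lookup m j * deg j) < deg k" .
  have 2: "(\<Sum>j\<in>?A \<inter> {k<..}. Poly_Mapping.lookup m j * deg j) = (\<Sum>j\<in>?A \<inter> {k<..}. Poly_Mapping.lookup m' j * deg j)"
    using eq by (intro sum.cong) auto
  have "(Poly_Mapping.lookup m k + 1) * deg k \<le> Poly_Mapping.lookup m' k * deg k"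
    using k by (intro mult_right_mono) auto
  then have "deg k + Poly_Mapping.lookup m k * deg k \<le> Poly_Mapping.lookup m' k * deg k"
    by simp
  with 1 2 show ?thesis
    by (simp add: weight_superset[of ?A] split)
qed

lemma digits_weight_inj:
  assumes S: "S \<subseteq> Istar" "inj_on deg S" and m: "digits Q S m" "digits Q S m'"
    and eq: "weight deg m = weight deg m'"
  shows "m = m'"
proof (rule ccontr)
  assume ne: "m \<noteq> m'"
  let ?D = "{k. Poly_Mapping.lookup m k \<noteq> Poly_Mapping.lookup m' k}"
  have "?D \<subseteq> Poly_Mapping.keys m \<union> Poly_Mapping.keys m'"
    by (auto simp: in_keys_iff)
  then have fin: "finite ?D" by (rule finite_subset) simp
  have neD: "?D \<noteq> {}" using ne poly_mapping_eqI[of m m'] by blast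
  define k where "k = Max ?D"
  have k: "k \<in> ?D" using Max_in[OF fin neD] by (simp add: k_def)
  have gt: "Poly_Mapping.lookup m j = Poly_Mapping.lookup m' j" if "j > k" for j
    using Max_ge[OF fin, of j] that leD by (auto simp: k_def)
  from k consider "Poly_Mapping.lookup m k < Poly_Mapping.lookup m' k" | "Poly_Mapping.lookup m' k < Poly_Mapping.lookup m k"
    using linorder_neqE_nat by blast
  then show False
  proof cases
    case 1
    with digits_weight_less[OF S m(1) m(2)] gt eq show False by force
  next
    case 2
    with digits_weight_less[OF S m(2) m(1)] gt eq show False by force
  qed
qed

text \<open>Distinct monomials have values of distinct degrees, so the one of greatest weight
  determines the leading coefficient alone.\<close>

lemma leading_term:
  fixes F :: "('a \<Rightarrow>\<^sub>0 nat) \<Rightarrow>\<^sub>0 'b"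
  assumes T: "\<And>k. Polynomial.degree (T k) = deg k"
    and S: "S \<subseteq> Istar" "inj_on deg S" and F: "F \<noteq> 0" "\<And>m. m \<in> Poly_Mapping.keys F \<Longrightarrow> digits Q S m"
  obtains m0 where "m0 \<in> Poly_Mapping.keys F"
    "\<And>m. m \<in> Poly_Mapping.keys F \<Longrightarrow> m \<noteq> m0 \<Longrightarrow> weight deg m < weight deg m0"
    "Polynomial.degree (mpoly_eval (\<lambda>c. [:c:]) T F) = weight deg m0"
    "Polynomial.lead_coeff (mpoly_eval (\<lambda>c. [:c:]) T F) =
      Poly_Mapping.lookup F m0 * Polynomial.lead_coeff (monom_eval T m0)"
    "mpoly_eval (\<lambda>c. [:c:]) T F \<noteq> 0"
proof -
  let ?f = "mpoly_eval (\<lambda>c. [:c:]) T F"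
  have T0: "T k \<noteq> 0" for k using T[of k] degree_pos[of k] by auto
  have degm: "Polynomial.degree (monom_eval T m) = weight deg m" and m_ne: "monom_eval T m \<noteq> 0" for m
  proof -
    show "monom_eval T m \<noteq> 0" using T0 by (simp add: monom_eval_def)
    have "Polynomial.degree (monom_eval T m)
        = (\<Sum>k\<in>Poly_Mapping.keys m. Polynomial.degree (T k ^ Poly_Mapping.lookup m k))"
      unfolding monom_eval_def using T0 by (intro degree_prod_eq_sum_degree) auto
    also have "\<dots> = weight deg m"
      unfolding weight_def using T0 T by (intro sum.cong) (auto simp: degree_power_eq)
    finally show "Polynomial.degree (monom_eval T m) = weight deg m" .
  qed
  have "weight deg ` Poly_Mapping.keys F \<noteq> {}"
    using F(1) by (metis image_is_empty poly_mapping_eqI lookup_zero in_keys_iff empty_iff)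
  then have "Max (weight deg ` Poly_Mapping.keys F) \<in> weight deg ` Poly_Mapping.keys F"
    by (intro Max_in) auto
  then obtain m0 where m0: "m0 \<in> Poly_Mapping.keys F" "weight deg m0 = Max (weight deg ` Poly_Mapping.keys F)"
    by auto
  have less: "weight deg m < weight deg m0" if "m \<in> Poly_Mapping.keys F" "m \<noteq> m0" for m
  proof -
    have "weight deg m \<le> weight deg m0" using m0(2) that(1) by simp
    moreover have "weight deg m \<noteq> weight deg m0"
      using digits_weight_inj[OF S F(2) F(2)] that m0(1) by blast
    ultimately show ?thesis by simp
  qed
  let ?t = "\<lambda>m. [:Poly_Mapping.lookup F m:] * monom_eval T m"
  have degt: "Polynomial.degree (?t m) \<le> weight deg m" for m
    using degm[of m] by (simp add: degree_smult_le)
  have f: "?f = ?t m0 + (\<Sum>m\<in>Poly_Mapping.keys F - {m0}. ?t m)"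
    unfolding mpoly_eval_def using m0(1) by (subst sum.remove[of _ m0]) auto
  have hi: "Polynomial.coeff (\<Sum>m\<in>Poly_Mapping.keys F - {m0}. ?t m) n = 0" if "n \<ge> weight deg m0" for n
    unfolding coeff_sum
  proof (intro sum.neutral ballI coeff_eq_0)
    fix m assume "m \<in> Poly_Mapping.keys F - {m0}"
    then show "Polynomial.degree (?t m) < n"
      using degt[of m] less[of m] that by auto
  qed
  have lead: "Polynomial.coeff ?f (weight deg m0) = Poly_Mapping.lookup F m0 * Polynomial.lead_coeff (monom_eval T m0)"
    unfolding f using hi[OF order_refl] degm[of m0] by simp
  moreover have ne: "\<dots> \<noteq> 0"
    using m0(1) m_ne[of m0] by (simp add: in_keys_iff)
  moreover have "Polynomial.coeff ?f n = 0" if "n > weight deg m0" for n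
    unfolding f using hi[of n] degt[of m0] that by (simp add: coeff_eq_0 degm)
  ultimately have deg: "Polynomial.degree ?f = weight deg m0"
    by (intro antisym degree_le le_degree) auto
  then show ?thesis
    using that[of m0] m0(1) less lead ne by (metis coeff_0)
qed

lemma digits_eval_eq_0:
  fixes F :: "('a \<Rightarrow>\<^sub>0 nat) \<Rightarrow>\<^sub>0 'b"
  assumes "\<And>k. Polynomial.degree (T k) = deg k"
    and "S \<subseteq> Istar" "inj_on deg S" "\<And>m. m \<in> Poly_Mapping.keys F \<Longrightarrow> digits Q S m"
    and "mpoly_eval (\<lambda>c. [:c:]) T F = 0"
  shows "F = 0"
  using leading_term[OF assms(1-3) _ assms(4)] assms(5) by metis

end

section \<open>Neat pairs and their levels\<close>

context degree_blocks
begin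

text \<open>For a pair that is not immediate, the offset of l is 0 if its block is finite, and
  equals that of i by neatness otherwise.\<close>

lemma pair_level_eq:
  assumes "neat_pair Q l i"
  shows "pair_level Q l i = offset Q i"
proof (cases "immediate_succ i l")
  case False
  then have *: "infinite (block Q (block_index Q i))" "block_index Q l = block_index Q i + 1"
    using assms by (auto simp: neat_pair_def succ_rel_def)
  then have "offset Q l \<le> offset Q i"
    using assms finite_block(2)[of l] by (cases "finite (block Q (block_index Q l))") (auto simp: neat_pair_def)
  then show ?thesis
    using False by (simp add: pair_level_def)
qed (simp add: pair_level_def)

lemma neat_pair_Istar: "neat_pair Q l i \<Longrightarrow> i \<in> Istar"
  using le_imax[of l] unfolding neat_pair_def succ_rel_def by force

text \<open>The immediate successor of i stays in the infinite block; this pair serves to raise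
  offsets one at a time.\<close>

lemma neat_pair_same_block:
  assumes "infinite (block Q (block_index Q i))"
  obtains l where "neat_pair Q l i" "deg l = deg i" "offset Q l = Suc (offset Q i)"
proof -
  obtain f where f: "\<And>j. deg j = deg i \<longleftrightarrow> j \<in> range f" "\<And>n. offset Q (f n) = n"
    "\<And>n. immediate_succ (f n) (f (Suc n))"
    using infinite_block[OF assms] by metis
  define l where "l = f (Suc (offset Q i))"
  have i: "i = f (offset Q i)"
    using f(1)[of i] f(2) by auto
  have "deg l = deg i" unfolding l_def using f(1) by auto
  moreover have "immediate_succ i l"
    unfolding l_def using f(3) i by metis
  moreover from this have "i < l" by (simp add: immediate_succ_def)
  ultimately show ?thesis
    using that[of l] f(2)[of "Suc (offset Q i)"] block_index_eq_iff[of i l]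
    by (simp add: neat_pair_def succ_rel_def flip: l_def)
qed

text \<open>If the block of i is infinite, the element of equal offset in the next block is chosen,
  or its only element. If it is finite, the immediate successor begins the next block.\<close>

lemma neat_pair_next_block:
  assumes "deg i < deg j"
  obtains l where "neat_pair Q l i" "deg i < deg l" "deg l = degree_plus Q i" "offset Q l \<le> offset Q i"
proof -
  have i: "i \<in> Istar"
    using degree_less_imp[OF assms] le_imax[of j] by auto
  obtain l where l: "deg l = degree_plus Q i" "block_index Q l = block_index Q i + 1" "deg i < deg l"
    using degree_plus_attained[OF i] .
  show ?thesis
  proof (cases "finite (block Q (block_index Q i))")
    case False
    show ?thesis
    proof (cases "finite (block Q (block_index Q l))")
      case True
      then show ?thesis
        using that[of l] l finite_block(2)[OF True] False degree_less_imp[OF l(3)]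
        by (simp add: neat_pair_def succ_rel_def)
    next
      case inf: False
      then obtain f where f: "\<And>j. deg j = deg l \<longleftrightarrow> j \<in> range f" "\<And>n. offset Q (f n) = n"
        using infinite_block by metis
      let ?l = "f (offset Q i)"
      have "deg ?l = deg l" using f(1) by auto
      moreover from this have "block_index Q ?l = block_index Q l"
        using block_index_eq_iff by blast
      ultimately show ?thesis
        using that[of ?l] l f(2) False degree_less_imp[of i ?l] by (simp add: neat_pair_def succ_rel_def)
    qed
  next
    case True
    define l' where "l' = (LEAST k. i < k)"
    have il: "i < l'" and least: "\<And>k. i < k \<Longrightarrow> l' \<le> k"
      unfolding l'_def using LeastI[of "\<lambda>k. i < k", OF degree_less_imp[OF l(3)]] Least_le[of "\<lambda>k. i < k"] by auto
    then have imm: "immediate_succ i l'" using leD by (auto simp: immediate_succ_def)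
    have "deg i \<noteq> deg l'" using finite_block(1)[OF True, of l'] il by auto
    then have less: "deg i < deg l'" using degree_mono[of i l'] il by (metis le_neq_implies_less order.strict_implies_order)
    have "deg l' = deg l"
      using degree_plus_le[OF less] degree_mono[OF least[OF degree_less_imp[OF l(3)]]] l(1) by simp
    moreover have "\<not> (k \<in> block Q (block_index Q l') \<and> k < l')" for k
    proof
      assume k: "k \<in> block Q (block_index Q l') \<and> k < l'"
      then have "k \<le> i" using least[of k] by (auto simp: not_less[symmetric])
      with k less degree_mono[of k i] show False
        by (simp add: block_block_index)
    qed
    then have "{k \<in> block Q (block_index Q l'). k < l'} = {}" by blast
    then have "offset Q l' = 0" by (simp only: offset_def card.empty)
    ultimately show ?thesis
      using that[of l'] l imm il True less by (simp add: neat_pair_def succ_rel_def)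
  qed
qed

end

section \<open>Neat complete sequences of key polynomials\<close>

locale neat_key_sequence =
  fixes \<iota> :: "'k::field \<Rightarrow> 'l::field"
    and v :: "'l \<Rightarrow> 'g::linordered_ab_group_add extended"
    and \<eta> :: 'l
    and \<nu>bar :: "'k alg_closure poly \<Rightarrow> 'g extended"
    and Q :: "'i::wellorder \<Rightarrow> 'k poly"
    and a :: "'i \<Rightarrow> 'k"
    and E :: "'i \<Rightarrow> 'i \<Rightarrow> (('i \<Rightarrow>\<^sub>0 nat) \<Rightarrow>\<^sub>0 'k)"
    and b :: "'i \<Rightarrow> 'i \<Rightarrow> 'k"
  assumes simple: "simple_algebraic_extension \<iota> \<eta>"
    and valuation: "field_valuation v"
    and closure: "extends_to_closure \<nu>bar (nu \<iota> v \<eta>)"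
    and complete: "complete_key_sequence (nu \<iota> v \<eta>) \<nu>bar Q"
    and normalized: "normalized \<iota> v \<eta> Q a"
    and strongly: "successively_strongly_monic (nu \<iota> v \<eta>) Q"
    and neat: "neat_family (nu \<iota> v \<eta>) (v \<circ> \<iota>) Q (Qtilde \<iota> \<eta> Q a) E"
    and scalars: "admissible_scalars (nu \<iota> v \<eta>) (v \<circ> \<iota>) Q (Qtilde \<iota> \<eta> Q a) E b"
begin

abbreviation \<nu> :: "'k poly \<Rightarrow> 'g extended" where "\<nu> \<equiv> nu \<iota> v \<eta>"
abbreviation T :: "'i \<Rightarrow> 'k poly" where "T \<equiv> Qtilde \<iota> \<eta> Q a"
abbreviation trunc :: "'i \<Rightarrow> 'k poly \<Rightarrow> 'g extended" where "trunc i \<equiv> truncation \<nu> (Q i)"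
abbreviation ev :: "(('i \<Rightarrow>\<^sub>0 nat) \<Rightarrow>\<^sub>0 'k) \<Rightarrow> 'k poly" where "ev \<equiv> mpoly_eval (\<lambda>c. [:c:]) T"
abbreviation ev\<^sub>L :: "(('i \<Rightarrow>\<^sub>0 nat) \<Rightarrow>\<^sub>0 'k) \<Rightarrow> 'l"
  where "ev\<^sub>L \<equiv> mpoly_eval \<iota> (\<lambda>i. poly (map_poly \<iota> (T i)) \<eta>)"

sublocale emb: field_homomorphism \<iota>
  using simple by unfold_locales (auto simp: simple_algebraic_extension_def field_embedding_def
      ring_hom_def ring_of_type_algebra_def)

sublocale iota: ring_homomorphism \<iota>
  by unfold_locales (auto simp: emb.hom_add emb.hom_mult)

sublocale vL: ring_val v
  using valuation by unfold_locales (simp add: field_valuation_def)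

sublocale vK: field_val "v \<circ> \<iota>"
  by unfold_locales (auto simp: ring_valuation_def emb.hom_add emb.hom_mult vL.mult vL.add)

sublocale closure_valuation \<nu>bar \<nu>
  using closure by unfold_locales

text \<open>The homomorphism to L factors through K[x], so its kernel is controlled by divisibility
  by the minimal polynomial.\<close>

lemma poly_ev: "poly (map_poly \<iota> (ev F)) \<eta> = ev\<^sub>L F"
proof -
  have prod: "map_poly \<iota> (prod f A) = (\<Prod>x\<in>A. map_poly \<iota> (f x))" for f :: "'i \<Rightarrow> _" and A
    by (induction A rule: infinite_finite_induct) (auto simp: emb.map_poly_mult)
  have mon: "poly (map_poly \<iota> (monom_eval T m)) \<eta> = monom_eval (\<lambda>i. poly (map_poly \<iota> (T i)) \<eta>) m" for m
    by (simp add: monom_eval_def prod poly_prod emb.map_poly_power)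
  show ?thesis
    unfolding mpoly_eval_def emb.map_poly_sum poly_sum emb.map_poly_mult poly_mult mon
    by (simp add: map_poly_pCons)
qed

lemma nu_infinite_iff: "\<nu> f = \<infinity> \<longleftrightarrow> poly (map_poly \<iota> f) \<eta> = 0"
  using valuation by (auto simp: nu_def field_valuation_def)

lemma nu_const: "\<nu> [:c:] = v (\<iota> c)"
  by (simp add: nu_def map_poly_pCons)

section \<open>The minimal polynomial and the top of the key sequence\<close>

definition g where "g = min_poly \<iota> \<eta>"

text \<open>The definite description in \<open>min_poly\<close> needs a unique candidate: an
  annihilating polynomial of least degree can be made monic, and the difference of two such would
  have smaller degree.\<close>

lemma g_monic: "Polynomial.lead_coeff g = 1"
  and g_root: "poly (map_poly \<iota> g) \<eta> = 0"
  and g_minimal: "h \<noteq> 0 \<Longrightarrow> poly (map_poly \<iota> h) \<eta> = 0 \<Longrightarrow> Polynomial.degree g \<le> Polynomial.degree h"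
proof -
  let ?P = "\<lambda>h::'k poly. h \<noteq> 0 \<and> poly (map_poly \<iota> h) \<eta> = 0"
  obtain p where p: "?P p" using simple by (auto simp: simple_algebraic_extension_def)
  obtain g0 where g0: "?P g0" "\<And>h. ?P h \<Longrightarrow> Polynomial.degree g0 \<le> Polynomial.degree h"
    using ex_has_least_nat[of ?P p Polynomial.degree] p by blast
  define g1 where "g1 = Polynomial.smult (inverse (Polynomial.lead_coeff g0)) g0"
  have smult: "map_poly \<iota> (Polynomial.smult c f) = Polynomial.smult (\<iota> c) (map_poly \<iota> f)" for c f
    using emb.map_poly_mult[of "[:c:]" f] by (simp add: map_poly_pCons)
  let ?R = "\<lambda>g. Polynomial.lead_coeff g = 1 \<and> poly (map_poly \<iota> g) \<eta> = 0 \<and>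
    (\<forall>h. h \<noteq> 0 \<and> poly (map_poly \<iota> h) \<eta> = 0 \<longrightarrow> Polynomial.degree g \<le> Polynomial.degree h)"
  have R1: "?R g1"
    using g0 by (auto simp: g1_def smult)
  have "g' = g1" if R: "?R g'" for g'
  proof (rule ccontr)
    assume ne: "g' \<noteq> g1"
    have deg: "Polynomial.degree g' = Polynomial.degree g1"
      using R R1 by (metis antisym leading_coeff_0_iff zero_neq_one)
    have root: "poly (map_poly \<iota> (g' - g1)) \<eta> = 0"
      using R R1 by (simp add: emb.map_poly_diff)
    with R ne have le: "Polynomial.degree g' \<le> Polynomial.degree (g' - g1)" by auto
    moreover have "Polynomial.degree (g' - g1) \<le> Polynomial.degree g'"
      by (rule degree_diff_le) (use deg in auto)
    ultimately have "Polynomial.lead_coeff (g' - g1) = 0"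
      using R R1 deg by simp
    then have "g' - g1 = 0" by (simp only: leading_coeff_0_iff)
    with ne show False by simp
  qed
  with R1 have "?R g" unfolding g_def min_poly_def by (intro theI[where P = ?R]) auto
  then show "Polynomial.lead_coeff g = 1" "poly (map_poly \<iota> g) \<eta> = 0"
    "h \<noteq> 0 \<Longrightarrow> poly (map_poly \<iota> h) \<eta> = 0 \<Longrightarrow> Polynomial.degree g \<le> Polynomial.degree h"
    by auto
qed

lemma g_nonzero: "g \<noteq> 0" using g_monic by auto

lemma g_degree: "0 < Polynomial.degree g"
proof (rule ccontr)
  assume "\<not> ?thesis"
  then obtain c where c: "g = [:c:]" using degree_eq_zeroE[of g] by auto
  with g_monic have "c = 1" by simp
  with c g_root show False by (simp add: map_poly_pCons)
qed

lemma g_dvd: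
  assumes "poly (map_poly \<iota> f) \<eta> = 0"
  shows "g dvd f"
proof (rule ccontr)
  assume "\<not> g dvd f"
  then have r: "f mod g \<noteq> 0" "Polynomial.degree (f mod g) < Polynomial.degree g"
    using degree_mod_less[of g f] g_nonzero by (auto simp: dvd_eq_mod_eq_0)
  have "poly (map_poly \<iota> (f div g * g + f mod g)) \<eta> = 0"
    using assms by (simp only: div_mult_mod_eq)
  then have "poly (map_poly \<iota> (f mod g)) \<eta> = 0"
    unfolding emb.map_poly_add emb.map_poly_mult using g_root by simp
  with g_minimal[OF r(1)] r(2) show False by simp
qed

lemma key: "key_polynomial \<nu>bar (Q i)"
  and epsilon_mono: "strict_mono (\<lambda>i. epsilon \<nu>bar (Q i))"
  and complete_set: "complete_set \<nu> (range Q)"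
  using complete by (auto simp: complete_key_sequence_def)

lemma epsilon_less_iff: "epsilon \<nu>bar (Q i) < epsilon \<nu>bar (Q j) \<longleftrightarrow> i < j"
  using strict_mono_less[OF epsilon_mono] .

lemma epsilon_le_iff: "epsilon \<nu>bar (Q i) \<le> epsilon \<nu>bar (Q j) \<longleftrightarrow> i \<le> j"
  using strict_mono_less_eq[OF epsilon_mono] .

lemma Q_monic: "Polynomial.lead_coeff (Q i) = 1" and Q_degree_pos: "0 < Polynomial.degree (Q i)"
  using key[of i] by (auto simp: key_polynomial_def)

text \<open>With a finite nearest distance, \<open>\<nu> g\<close> would be finite too, although
  \<open>g\<close> vanishes at \<eta>.\<close>

lemma epsilon_g: "epsilon \<nu>bar g = \<infinity>"
proof -
  obtain \<alpha> where \<alpha>: "epsilon \<nu>bar g = \<nu>bar [:- \<alpha>, 1:]"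
    using epsilon_attained[OF g_degree] .
  show ?thesis
  proof (cases "epsilon \<nu>bar g")
    case (Fin d)
    with \<alpha> obtain \<gamma> where "\<nu> g = Fin \<gamma>"
      using initial_map_poly[of \<alpha> d g] g_nonzero by (metis order_refl)
    then show ?thesis using nu_infinite_iff[of g] g_root by simp
  qed (use \<alpha> in auto)
qed

text \<open>Completeness applied to \<open>g\<close> yields a key polynomial at which the truncation
  of \<open>g\<close> is infinite. It must vanish at \<eta>, hence equal \<open>g\<close>, and its
  infinite \<open>epsilon\<close> makes it the last one.\<close>

lemma Q_imax: "Q imax = g" and Q_le_imax: "(i::'i) \<le> imax"
proof -
  obtain i0 where i0: "Polynomial.degree (Q i0) \<le> Polynomial.degree g" "truncation \<nu> (Q i0) g = \<nu> g"
    using complete_set g_degree unfolding complete_set_def by blast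
  then have inf: "\<nu> (Polynomial.coeff (q_expansion (Q i0) g) j * Q i0 ^ j) = \<infinity>" for j
    using nu_infinite_iff[of g] g_root truncation_ge_iff[OF ring_val_axioms, of "\<infinity>" "Q i0" g] by auto
  have "q_expansion (Q i0) g \<noteq> 0"
    using poly_q_expansion[OF Q_degree_pos, of i0 g] g_nonzero by auto
  then obtain j where j: "Polynomial.coeff (q_expansion (Q i0) g) j \<noteq> 0"
    by (auto simp: poly_eq_iff)
  \<comment> \<open>The coefficient has degree below that of \<open>g\<close>, so the infinite value
    of its term must come from \<open>Q i0\<close>.\<close>
  have "poly (map_poly \<iota> (Polynomial.coeff (q_expansion (Q i0) g) j)) \<eta> \<noteq> 0"
    using g_minimal[OF j] degree_coeff_q_expansion[OF Q_degree_pos, of i0 g j] i0(1) by auto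
  then have root: "poly (map_poly \<iota> (Q i0)) \<eta> = 0"
    using inf[of j] by (auto simp: nu_infinite_iff emb.map_poly_mult emb.map_poly_power)
  have "Q i0 \<noteq> 0" using Q_degree_pos[of i0] by auto
  then have deg: "Polynomial.degree (Q i0) = Polynomial.degree g"
    using g_minimal[of "Q i0"] root i0(1) by auto
  have "g dvd Q i0" using g_dvd root by blast
  then obtain c where c: "Q i0 = g * c" by (auto simp: dvd_def)
  have "c \<noteq> 0" using \<open>Q i0 \<noteq> 0\<close> c by auto
  then have "Polynomial.degree c = 0"
    using deg g_nonzero unfolding c by (subst (asm) degree_mult_eq) auto
  moreover have "Polynomial.lead_coeff c = 1"
    using Q_monic[of i0] g_monic unfolding c lead_coeff_mult by simp
  ultimately have "c = 1" by (metis degree_eq_zeroE lead_coeff_pCons(2) one_pCons)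
  with c have Qi0: "Q i0 = g" by simp
  have le: "i \<le> i0" for i
  proof (rule ccontr)
    assume "\<not> i \<le> i0"
    then have "epsilon \<nu>bar (Q i0) < epsilon \<nu>bar (Q i)"
      by (simp add: epsilon_less_iff)
    then show False using Qi0 epsilon_g by (cases "epsilon \<nu>bar (Q i)") auto
  qed
  have "imax = i0"
    unfolding imax_def using le by (intro Greatest_equality) auto
  with Qi0 le[of i] show "Q imax = g" "i \<le> imax" by simp_all
qed

text \<open>A polynomial of smaller degree than a key polynomial has smaller \<open>epsilon\<close>,
  and \<open>epsilon\<close> orders the indices.\<close>

lemma Q_degree_mono:
  assumes "i \<le> j"
  shows "Polynomial.degree (Q i) \<le> Polynomial.degree (Q j)"
proof (rule ccontr)
  assume "\<not> ?thesis"
  then have "epsilon \<nu>bar (Q j) < epsilon \<nu>bar (Q i)"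
    using key[of i] Q_degree_pos[of j] by (auto simp: key_polynomial_def)
  then have "j < i"
    by (simp add: epsilon_less_iff)
  with assms show False by simp
qed

sublocale degree_blocks Q
proof
  show "finite (key_degrees Q)"
    unfolding key_degrees_def
    by (rule finite_subset[of _ "{..Polynomial.degree (Q imax)}"]) (auto intro: Q_degree_mono Q_le_imax)
qed (use normalized in \<open>auto simp: normalized_def intro: Q_degree_mono\<close>)

text \<open>Strict monotonicity leaves the value \<infinity> to \<open>imax\<close> alone;
  truncations at all other key polynomials are therefore valuations.\<close>

lemma epsilon_finite:
  assumes "i \<in> Istar"
  obtains d where "epsilon \<nu>bar (Q i) = Fin d"
proof -
  obtain \<alpha> where \<alpha>: "epsilon \<nu>bar (Q i) = \<nu>bar [:- \<alpha>, 1:]"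
    using epsilon_attained[OF Q_degree_pos] .
  have "i < imax" using assms Q_le_imax[of i] by auto
  then have "epsilon \<nu>bar (Q i) < \<infinity>"
    using epsilon_less_iff[of i imax] epsilon_g Q_imax by simp
  moreover have "epsilon \<nu>bar (Q i) \<noteq> -\<infinity>" using \<alpha> by simp
  ultimately show ?thesis using that by (cases "epsilon \<nu>bar (Q i)") auto
qed

lemma deg_imax: "deg imax = Polynomial.degree g"
  by (simp add: Q_imax)

lemma value_a: "i \<in> Istar \<Longrightarrow> v (\<iota> (a i)) = \<nu> (Q i)"
  using normalized by (simp add: normalized_def)

lemma a_nonzero:
  assumes "i \<in> Istar"
  shows "a i \<noteq> 0"
proof
  assume "a i = 0"
  then have "\<nu> (Q i) = \<infinity>" using value_a[OF assms] by simp
  moreover have "Q i \<noteq> 0" using Q_degree_pos[of i] by auto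
  ultimately have "Polynomial.degree g \<le> deg i"
    using g_minimal[of "Q i"] nu_infinite_iff by auto
  with assms Istar_iff[of i] deg_imax show False by simp
qed

lemma T_imax: "T imax = g"
  by (simp add: Qtilde_def g_def)

lemma T_Istar: "i \<in> Istar \<Longrightarrow> T i = [:inverse (a i):] * Q i"
  by (simp add: Qtilde_def)

lemma degree_T: "Polynomial.degree (T i) = deg i"
  using T_Istar[of i] a_nonzero[of i] T_imax Q_imax by (cases "i = imax") auto

lemma T_nonzero: "T i \<noteq> 0"
  using degree_T[of i] Q_degree_pos[of i] by auto

lemma value_inverse: "c \<noteq> 0 \<Longrightarrow> v (\<iota> (inverse c)) + v (\<iota> c) = 0"
  using mult[of "[:inverse c:]" "[:c:]"] by (simp add: nu_const one_pCons[symmetric] del: pCons_one)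

lemma nu_T:
  assumes "i \<in> Istar"
  shows "\<nu> (T i) = 0"
  using value_inverse[OF a_nonzero[OF assms]] value_a[OF assms]
  unfolding T_Istar[OF assms] mult by (simp add: nu_const)

lemma trunc_ring_val:
  assumes "i \<in> Istar"
  shows "ring_val (trunc i)"
proof -
  obtain d where "epsilon \<nu>bar (Q i) = Fin d" using epsilon_finite[OF assms] .
  then show ?thesis using truncation_ring_val[OF key] by blast
qed

lemma trunc_finite:
  assumes "i \<in> Istar" "f \<noteq> 0"
  obtains \<gamma> where "trunc i f = Fin \<gamma>"
  using epsilon_finite[OF assms(1)] truncation_finite[OF key _ assms(2)] by metis

lemma trunc_const:
  assumes "i \<in> Istar"
  shows "trunc i [:c:] = v (\<iota> c)"
proof -
  obtain d where "epsilon \<nu>bar (Q i) = Fin d" using epsilon_finite[OF assms] .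
  then show ?thesis using truncation_eq[OF key, of i d "[:c:]"] by (simp add: nu_const)
qed

text \<open>No root of \<open>Q k\<close> is nearer than the nearest root of \<open>Q i\<close>, so
  the truncation agrees with \<nu>, and \<open>a k\<close> normalizes the value to 0.\<close>

lemma trunc_T:
  assumes "i \<in> Istar" "k \<le> i"
  shows "trunc i (T k) = 0"
proof -
  interpret ti: ring_val "trunc i" using trunc_ring_val[OF assms(1)] .
  have k: "k \<in> Istar" using assms Q_le_imax[of i] by auto
  obtain d where "epsilon \<nu>bar (Q i) = Fin d" using epsilon_finite[OF assms(1)] .
  moreover have "epsilon \<nu>bar (Q k) \<le> epsilon \<nu>bar (Q i)"
    using assms(2) by (simp add: epsilon_le_iff)
  ultimately have "trunc i (Q k) = \<nu> (Q k)"
    using truncation_eq[OF key] by blast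
  then show ?thesis
    using nu_T[OF k] unfolding T_Istar[OF k] mult ti.mult by (simp only: trunc_const[OF assms(1)] nu_const)
qed

text \<open>With leading coefficient 1, the top term of the expansion is a pure power of
  \<open>Q i\<close>, and it has larger degree than all other terms.\<close>

lemma neat_strongly_monic:
  assumes "neat_pair Q l i" "l \<in> Istar"
  obtains r where "deg l = r * deg i" "\<nu> (Q i ^ r) = trunc i (Q l)"
proof -
  let ?F = "q_expansion (Q i) (Q l)"
  let ?r = "Polynomial.degree ?F"
  have sm: "Polynomial.lead_coeff ?F = 1" "\<nu> (Q i ^ ?r) = trunc i (Q l)"
    using strongly assms neat_pair_Istar[OF assms(1)]
    by (auto simp: successively_strongly_monic_def neat_pair_def strongly_monic_def)
  have Q0: "Q i \<noteq> 0" using Q_degree_pos[of i] by auto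
  have "Q l = (\<Sum>j\<le>?r. Polynomial.coeff ?F j * Q i ^ j)"
    using poly_q_expansion[OF Q_degree_pos, of i "Q l"] by (simp add: poly_altdef)
  also have "\<dots> = Q i ^ ?r + (\<Sum>j<?r. Polynomial.coeff ?F j * Q i ^ j)"
    using sm(1) by (simp add: lessThan_Suc_atMost[symmetric])
  finally have Ql: "Q l = Q i ^ ?r + (\<Sum>j<?r. Polynomial.coeff ?F j * Q i ^ j)" .
  have deg_pow: "Polynomial.degree (Q i ^ n) = n * deg i" for n
    using Q0 by (simp add: degree_power_eq)
  have "deg l = ?r * deg i"
  proof (cases "?r = 0")
    case True
    then show ?thesis using Ql by simp
  next
    case False
    have "Polynomial.degree (\<Sum>j<?r. Polynomial.coeff ?F j * Q i ^ j) < ?r * deg i"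
    proof (rule degree_sum_less)
      fix j assume "j \<in> {..<?r}"
      then have "(j + 1) * deg i \<le> ?r * deg i" by (intro mult_right_mono) auto
      then show "Polynomial.degree (Polynomial.coeff ?F j * Q i ^ j) < ?r * deg i"
        using degree_mult_le[of "Polynomial.coeff ?F j" "Q i ^ j"] deg_pow[of j]
          degree_coeff_q_expansion[OF Q_degree_pos, of i "Q l" j] by simp
    qed (use False Q_degree_pos[of i] in simp)
    then show ?thesis
      using Ql deg_pow[of ?r] by (metis degree_add_eq_left)
  qed
  with sm(2) show ?thesis using that by blast
qed

sublocale radix Q
proof
  fix i j assume "i \<in> Istar" and j: "j \<in> Istar" "deg j = degree_plus Q i"
  from degree_plus_attained[OF \<open>i \<in> Istar\<close>] j(2) have "deg i < deg j" by metis
  \<comment> \<open>Only degrees matter, so j may be replaced by a neat partner of i in the same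
    block.\<close>
  then obtain l where l: "neat_pair Q l i" "deg l = degree_plus Q i"
    using neat_pair_next_block by metis
  with j have "l \<in> Istar" using Istar_iff by metis
  then show "deg i dvd deg j"
    using neat_strongly_monic[OF l(1)] l(2) j(2) by (metis dvd_triv_right)
qed (rule Q_degree_pos)


abbreviation vK :: "'k \<Rightarrow> 'g extended" where "vK \<equiv> v \<circ> \<iota>"
abbreviation R :: "(('i \<Rightarrow>\<^sub>0 nat) \<Rightarrow>\<^sub>0 'k) ring" where "R \<equiv> OKX vK"

subsection \<open>The chosen expansions\<close>

lemma E_expansion:
  assumes "neat_pair Q l i"
  shows ev_E: "ev (E l i) = T l"
    and E_lookup_eq_0: "\<And>m k. m \<in> Poly_Mapping.keys (E l i) \<Longrightarrow> i < k \<Longrightarrow> Poly_Mapping.lookup m k = 0"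
    and E_value: "trunc i (T l) = Min ((\<lambda>m. vK (Poly_Mapping.lookup (E l i) m)) ` Poly_Mapping.keys (E l i))"
    and E_digit: "\<And>m k. m \<in> Poly_Mapping.keys (E l i) \<Longrightarrow> k < i \<Longrightarrow>
      real (Poly_Mapping.lookup m k) < real (degree_plus Q k) / real (deg k)"
    and E_block: "\<And>q k k'. q \<in> {1..ww Q} \<Longrightarrow> k \<in> block Q q \<Longrightarrow> k' \<in> block Q q \<Longrightarrow>
      appears (E l i) k \<Longrightarrow> appears (E l i) k' \<Longrightarrow> k = k'"
    and E_level: "neat_of_level Q (E l i) (offset Q i)"
proof -
  have *: "full_expansion \<nu> vK Q T i (T l) (E l i)" "neat_of_level Q (E l i) (pair_level Q l i)"
    using neat assms unfolding neat_family_def by blast+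
  then show "neat_of_level Q (E l i) (offset Q i)" by (simp add: pair_level_eq assms)
  note F = *(1)[unfolded full_expansion_def]
  show "ev (E l i) = T l" using F by simp
  show "Poly_Mapping.lookup m k = 0" if "m \<in> Poly_Mapping.keys (E l i)" "i < k" for m k
    using F that by blast
  show "trunc i (T l) = Min ((\<lambda>m. vK (Poly_Mapping.lookup (E l i) m)) ` Poly_Mapping.keys (E l i))"
    using F by blast
  show "real (Poly_Mapping.lookup m k) < real (degree_plus Q k) / real (deg k)"
    if "m \<in> Poly_Mapping.keys (E l i)" "k < i" for m k
    using F that by blast
  show "k = k'" if "q \<in> {1..ww Q}" "k \<in> block Q q" "k' \<in> block Q q"
    "appears (E l i) k" "appears (E l i) k'" for q k k'
    using F that by blast
qed

lemma E_value_le: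
  "neat_pair Q l i \<Longrightarrow> m \<in> Poly_Mapping.keys (E l i) \<Longrightarrow>
    trunc i (T l) \<le> vK (Poly_Mapping.lookup (E l i) m)"
  unfolding E_value by simp

lemma E_appears_le:
  assumes "neat_pair Q l i" "appears (E l i) k"
  shows "k \<le> i" "k \<in> Istar"
proof -
  show "k \<le> i"
    using assms(2) E_lookup_eq_0[OF assms(1)] unfolding appears_def
    by (metis leI less_irrefl)
  then show "k \<in> Istar"
    using neat_pair_Istar[OF assms(1)] Q_le_imax[of i] by auto
qed

lemma E_inj:
  assumes l: "neat_pair Q l i" and k: "appears (E l i) k" "appears (E l i) k'" "deg k = deg k'"
  shows "k = k'"
proof -
  have "block_index Q k \<in> {1..ww Q}"
    using E_appears_le[OF l k(1)] Istar_block_index by blast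
  moreover have "k \<in> block Q (block_index Q k)" "k' \<in> block Q (block_index Q k)"
    using k by (auto simp: block_block_index)
  ultimately show ?thesis
    using E_block[OF l] k by blast
qed

lemma E_offset:
  assumes l: "neat_pair Q l i" and k: "appears (E l i) k"
    and inf: "infinite (block Q (block_index Q k))"
  shows "offset Q k = offset Q i"
proof -
  let ?q = "block_index Q k"
  have q: "?q \<in> {1..ww Q}"
    using E_appears_le[OF l k(1)] Istar_block_index by blast
  have kq: "k \<in> block Q ?q" by (simp add: block_block_index)
  \<comment> \<open>The definite description in \<open>jj\<close> is resolved by the rule that a
    full expansion uses at most one variable per block.\<close>
  then have "(THE k'. k' \<in> block Q ?q \<and> appears (E l i) k') = k"
    using k E_inj[OF l] by (intro the_equality) (auto simp: block_block_index)
  then have "jj Q (E l i) ?q = Some k"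
    using k kq by (auto simp: jj_def)
  then show ?thesis
    using E_level[OF l] q inf unfolding neat_of_level_def Let_def by fastforce
qed

text \<open>A variable from the block of i would share its offset by neatness, and hence be
  i.\<close>

lemma E_appears_degree:
  assumes l: "neat_pair Q l i" and k: "appears (E l i) k" "k \<noteq> i"
  shows "deg k < deg i"
proof -
  have "deg k \<noteq> deg i"
  proof
    assume eq: "deg k = deg i"
    then have "infinite (block Q (block_index Q k))"
      using finite_block(1)[of k i] k(2) by auto
    then have "offset Q k = offset Q i"
      by (rule E_offset[OF l k(1)])
    with eq k(2) show False using offset_inj by blast
  qed
  with degree_mono[OF E_appears_le(1)[OF l k(1)]] show ?thesis by simp
qed

text \<open>The index i is put into S even if it does not appear, so that it occupies the last
  place, whose digit is unbounded.\<close>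

lemma E_digits:
  assumes l: "neat_pair Q l i"
  defines "S \<equiv> insert i {k. appears (E l i) k}"
  shows "S \<subseteq> Istar" "inj_on deg S" "\<And>k. k \<in> S \<Longrightarrow> k \<le> i"
    "\<And>m. m \<in> Poly_Mapping.keys (E l i) \<Longrightarrow> digits Q S m"
proof -
  show "S \<subseteq> Istar"
    using neat_pair_Istar[OF l] E_appears_le[OF l] by (auto simp: S_def)
  show "inj_on deg S"
    using E_inj[OF l] E_appears_degree[OF l] unfolding S_def inj_on_def
    by (metis insert_iff less_irrefl mem_Collect_eq)
  show le: "k \<le> i" if "k \<in> S" for k
    using that E_appears_le[OF l] by (auto simp: S_def)
  fix m assume m: "m \<in> Poly_Mapping.keys (E l i)"
  have "Poly_Mapping.lookup m k * deg k < degree_plus Q k" if "k \<in> S" "k' \<in> S" "k < k'" for k k'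
  proof -
    have "k < i" using that le by (meson order.strict_trans2)
    then have "real (Poly_Mapping.lookup m k) < real (degree_plus Q k) / real (deg k)"
      using E_digit[OF l m] by blast
    then have "real (Poly_Mapping.lookup m k) * real (deg k) < real (degree_plus Q k)"
      using degree_pos[of k] by (simp add: field_simps)
    then show ?thesis by (simp flip: of_nat_mult)
  qed
  moreover have "Poly_Mapping.keys m \<subseteq> S"
    using m by (auto simp: S_def appears_def in_keys_iff)
  ultimately show "digits Q S m"
    by (auto simp: digits_def)
qed

lemma value_b:
  assumes "neat_pair Q l i"
  obtains x where "vK (b l i) = Fin x" "trunc i (T l) = Fin (- x)"
proof -
  have "vK (b l i) = - trunc i (T l)"
    using scalars assms by (simp add: admissible_scalars_def)
  moreover obtain y where "trunc i (T l) = Fin y"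
    using trunc_finite[OF neat_pair_Istar[OF assms] T_nonzero] .
  ultimately show ?thesis using that[of "-y"] by simp
qed

lemma b_nonzero: "neat_pair Q l i \<Longrightarrow> b l i \<noteq> 0"
  using value_b[of l i] by fastforce

text \<open>Comparing degrees identifies the leading monomial as a power of the i-th variable;
  comparing leading coefficients gives its coefficient as \<open>a i ^ r / a l\<close>. Strong
  monicity gives this the value of the truncation, so \<open>b l i\<close> scales it to a
  unit.\<close>

lemma E_leading:
  assumes l: "neat_pair Q l i" "l \<in> Istar"
  obtains r where "deg l = r * deg i" "0 < r"
    "vK (b l i * Poly_Mapping.lookup (E l i) (Poly_Mapping.single i r)) = 0"
    "\<And>m. m \<in> Poly_Mapping.keys (E l i) \<Longrightarrow> m \<noteq> Poly_Mapping.single i r \<Longrightarrow> weight deg m < deg l"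
proof -
  have i: "i \<in> Istar" using neat_pair_Istar[OF l(1)] .
  interpret ti: ring_val "trunc i" using trunc_ring_val[OF i] .
  define S where "S = insert i {k. appears (E l i) k}"
  note S = E_digits[OF l(1), folded S_def]
  obtain r where r: "deg l = r * deg i" "\<nu> (Q i ^ r) = trunc i (Q l)"
    using neat_strongly_monic[OF l] .
  have "E l i \<noteq> 0"
    using ev_E[OF l(1)] T_nonzero[of l] by auto
  then obtain m0 where m0: "m0 \<in> Poly_Mapping.keys (E l i)"
    "\<And>m. m \<in> Poly_Mapping.keys (E l i) \<Longrightarrow> m \<noteq> m0 \<Longrightarrow> weight deg m < weight deg m0"
    "Polynomial.degree (T l) = weight deg m0"
    "Polynomial.lead_coeff (T l) = Poly_Mapping.lookup (E l i) m0 * Polynomial.lead_coeff (monom_eval T m0)"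
    using leading_term[of T S "E l i"] S degree_T ev_E[OF l(1)] by metis
  \<comment> \<open>Needed at the places where the pure power has digit 0.\<close>
  have pos: "0 < degree_plus Q k" if "k \<in> S" for k
    using degree_plus_attained[of k] that S(1) by (metis degree_pos subsetD)
  have "digits Q S (Poly_Mapping.single i r)"
    using S(3) pos leD by (auto simp: digits_def S_def lookup_single when_def split: if_splits)
  moreover have "weight deg m0 = weight deg (Poly_Mapping.single i r)"
    using m0(3) r(1) degree_T by simp
  ultimately have m0_eq: "m0 = Poly_Mapping.single i r"
    using digits_weight_inj[OF S(1,2) S(4)[OF m0(1)]] by blast
  let ?c = "Poly_Mapping.lookup (E l i) m0"
  have lead: "Polynomial.lead_coeff (T k) = inverse (a k)" if "k \<in> Istar" for k
    using Q_monic[of k] a_nonzero[OF that] unfolding T_Istar[OF that] by (simp add: degree_smult_eq)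
  have "inverse (a l) = ?c * inverse (a i) ^ r"
    using m0(4) unfolding m0_eq lead[OF l(2)] monom_eval_single lead_coeff_power lead[OF i] .
  then have c: "?c = inverse (a l) * a i ^ r"
    using a_nonzero[OF i] by (simp add: field_simps)
  have pow: "v (\<iota> (a i ^ n)) = \<nu> (Q i ^ n)" for n
    by (induction n) (simp_all add: emb.hom_mult vL.mult mult value_a[OF i])
  have "vK ?c = v (\<iota> (inverse (a l))) + trunc i (Q l)"
    unfolding c by (simp add: emb.hom_mult vL.mult pow r(2))
  also have "\<dots> = trunc i (T l)"
    unfolding T_Istar[OF l(2)] ti.mult by (simp only: trunc_const[OF i])
  finally have "vK (b l i * ?c) = 0"
    using value_b[OF l(1)] by (metis add.left_inverse add.right_inverse plus_extended.simps(1) vK.mult zero_extended_def)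
  moreover have "0 < r"
    using r(1) degree_pos[of l] by (cases r) auto
  moreover have "weight deg m < deg l" if "m \<in> Poly_Mapping.keys (E l i)" "m \<noteq> Poly_Mapping.single i r" for m
    using m0(2)[of m] m0(3) that unfolding m0_eq by (simp add: degree_T)
  ultimately show ?thesis
    using that r(1) unfolding m0_eq by blast
qed

text \<open>The value of \<open>b l i\<close> is opposite to the least value among the coefficients
  of \<open>E l i\<close>, so scaling makes all of them integral.\<close>

lemma QQ_carrier:
  assumes l: "neat_pair Q l i"
  shows "QQ E b l i \<in> carrier R"
proof -
  obtain x where x: "vK (b l i) = Fin x" "trunc i (T l) = Fin (- x)"
    using value_b[OF l] .
  have "0 \<le> vK (Poly_Mapping.lookup (QQ E b l i) m)" for m
  proof (cases "m \<in> Poly_Mapping.keys (E l i)")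
    case True
    then have "Fin (- x) \<le> vK (Poly_Mapping.lookup (E l i) m)"
      using E_value_le[OF l] x by metis
    then have "Fin (x + - x) \<le> vK (b l i) + vK (Poly_Mapping.lookup (E l i) m)"
      using x by (intro Fin_add_le) auto
    then show ?thesis
      by (simp add: QQ_def lookup_mconst_mult vL.mult emb.hom_mult zero_extended_def)
  next
    case False
    then show ?thesis by (simp add: QQ_def lookup_mconst_mult in_keys_iff)
  qed
  moreover have "Poly_Mapping.keys m \<subseteq> Istar" if "m \<in> Poly_Mapping.keys (QQ E b l i)" for m
  proof -
    have "m \<in> Poly_Mapping.keys (E l i)"
      using that by (auto simp: QQ_def lookup_mconst_mult in_keys_iff)
    then show ?thesis
      using E_digits(1,4)[OF l] by (force simp: digits_def)
  qed
  ultimately show ?thesis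
    by (simp add: vK.carrier_iff)
qed

lemma ev_QQ: "neat_pair Q l i \<Longrightarrow> ev (QQ E b l i) = [:b l i:] * T l"
  by (simp only: QQ_def pconst.mpoly_eval_mult pconst.mpoly_eval_mconst ev_E)

text \<open>The truncation is at most \<nu>, which is 0 on \<open>T l\<close>.\<close>

lemma value_b_nonneg:
  assumes l: "neat_pair Q l i" "l \<in> Istar"
  shows "0 \<le> vK (b l i)"
proof -
  obtain x where x: "vK (b l i) = Fin x" "trunc i (T l) = Fin (- x)"
    using value_b[OF l(1)] .
  have "Fin (- x) \<le> 0"
    using truncation_le[OF Q_degree_pos, of i "T l"] nu_T[OF l(2)] x by simp
  then show ?thesis using x by (simp add: zero_extended_def)
qed

subsection \<open>The ideals\<close>

abbreviation I1 where "I1 \<equiv> ideal_I1 vK Q E b"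
abbreviation I2 where "I2 \<equiv> ideal_I2 vK Q E b"

abbreviation gens1 :: "(('i \<Rightarrow>\<^sub>0 nat) \<Rightarrow>\<^sub>0 'k) set"
  where "gens1 \<equiv> {mconst (b l i) * mvar l - QQ E b l i | i l. i \<in> Istar \<and> l \<in> Istar \<and> neat_pair Q l i}"

abbreviation gens2 :: "(('i \<Rightarrow>\<^sub>0 nat) \<Rightarrow>\<^sub>0 'k) set"
  where "gens2 \<equiv> {QQ E b imax i | i. i \<in> Istar \<and> succ_rel Q i imax}"

text \<open>The last block is finite, so the neatness condition on two infinite blocks is
  vacuous.\<close>

lemma neat_pair_imax: "succ_rel Q i imax \<Longrightarrow> neat_pair Q imax i"
  using last_block block_index_imax by (simp add: neat_pair_def)

lemma gens1_carrier: "gens1 \<subseteq> carrier R"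
proof
  fix P assume "P \<in> gens1"
  then obtain i l where "P = mconst (b l i) * mvar l - QQ E b l i" "neat_pair Q l i" "l \<in> Istar"
    by blast
  then show "P \<in> carrier R"
    by (simp only: vK.carrier_diff vK.carrier_mult vK.carrier_mconst vK.carrier_mvar value_b_nonneg QQ_carrier)
qed

lemma gens2_carrier: "gens2 \<subseteq> carrier R"
  using QQ_carrier neat_pair_imax by blast

lemma ideal_I1: "ideal I1 R" and ideal_I2: "ideal I2 R"
  unfolding ideal_I1_def ideal_I2_def
  by (intro ring.genideal_ideal cring.axioms(1) vK.cring_RX gens1_carrier gens2_carrier)+

lemma gens1_subset: "gens1 \<subseteq> I1" and gens2_subset: "gens2 \<subseteq> I2"
  unfolding ideal_I1_def ideal_I2_def
  by (intro ring.genideal_self cring.axioms(1) vK.cring_RX gens1_carrier gens2_carrier)+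

text \<open>Applied with values in K[x] to bound \<open>I1\<close>, and with values in L to bound
  \<open>I2\<close>.\<close>

lemma ideal_kernel:
  assumes "ring_homomorphism h"
  shows "ideal {P \<in> carrier R. mpoly_eval h x P = 0} R"
proof -
  interpret h: ring_homomorphism h by fact
  interpret R: cring R by (rule vK.cring_RX)
  show ?thesis
  proof (rule idealI)
    show "subgroup {P \<in> carrier R. mpoly_eval h x P = 0} (add_monoid R)"
    proof (rule R.add.subgroupI)
      fix P assume P: "P \<in> {P \<in> carrier R. mpoly_eval h x P = 0}"
      then have "\<ominus>\<^bsub>R\<^esub> P = - P"
        using vK.carrier_uminus by (intro R.minus_equality) auto
      then show "\<ominus>\<^bsub>R\<^esub> P \<in> {P \<in> carrier R. mpoly_eval h x P = 0}"
        using P vK.carrier_uminus by (auto simp: h.mpoly_eval_uminus)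
    qed (auto simp: h.mpoly_eval_add intro: vK.carrier_add vK.carrier_zero intro!: exI[of _ 0])
  qed (auto simp: R.ring_axioms h.mpoly_eval_mult intro: vK.carrier_mult)
qed

text \<open>The generators vanish already in K[x], before \<eta> is substituted, because
  \<open>E l i\<close> is an expansion of \<open>T l\<close>.\<close>

lemma ev_I1:
  assumes "P \<in> I1"
  shows "P \<in> carrier R" "ev P = 0"
proof -
  interpret R: cring R by (rule vK.cring_RX)
  have "ev (mconst (b l i) * mvar l - QQ E b l i) = 0" if "neat_pair Q l i" for l i
    using ev_QQ[OF that]
    by (simp only: pconst.mpoly_eval_diff pconst.mpoly_eval_mult
      pconst.mpoly_eval_mconst pconst.mpoly_eval_mvar diff_self)
  then have "ev P = 0" if "P \<in> gens1" for P
    using that by blast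
  then have "gens1 \<subseteq> {P \<in> carrier R. ev P = 0}"
    using gens1_carrier by blast
  then have "I1 \<subseteq> {P \<in> carrier R. ev P = 0}"
    unfolding ideal_I1_def
    by (intro R.genideal_minimal ideal_kernel pconst.ring_homomorphism_axioms)
  with assms show "P \<in> carrier R" "ev P = 0" by auto
qed

lemma relation_ideal_eq: "relation_ideal \<iota> v \<eta> T = {P \<in> carrier R. ev\<^sub>L P = 0}"
  unfolding relation_ideal_def a_kernel_def kernel_def by (simp add: ring_of_type_algebra_def)

lemma ideals_subset: "I1 <+>\<^bsub>R\<^esub> I2 \<subseteq> relation_ideal \<iota> v \<eta> T"
proof -
  interpret R: cring R by (rule vK.cring_RX)
  note K = ideal_kernel[OF iota.ring_homomorphism_axioms, of "\<lambda>i. poly (map_poly \<iota> (T i)) \<eta>"]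
  have 1: "P \<in> relation_ideal \<iota> v \<eta> T" if "P \<in> I1" for P
    using ev_I1[OF that] poly_ev[of P] by (simp add: relation_ideal_eq)
  have "ev\<^sub>L (QQ E b imax i) = 0" if "succ_rel Q i imax" for i
    unfolding poly_ev[symmetric] ev_QQ[OF neat_pair_imax[OF that]] emb.map_poly_mult T_imax
    using g_root by simp
  then have "gens2 \<subseteq> {P \<in> carrier R. ev\<^sub>L P = 0}"
    using gens2_carrier by blast
  then have 2: "I2 \<subseteq> relation_ideal \<iota> v \<eta> T"
    unfolding ideal_I2_def relation_ideal_eq by (intro R.genideal_minimal K)
  have "P + P' \<in> relation_ideal \<iota> v \<eta> T" if "P \<in> I1" "P' \<in> I2" for P P'
    using vK.ideal_add[OF K] 1 2 that unfolding relation_ideal_eq by blast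
  then show ?thesis
    by (auto simp: set_add_def')
qed


subsection \<open>Reduction modulo the first ideal\<close>

text \<open>The generator is solved for the leading power in the i-th variable, whose coefficient is
  a unit of the valuation ring.\<close>

lemma rewrite_power:
  assumes l: "neat_pair Q l i" "l \<in> Istar"
  obtains r P where "deg l = r * deg i" "0 < r" "P \<in> carrier R"
    "Poly_Mapping.single (Poly_Mapping.single i r) 1 - P \<in> I1"
    "\<And>m. m \<in> Poly_Mapping.keys P \<Longrightarrow> m = Poly_Mapping.single l 1 \<or>
      weight deg m < deg l \<and> (\<forall>k\<in>Poly_Mapping.keys m. offset Q k \<le> offset Q i)"
proof -
  have i: "i \<in> Istar" using neat_pair_Istar[OF l(1)] .
  obtain r where r: "deg l = r * deg i" "0 < r"
    "vK (b l i * Poly_Mapping.lookup (E l i) (Poly_Mapping.single i r)) = 0"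
    "\<And>m. m \<in> Poly_Mapping.keys (E l i) \<Longrightarrow> m \<noteq> Poly_Mapping.single i r \<Longrightarrow> weight deg m < deg l"
    using E_leading[OF l] by metis
  let ?m0 = "Poly_Mapping.single i r"
  let ?gen = "mconst (b l i) * mvar l - QQ E b l i"
  define u where "u = b l i * Poly_Mapping.lookup (E l i) ?m0"
  have "u \<noteq> 0" using r(3) by (auto simp: u_def zero_extended_def)
  have "vK (inverse u) = 0"
    using value_inverse[OF \<open>u \<noteq> 0\<close>] r(3) by (simp add: u_def)
  then have vu: "0 \<le> vK (inverse u)" by simp
  have gen: "?gen \<in> I1" using gens1_subset i l by blast
  have X: "Poly_Mapping.single ?m0 1 \<in> carrier R"
    using i by (intro vK.carrier_single) auto
  \<comment> \<open>The coefficient of the power in \<open>QQ E b l i\<close> is u, so this multiple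
    of the generator cancels the power exactly.\<close>
  define P where "P = Poly_Mapping.single ?m0 1 + mconst (inverse u) * ?gen"
  have "mconst (inverse u) * ?gen \<in> I1"
    by (intro vK.ideal_mult[OF ideal_I1 gen] vK.carrier_mconst vu)
  then have "P \<in> carrier R" "Poly_Mapping.single ?m0 1 - P \<in> I1"
    using vK.carrier_add[OF X] ev_I1(1) vK.ideal_uminus[OF ideal_I1] by (auto simp: P_def)
  moreover have "m = Poly_Mapping.single l 1 \<or>
      weight deg m < deg l \<and> (\<forall>k\<in>Poly_Mapping.keys m. offset Q k \<le> offset Q i)"
    if m: "m \<in> Poly_Mapping.keys P" for m
  proof (cases "m = Poly_Mapping.single l 1")
    case False
    have lookP: "Poly_Mapping.lookup P m = (1 when m = ?m0) - inverse u * (b l i * Poly_Mapping.lookup (E l i) m)"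
      using False by (auto simp: P_def lookup_add lookup_minus lookup_mconst_mult mvar_def lookup_single when_def QQ_def)
    moreover have "inverse u * (b l i * Poly_Mapping.lookup (E l i) ?m0) = 1"
      using \<open>u \<noteq> 0\<close> by (simp flip: u_def)
    ultimately have "m \<noteq> ?m0"
      using m by (auto simp: in_keys_iff)
    then have mE: "m \<in> Poly_Mapping.keys (E l i)"
      using m lookP by (auto simp: in_keys_iff)
    have "offset Q k \<le> offset Q i" if "k \<in> Poly_Mapping.keys m" for k
    proof (cases "finite (block Q (block_index Q k))")
      case True
      then show ?thesis using finite_block(2)[of k] by simp
    next
      case inf: False
      have "appears (E l i) k"
        using mE that by (auto simp: appears_def in_keys_iff)
      then show ?thesis using E_offset[OF l(1) _ inf] by simp
    qed
    then show ?thesis using r(4)[OF mE \<open>m \<noteq> ?m0\<close>] by blast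
  qed simp
  ultimately show ?thesis using that r(1,2) by blast
qed

text \<open>One element of each block of \<open>I\<^sup>*\<close>, the infinite blocks being represented in a common offset \<open>s\<close>.\<close>

definition level_set :: "nat \<Rightarrow> 'i set"
  where "level_set s = {i \<in> Istar. finite (block Q (block_index Q i)) \<or> offset Q i = s}"

lemma level_set: "level_set s \<subseteq> Istar" "inj_on deg (level_set s)"
proof -
  show "inj_on deg (level_set s)"
  proof (rule inj_onI)
    fix i j assume ij: "i \<in> level_set s" "j \<in> level_set s" "deg i = deg j"
    show "i = j"
    proof (cases "finite (block Q (block_index Q i))")
      case True
      then show ?thesis using finite_block(1)[of i j] ij(3) by simp
    next
      case False
      moreover from this have "infinite (block Q (block_index Q j))"
        using ij(3) block_index_eq_iff by metis
      ultimately show ?thesis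
        using ij offset_inj by (simp add: level_set_def)
    qed
  qed
qed (auto simp: level_set_def)

definition reducible :: "nat \<Rightarrow> (('i \<Rightarrow>\<^sub>0 nat) \<Rightarrow>\<^sub>0 'k) \<Rightarrow> bool"
  where "reducible s F \<longleftrightarrow> (\<exists>G\<in>carrier R. F - G \<in> I1 \<and>
    (\<forall>m\<in>Poly_Mapping.keys G. digits Q (level_set s) m))"

lemma reducible_trans:
  assumes "F - F' \<in> I1" "reducible s F'"
  shows "reducible s F"
proof -
  obtain G where G: "G \<in> carrier R" "F' - G \<in> I1" "\<forall>m\<in>Poly_Mapping.keys G. digits Q (level_set s) m"
    using assms(2) by (auto simp: reducible_def)
  have "F - F' + (F' - G) \<in> I1"
    by (rule vK.ideal_add[OF ideal_I1 assms(1) G(2)])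
  then show ?thesis
    using G by (auto simp: reducible_def)
qed

lemma reducible_0: "reducible s 0"
  using vK.ideal_zero[OF ideal_I1] by (auto simp: reducible_def intro!: bexI[of _ 0] vK.carrier_zero)

lemma reducible_add:
  assumes "reducible s F" "reducible s F'"
  shows "reducible s (F + F')"
proof -
  obtain G G' where G: "G \<in> carrier R" "F - G \<in> I1" "\<forall>m\<in>Poly_Mapping.keys G. digits Q (level_set s) m"
    "G' \<in> carrier R" "F' - G' \<in> I1" "\<forall>m\<in>Poly_Mapping.keys G'. digits Q (level_set s) m"
    using assms by (auto simp: reducible_def)
  have "(F - G) + (F' - G') \<in> I1"
    by (rule vK.ideal_add[OF ideal_I1 G(2) G(5)])
  then have "F + F' - (G + G') \<in> I1" by (simp add: algebra_simps)
  moreover have "\<forall>m\<in>Poly_Mapping.keys (G + G'). digits Q (level_set s) m"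
    using G(3,6) Poly_Mapping.keys_add[of G G'] by blast
  ultimately show ?thesis
    using vK.carrier_add[OF G(1,4)] by (auto simp: reducible_def)
qed

lemma reducible_sum: "(\<And>x. x \<in> A \<Longrightarrow> reducible s (f x)) \<Longrightarrow> reducible s (sum f A)"
  by (induction A rule: infinite_finite_induct) (auto intro: reducible_add reducible_0)

lemma reducible_scale:
  assumes "reducible s F" "0 \<le> vK c"
  shows "reducible s (mconst c * F)"
proof -
  obtain G where G: "G \<in> carrier R" "F - G \<in> I1" "\<forall>m\<in>Poly_Mapping.keys G. digits Q (level_set s) m"
    using assms(1) by (auto simp: reducible_def)
  have c: "mconst c \<in> carrier R" using assms(2) by (rule vK.carrier_mconst)
  have "mconst c * (F - G) \<in> I1"
    by (rule vK.ideal_mult[OF ideal_I1 G(2) c])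
  then have "mconst c * F - mconst c * G \<in> I1" by (simp add: right_diff_distrib)
  moreover have "\<forall>m\<in>Poly_Mapping.keys (mconst c * G). digits Q (level_set s) m"
    using G(3) by (auto simp: in_keys_iff lookup_mconst_mult)
  ultimately show ?thesis
    using vK.carrier_mult[OF c G(1)] by (auto simp: reducible_def)
qed

text \<open>Two failures are possible: a variable of an infinite block has offset below s, and its
  successor is used; or a digit is too large, and the next block is used. In both cases the exponent
  suffices for the power to be rewritten.\<close>

lemma rewrite_position:
  assumes m: "Poly_Mapping.keys m \<subseteq> Istar" "\<And>k. k \<in> Poly_Mapping.keys m \<Longrightarrow> offset Q k \<le> s"
    and not: "\<not> digits Q (level_set s) m"
  obtains k l where "k \<in> Poly_Mapping.keys m" "neat_pair Q l k" "l \<in> Istar" "offset Q l \<le> s"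
    "deg l \<le> Poly_Mapping.lookup m k * deg k"
    "deg k < deg l \<or> deg l = deg k \<and> offset Q k < offset Q l"
proof (cases "Poly_Mapping.keys m \<subseteq> level_set s")
  case False
  then obtain k where k: "k \<in> Poly_Mapping.keys m" "k \<in> Istar"
    "infinite (block Q (block_index Q k))" "offset Q k \<noteq> s"
    using m(1) by (auto simp: level_set_def)
  with m(2) have less: "offset Q k < s" by fastforce
  obtain l where l: "neat_pair Q l k" "deg l = deg k" "offset Q l = Suc (offset Q k)"
    using neat_pair_same_block[OF k(3)] .
  have "l \<in> Istar"
    using k(2) l(2) Istar_iff by simp
  moreover have "deg l \<le> Poly_Mapping.lookup m k * deg k"
    using k(1) l(2) by (cases "Poly_Mapping.lookup m k") (auto simp: in_keys_iff)
  ultimately show ?thesis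
    using that[of k l] k(1) l less by simp
next
  case True
  with not obtain k k' where k: "k \<in> level_set s" "k' \<in> level_set s" "k < k'"
    "degree_plus Q k \<le> Poly_Mapping.lookup m k * deg k"
    by (auto simp: digits_def not_less)
  then have "deg k < deg k'"
    using degree_mono[of k k'] level_set(2)[of s] by (metis inj_on_eq_iff le_neq_implies_less order_less_le)
  then obtain l where l: "neat_pair Q l k" "deg k < deg l" "deg l = degree_plus Q k" "offset Q l \<le> offset Q k"
    using neat_pair_next_block by metis
  have "deg l \<le> deg k'"
    using degree_plus_le[OF \<open>deg k < deg k'\<close>] l(3) by simp
  then have "l \<in> Istar"
    using k(2) level_set(1) Istar_iff[of l] Istar_iff[of k'] by fastforce
  have "k \<in> Poly_Mapping.keys m"
    using k(4) l(2,3) by (auto simp: in_keys_iff intro!: Nat.gr0I)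
  then show ?thesis
    using that[of k l] l \<open>l \<in> Istar\<close> k(4) m(2)[of k] by simp
qed

text \<open>Rewriting lowers the degree except in the monomial containing \<open>X\<^sub>l\<close>. That one has fewer factors, or,
  if \<open>Q\<^sub>l\<close> and \<open>Q\<^sub>k\<close> have equal degrees, an offset closer to \<open>s\<close>.\<close>

lemma reducible_monomial:
  assumes "Poly_Mapping.keys m \<subseteq> Istar" "\<And>k. k \<in> Poly_Mapping.keys m \<Longrightarrow> offset Q k \<le> s"
  shows "reducible s (Poly_Mapping.single m 1)"
  using assms
proof (induction m rule: wf_induct_rule[OF wf_measures[of
      "[weight deg, weight (\<lambda>_. 1), weight (\<lambda>k. s - offset Q k)]"]])
  case (1 m)
  note m = "1.prems"
  show ?case
  proof (cases "digits Q (level_set s) m")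
    case True
    have "Poly_Mapping.single m 1 \<in> carrier R"
      using m(1) by (intro vK.carrier_single) auto
    then show ?thesis
      using True vK.ideal_zero[OF ideal_I1]
      by (auto simp: reducible_def lookup_single intro!: bexI[of _ "Poly_Mapping.single m 1"])
  next
    case False
    obtain k l where kl: "k \<in> Poly_Mapping.keys m" "neat_pair Q l k" "l \<in> Istar" "offset Q l \<le> s"
      "deg l \<le> Poly_Mapping.lookup m k * deg k"
      "deg k < deg l \<or> deg l = deg k \<and> offset Q k < offset Q l"
      using rewrite_position[OF m False] by blast
    obtain r P where P: "deg l = r * deg k" "0 < r" "P \<in> carrier R"
      "Poly_Mapping.single (Poly_Mapping.single k r) 1 - P \<in> I1"
      "\<And>m. m \<in> Poly_Mapping.keys P \<Longrightarrow> m = Poly_Mapping.single l 1 \<or>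
        weight deg m < deg l \<and> (\<forall>k'\<in>Poly_Mapping.keys m. offset Q k' \<le> offset Q k)"
      using rewrite_power[OF kl(2,3)] by metis
    have "r \<le> Poly_Mapping.lookup m k"
      using kl(5) degree_pos[of k] unfolding P(1) by simp
    define m1 where "m1 = m - Poly_Mapping.single k r"
    have m_eq: "m = Poly_Mapping.single k r + m1"
      using \<open>r \<le> _\<close> by (intro poly_mapping_eqI) (auto simp: m1_def lookup_add lookup_minus lookup_single when_def)
    have keys1: "Poly_Mapping.keys m1 \<subseteq> Poly_Mapping.keys m"
      by (auto simp: m_eq in_keys_iff lookup_add)
    let ?X = "\<lambda>m. Poly_Mapping.single m 1 :: ('i \<Rightarrow>\<^sub>0 nat) \<Rightarrow>\<^sub>0 'k"
    have X1: "?X m1 \<in> carrier R"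
      using keys1 m(1) by (intro vK.carrier_single) auto
    have "?X m1 * (?X (Poly_Mapping.single k r) - P) \<in> I1"
      by (rule vK.ideal_mult[OF ideal_I1 P(4) X1])
    then have "?X m - ?X m1 * P \<in> I1"
      by (simp add: m_eq right_diff_distrib mult_single add.commute)
    moreover have "reducible s (?X m1 * P)"
    proof -
      have "?X m1 * P = (\<Sum>p\<in>Poly_Mapping.keys P. Poly_Mapping.single (p + m1) (Poly_Mapping.lookup P p))"
        by (subst poly_mapping_sum_single[of P]) (simp add: sum_distrib_left mult_single add.commute)
      also have "\<dots> = (\<Sum>p\<in>Poly_Mapping.keys P. mconst (Poly_Mapping.lookup P p) * ?X (p + m1))"
        by (simp flip: mpoly_single_eq)
      also have "reducible s \<dots>"
      proof (rule reducible_sum, rule reducible_scale)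
        fix p assume p: "p \<in> Poly_Mapping.keys P"
        show "0 \<le> vK (Poly_Mapping.lookup P p)"
          using P(3) vK.carrier_iff by blast
        show "reducible s (?X (p + m1))"
        proof (rule "1.IH")
          have "Poly_Mapping.keys p \<subseteq> Istar"
            using P(3) p vK.carrier_iff by blast
          then show "Poly_Mapping.keys (p + m1) \<subseteq> Istar"
            using Poly_Mapping.keys_add[of p m1] keys1 m(1) by blast
          have "offset Q k' \<le> s" if "k' \<in> Poly_Mapping.keys p" for k'
            using P(5)[OF p] that kl(4) m(2)[OF kl(1)] by (auto split: if_splits)
          then show "offset Q k' \<le> s" if "k' \<in> Poly_Mapping.keys (p + m1)" for k'
            using Poly_Mapping.keys_add[of p m1] keys1 m(2) that by blast
          consider "p = Poly_Mapping.single l 1" | "weight deg p < deg l"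
            using P(5)[OF p] by blast
          then show "(p + m1, m) \<in> measures [weight deg, weight (\<lambda>_. 1), weight (\<lambda>k. s - offset Q k)]"
          proof cases
            case 1
            show ?thesis
            proof (cases "deg k < deg l")
              case True
              then have "1 < r" using P(1) by (cases "r = 1") (use P(2) in auto)
              then show ?thesis
                by (simp add: 1 m_eq weight_add P(1))
            next
              case False
              then have "deg l = deg k" "offset Q k < offset Q l"
                using kl(6) by auto
              moreover from this have "r = 1" using P(1) degree_pos[of k] by simp
              \<comment> \<open>Since \<open>offset Q l\<close> does not exceed s, the natural
                difference from s strictly decreases.\<close>
              ultimately show ?thesis
                using kl(4) by (simp add: 1 m_eq weight_add)
            qed
          next
            case 2
            then show ?thesis by (simp add: m_eq weight_add P(1))
          qed
        qed
      qed
      finally show ?thesis .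
    qed
    ultimately show ?thesis by (rule reducible_trans)
  qed
qed

text \<open>With s at least every offset that occurs, F reduces to digit form on a single level. The
  remainder still evaluates to 0, so it is 0 by uniqueness of digits.\<close>

lemma I1_memI:
  assumes F: "F \<in> carrier R" "ev F = 0"
  shows "F \<in> I1"
proof -
  define K where "K = (\<Union>m\<in>Poly_Mapping.keys F. Poly_Mapping.keys m)"
  \<comment> \<open>The inserted 0 covers the case in which no variable occurs.\<close>
  define s where "s = Max (insert 0 (offset Q ` K))"
  have "finite K" by (simp add: K_def)
  then have s: "offset Q k \<le> s" if "k \<in> K" for k
    unfolding s_def using that by (intro Max_ge) auto
  have "reducible s (\<Sum>m\<in>Poly_Mapping.keys F. mconst (Poly_Mapping.lookup F m) * Poly_Mapping.single m 1)"
  proof (intro reducible_sum reducible_scale reducible_monomial)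
    fix m assume m: "m \<in> Poly_Mapping.keys F"
    show "0 \<le> vK (Poly_Mapping.lookup F m)" "Poly_Mapping.keys m \<subseteq> Istar"
      using F(1) m vK.carrier_iff by blast+
    show "offset Q k \<le> s" if "k \<in> Poly_Mapping.keys m" for k
      using s m that by (auto simp: K_def)
  qed
  then have "reducible s F"
    by (subst poly_mapping_sum_single) (simp flip: mpoly_single_eq)
  then obtain G where G: "F - G \<in> I1" "\<And>m. m \<in> Poly_Mapping.keys G \<Longrightarrow> digits Q (level_set s) m"
    by (auto simp: reducible_def)
  have "ev G = 0"
    using ev_I1(2)[OF G(1)] F(2) by (simp add: pconst.mpoly_eval_diff)
  then have "G = 0"
    using digits_eval_eq_0[of T "level_set s" G] degree_T level_set G(2) by blast
  with G(1) show ?thesis by simp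
qed

subsection \<open>Integral representations\<close>

definition representable :: "'k poly \<Rightarrow> bool"
  where "representable f \<longleftrightarrow> (\<exists>H\<in>carrier R. ev H = f)"

text \<open>Moving \<open>a k ^ j\<close> into the j-th coefficient leaves powers of
  \<open>T k\<close> of value 0, so the coefficients are integral and of small degree. The degree of
  f itself is unrestricted, which allows the later use for the cofactor of \<open>g\<close>.\<close>

lemma representable_truncation:
  assumes k: "k \<in> Istar" and f: "0 \<le> trunc k f"
    and IH: "\<And>f'. Polynomial.degree f' < deg k \<Longrightarrow> 0 \<le> \<nu> f' \<Longrightarrow> representable f'"
  shows "representable f"
proof -
  let ?F = "q_expansion (Q k) f"
  let ?c = "\<lambda>j. Polynomial.coeff ?F j * [:a k ^ j:]"
  have Qk: "Q k ^ j = [:a k ^ j:] * T k ^ j" for j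
  proof -
    have "Q k = [:a k:] * T k"
      using a_nonzero[OF k] by (simp add: T_Istar[OF k])
    then have "Q k ^ j = [:a k:] ^ j * T k ^ j"
      by (simp only: power_mult_distrib)
    also have "[:a k:] ^ j = [:a k ^ j:]"
      by (induction j) (simp_all add: one_pCons mult.commute)
    finally show ?thesis .
  qed
  have "\<nu> (T k ^ j) = 0" for j
    by (induction j) (simp_all add: mult nu_T[OF k])
  then have "\<nu> (Polynomial.coeff ?F j * Q k ^ j) = \<nu> (?c j)" for j
    unfolding Qk by (simp only: mult add.assoc add_0_right)
  moreover have "0 \<le> \<nu> (Polynomial.coeff ?F j * Q k ^ j)" for j
    using f truncation_ge_iff[OF ring_val_axioms] by blast
  ultimately have "0 \<le> \<nu> (?c j)" for j by simp
  moreover have "Polynomial.degree (?c j) < deg k" for j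
    using degree_mult_le[of "Polynomial.coeff ?F j" "[:a k ^ j:]"]
      degree_coeff_q_expansion[OF Q_degree_pos, of k f j] by simp
  ultimately have "\<exists>H\<in>carrier R. ev H = ?c j" for j
    using IH unfolding representable_def by blast
  then obtain H where H: "\<And>j. H j \<in> carrier R" "\<And>j. ev (H j) = ?c j"
    by metis
  let ?H = "\<Sum>j\<le>Polynomial.degree ?F. H j * Poly_Mapping.single (Poly_Mapping.single k j) 1"
  have "?H \<in> carrier R"
    using k by (intro vK.carrier_sum vK.carrier_mult H vK.carrier_single) auto
  moreover have "ev ?H = (\<Sum>j\<le>Polynomial.degree ?F. ?c j * T k ^ j)"
    unfolding pconst.mpoly_eval_sum pconst.mpoly_eval_mult H(2) pconst.mpoly_eval_single
    by (simp only: monom_eval_single pconst.h_one mult_1)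
  moreover have "\<dots> = (\<Sum>j\<le>Polynomial.degree ?F. Polynomial.coeff ?F j * Q k ^ j)"
    unfolding Qk by (simp only: mult.assoc)
  moreover have "\<dots> = f"
    using poly_q_expansion[OF Q_degree_pos, of k f] by (simp add: poly_altdef)
  ultimately have "ev ?H = f" by (simp only:)
  with \<open>?H \<in> carrier R\<close> show ?thesis
    unfolding representable_def by (rule bexI[rotated])
qed

text \<open>Completeness supplies a key polynomial of degree at most that of f whose truncation
  keeps the value of f; the degree bound by \<open>g\<close> places its index in
  \<open>Istar\<close>, and its expansion coefficients have smaller degree.\<close>

lemma representable_nonneg:
  assumes "Polynomial.degree f < Polynomial.degree g" "0 \<le> \<nu> f"
  shows "representable f"
  using assms
proof (induction "Polynomial.degree f" arbitrary: f rule: less_induct)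
  case less
  show ?case
  proof (cases "Polynomial.degree f = 0")
    case True
    then obtain c where c: "f = [:c:]" by (auto elim: degree_eq_zeroE)
    then have "mconst c \<in> carrier R"
      using less.prems(2) by (intro vK.carrier_mconst) (simp add: nu_const)
    then show ?thesis
      unfolding representable_def c by (intro bexI[of _ "mconst c"]) simp_all
  next
    case False
    then obtain k where k: "deg k \<le> Polynomial.degree f" "trunc k f = \<nu> f"
      using complete_set unfolding complete_set_def by blast
    have "k \<in> Istar"
      using k(1) less.prems(1) Istar_iff[of k] deg_imax by simp
    then show ?thesis
    proof (rule representable_truncation)
      show "0 \<le> trunc k f" using k(2) less.prems(2) by simp
      show "representable f'" if "Polynomial.degree f' < deg k" "0 \<le> \<nu> f'" for f'
        using that k(1) less.prems(1) by (intro less.hyps) simp_all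
    qed
  qed
qed

subsection \<open>The relation ideal\<close>

text \<open>Any index in the last block of \<open>Istar\<close> is related to \<open>imax\<close>:
  through immediate succession if the block is finite, through adjacency of the blocks
  otherwise.\<close>

lemma last_block_pair:
  assumes "finite K" "K \<subseteq> Istar" "(Istar :: 'i set) \<noteq> {}"
  obtains k where "k \<in> Istar" "succ_rel Q k imax" "\<And>j. j \<in> K \<Longrightarrow> j \<le> k"
proof -
  have "deg ` Istar \<subseteq> {..deg imax}"
    using degree_mono[OF le_imax] by auto
  then have fin: "finite (deg ` Istar)" by (rule finite_subset) simp
  have "Max (deg ` Istar) \<in> deg ` Istar"
    using fin assms(3) by (intro Max_in) auto
  then obtain j0 where j0: "Max (deg ` Istar) = deg j0" "j0 \<in> Istar" by (rule imageE)
  have max: "deg j \<le> deg j0" if "j \<in> Istar" for j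
    unfolding j0(1)[symmetric] using fin that by (intro Max_ge) auto
  \<comment> \<open>Including \<open>j0\<close> forces k into the last block of
    \<open>Istar\<close>, whatever K is.\<close>
  define k where "k = Max (insert j0 K)"
  have k: "k \<in> insert j0 K" "\<And>j. j \<in> insert j0 K \<Longrightarrow> j \<le> k"
    unfolding k_def using assms(1) by (intro Max_in, simp_all del: Max_insert)
  then have kI: "k \<in> Istar" using j0(2) assms(2) by blast
  have maxk: "deg j \<le> deg k" if "j \<in> Istar" for j
    using max[OF that] degree_mono[OF k(2)[of j0]] by simp
  have "k < imax" using kI le_imax[of k] by auto
  moreover have "immediate_succ k imax \<or> infinite (block Q (block_index Q k)) \<and>
      block_index Q imax = block_index Q k + 1"
  proof (cases "finite (block Q (block_index Q k))")
    case True
    have "\<not> (k < j \<and> j < imax)" for j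
    proof
      assume j: "k < j \<and> j < imax"
      then have "deg j \<le> deg k" "deg k \<le> deg j"
        using maxk[of j] degree_mono[of k j] j by (simp_all add: order.strict_implies_order order.strict_implies_not_eq)
      then have "deg j = deg k" by simp
      then show False using finite_block(1)[OF True] j by simp
    qed
    then show ?thesis
      using \<open>k < imax\<close> by (auto simp: immediate_succ_def)
  next
    case False
    obtain j where j: "block_index Q j = block_index Q k + 1" "deg k < deg j"
      using degree_plus_attained[OF kI] by metis
    have "j = imax"
      using maxk[of j] j(2) by auto
    with j False show ?thesis by simp
  qed
  ultimately have "succ_rel Q k imax" by (simp add: succ_rel_def)
  with kI k(2) show ?thesis using that by blast
qed

lemma relation_ideal_subset: "relation_ideal \<iota> v \<eta> T \<subseteq> I1 <+>\<^bsub>R\<^esub> I2"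
proof
  fix F assume "F \<in> relation_ideal \<iota> v \<eta> T"
  then have F: "F \<in> carrier R" "ev\<^sub>L F = 0" by (auto simp: relation_ideal_eq)
  have "\<exists>P\<in>I1. \<exists>P'\<in>I2. F = P + P'"
  proof (cases "ev F = 0")
    case True
    then show ?thesis
      using I1_memI[OF F(1)] vK.ideal_zero[OF ideal_I2] by force
  next
    case False
    have "g dvd ev F"
      using F(2) by (intro g_dvd) (simp add: poly_ev)
    then obtain h where h: "ev F = g * h" by (auto simp: dvd_def)
    with False have "h \<noteq> 0" by auto
    \<comment> \<open>Without variables \<open>ev F\<close> would be constant, which a nonzero
      multiple of \<open>g\<close> is not.\<close>
    have Istar: "(Istar :: 'i set) \<noteq> {}"
    proof
      assume "(Istar :: 'i set) = {}"
      then have "Poly_Mapping.keys F \<subseteq> {0}"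
        using F(1) unfolding vK.carrier_iff by auto
      then have "ev F = [:Poly_Mapping.lookup F 0:]"
        using pconst.mpoly_eval_superset[of "{0}" F T] by simp
      then have "Polynomial.degree (g * h) = 0" by (simp flip: h)
      then show False
        using g_degree g_nonzero \<open>h \<noteq> 0\<close> by (simp add: degree_mult_eq)
    qed
    let ?K = "\<Union>m\<in>Poly_Mapping.keys F. Poly_Mapping.keys m"
    have "finite ?K" by simp
    moreover have "?K \<subseteq> Istar"
      using F(1) vK.carrier_iff by blast
    ultimately obtain k where k: "k \<in> Istar" "succ_rel Q k imax" "\<And>j. j \<in> ?K \<Longrightarrow> j \<le> k"
      using last_block_pair[OF _ _ Istar] by metis
    interpret tk: ring_val "trunc k" using trunc_ring_val[OF k(1)] .
    have pair: "neat_pair Q imax k" by (rule neat_pair_imax[OF k(2)])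
    let ?b = "b imax k"
    \<comment> \<open>Every variable of F has index at most k, so its value under the truncation is
      0, and the coefficients are integral.\<close>
    have trunc_F: "0 \<le> trunc k (ev F)"
      unfolding mpoly_eval_def
    proof (rule tk.sum_ge, rule tk.mult_nonneg)
      fix m assume m: "m \<in> Poly_Mapping.keys F"
      show "0 \<le> trunc k [:Poly_Mapping.lookup F m:]"
        using F(1) unfolding trunc_const[OF k(1)] vK.carrier_iff by simp
      show "0 \<le> trunc k (monom_eval T m)"
        unfolding monom_eval_def
      proof (rule tk.prod_nonneg, rule tk.power_nonneg)
        fix j assume "j \<in> Poly_Mapping.keys m"
        then have "j \<le> k" using k(3) m by blast
        then show "0 \<le> trunc k (T j)" using trunc_T[OF k(1)] by simp
      qed
    qed
    obtain x where x: "vK ?b = Fin x" "trunc k (T imax) = Fin (- x)"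
      using value_b[OF pair] .
    \<comment> \<open>Dividing the cofactor by \<open>?b\<close> thus has the same effect on the
      truncation as multiplying it by \<open>g\<close>.\<close>
    have "v (\<iota> (inverse ?b)) = trunc k g"
    proof -
      have "v (\<iota> (inverse ?b)) + Fin x = 0"
        using value_inverse[OF b_nonzero[OF pair]] x(1) by simp
      then show ?thesis
        using x(2) T_imax by (cases "v (\<iota> (inverse ?b))") (auto simp: zero_extended_def eq_neg_iff_add_eq_0)
    qed
    then have "trunc k ([:inverse ?b:] * h) = trunc k (ev F)"
      unfolding h tk.mult trunc_const[OF k(1)] by simp
    with trunc_F have "0 \<le> trunc k ([:inverse ?b:] * h)" by simp
    then have "representable ([:inverse ?b:] * h)"
    proof (rule representable_truncation[OF k(1)])
      show "representable f'" if "Polynomial.degree f' < deg k" "0 \<le> \<nu> f'" for f'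
        using that k(1) Istar_iff[of k] deg_imax by (intro representable_nonneg) simp_all
    qed
    then obtain H where H: "H \<in> carrier R" "ev H = [:inverse ?b:] * h"
      by (auto simp: representable_def)
    let ?P = "H * QQ E b imax k"
    \<comment> \<open>The scalar in \<open>QQ\<close> cancels the one divided out of h, which leaves
      exactly \<open>ev F\<close>.\<close>
    have "ev ?P = ([:inverse ?b:] * [:?b:]) * (g * h)"
      unfolding pconst.mpoly_eval_mult H(2) ev_QQ[OF pair] T_imax by (simp only: ac_simps)
    also have "[:inverse ?b:] * [:?b:] = 1"
      using b_nonzero[OF pair] by (simp add: one_pCons)
    finally have "ev (F - ?P) = 0"
      by (simp only: pconst.mpoly_eval_diff h mult_1 diff_self)
    moreover have "F - ?P \<in> carrier R"
      by (intro vK.carrier_diff vK.carrier_mult F(1) H(1) QQ_carrier pair)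
    ultimately have "F - ?P \<in> I1" by (intro I1_memI)
    moreover have "QQ E b imax k \<in> I2"
      using gens2_subset k by blast
    then have "?P \<in> I2"
      by (rule vK.ideal_mult[OF ideal_I2 _ H(1)])
    ultimately show ?thesis
      by (intro bexI[of _ "F - ?P"] bexI[of _ ?P]) auto
  qed
  then show "F \<in> I1 <+>\<^bsub>R\<^esub> I2"
    by (auto simp: set_add_def')
qed

end

theorem theorem5p18:
  fixes \<iota> :: "'k::field \<Rightarrow> 'l::field"
    and v :: "'l \<Rightarrow> 'g::linordered_ab_group_add extended"
    and \<eta> :: 'l
    and \<nu>bar :: "'k alg_closure poly \<Rightarrow> 'g extended"
    and Q :: "'i::wellorder \<Rightarrow> 'k poly"
    and a :: "'i \<Rightarrow> 'k"
    and E :: "'i \<Rightarrow> 'i \<Rightarrow> (('i \<Rightarrow>\<^sub>0 nat) \<Rightarrow>\<^sub>0 'k)"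
    and b :: "'i \<Rightarrow> 'i \<Rightarrow> 'k"
  assumes "simple_algebraic_extension \<iota> \<eta>"
    and "field_valuation v"
    and "ramification_index \<iota> v = 1"
    and "v \<eta> = 0"
    and "extends_to_closure \<nu>bar (nu \<iota> v \<eta>)"
    and "complete_key_sequence (nu \<iota> v \<eta>) \<nu>bar Q"
    and "normalized \<iota> v \<eta> Q a"
    and "successively_strongly_monic (nu \<iota> v \<eta>) Q"
    and "neat_family (nu \<iota> v \<eta>) (v \<circ> \<iota>) Q (Qtilde \<iota> \<eta> Q a) E"
    and "admissible_scalars (nu \<iota> v \<eta>) (v \<circ> \<iota>) Q (Qtilde \<iota> \<eta> Q a) E b"
  shows "relation_ideal \<iota> v \<eta> (Qtilde \<iota> \<eta> Q a) =
    ideal_I1 (v \<circ> \<iota>) Q E b <+>\<^bsub>OKX (v \<circ> \<iota>)\<^esub> ideal_I2 (v \<circ> \<iota>) Q E b"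
proof -
  interpret neat_key_sequence \<iota> v \<eta> \<nu>bar Q a E b
    using assms by unfold_locales
  show ?thesis
    using relation_ideal_subset ideals_subset by (rule antisym)
qed

end
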